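(* Under the standing assumptions below, let $\bar u^N$ be the process given by $\bar u^N_t=((\mathrm{id}-\overline{\boldsymbol B})^{-1}\overline a)(t)$ with $\overline a,\overline B$ as defined below. Then the $N$-player game has a unique Nash equilibrium, given for $i=1,\dots,N$ by $$\hat u^{i,N}_t=\big((\mathrm{id}-\boldsymbol B)^{-1}a^i\big)(t),\qquad 0\le t\le T,$$ where the operators $\widetilde{\boldsymbol D}_t$ and $\mathrm{id}-\boldsymbol B$ are invertible, $\boldsymbol B$ is the integral operator with kernel $B$, and $$a^i_t:=\frac1{2\lambda}\Big(\mathbb E_t\big[b^i_t+\tfrac1Nb^0_t-((\boldsymbol H+\boldsymbol H^* )\bar u^N)(t)\big]-\Big\langle 1_{\{t\le\cdot\}}\hat K(\cdot,t),\ \widetilde{\boldsymbol D}_t^{-1}1_{\{t\le\cdot\}}\mathbb E_t\big[b^i_\cdot+\tfrac1Nb^0_\cdot-((\boldsymbol H+\boldsymbol H^* )\bar u^N)(\cdot)\big]\Big\rangle_{L^2}\Big),$$ $$B(t,s):=1_{\{s<t\}}\frac1{2\lambda}\Big(\big\langle1_{\{t\le\cdot\}}\hat K(\cdot,t),\ \widetilde{\boldsymbol D}_t^{-1}1_{\{t\le\cdot\}}\hat K(\cdot,s)\big\rangle_{L^2}-\hat K(t,s)\Big),$$ $$\hat K(t,s):=G(t,s)-\tfrac1NH(t,s),\qquad \widetilde{\boldsymbol D}_t:=2\lambda\,\mathrm{id}-\tfrac1N(\boldsymbol H_t+\boldsymbol H_t^* )+\boldsymbol G_t+\boldsymbol 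G_t^*.$$
   Context: Fix $T>0$, an integer $N\ge2$ and a filtered probability space $(\Omega,\mathcal F,\mathbb F=(\mathcal F_t)_{0\le t\le T},\mathbb P)$ satisfying the usual conditions; $\mathbb E_t[\cdot]:=\mathbb E[\cdot\mid\mathcal F_t]$. On $L^2([0,T],\mathbb R)$, $\langle f,g\rangle_{L^2}=\int_0^Tf(s)g(s)\,ds$. A kernel $G\in L^2([0,T]^2,\mathbb R)$ induces the integral operator $(\boldsymbol Gf)(s)=\int_0^TG(s,u)f(u)\,du$; $G^*(s,u):=G(u,s)$ and $\boldsymbol G^*$ is the adjoint operator; $\mathrm{id}$ is the identity operator. A measurable kernel $G$ is Volterra if $G(t,s)=0$ whenever $s\ge t$; it is nonnegative definite if $\int_0^T\int_0^T(G(t,s)+G(s,t))f(s)f(t)\,ds\,dt\ge0$ for all $f\in L^2([0,T],\mathbb R)$. The class $\mathcal G$ consists of the nonnegative definite Volterra kernels $G:[0,T]^2\to\mathbb R_+$ with $\sup_{t\le T}\int_0^T|G(t,s)|^2ds+\sup_{s\le T}\int_0^T|G(t,s)|^2dt<\infty$; an admissible Volterra operator is an integral operator induced by a kernel in $\mathcal G$. For $G\in\mathcal G$ and $t\in[0,T]$, $G_t(s,r):=G(s,r)1_{\{r\ge t\}}$, $\boldsymbol G_t$ is its integral operator and $\boldsymbol G_t^*$ the adjoint of $\boldsymbol G_t$. $\mathcal U$ is the set of $\mathbb F$-progressively measurable real processes $u$ with $\int_0^T\mathbb E[u_s^2]ds<\infty$. Standing assumptions (N-player game): $b^0,b^1,\dots,b^N$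 are progressively measurable processes with $\int_0^T\mathbb E[(b^i_s)^2]ds<\infty$, and $c^1,\dots,c^N$ are integrable random variables. $\boldsymbol A_1,\boldsymbol A_3$ are admissible Volterra operators with kernels $A_1,A_3\in\mathcal G$, and $\boldsymbol A_2=\lambda\,\mathrm{id}+\hat{\boldsymbol A}_2$ with a constant $\lambda>0$ and $\hat{\boldsymbol A}_2$ an admissible Volterra operator with kernel $\hat A_2\in\mathcal G$. For $u^{1,N},\dots,u^{N,N}\in\mathcal U$ set $u^{-i,N}=(u^{j,N})_{j\ne i}$ and $\bar u^N=\frac1N\sum_{j=1}^Nu^{j,N}$. Player $i$'s objective is $$J^{i,N}(u^{i,N};u^{-i,N})=\mathbb E\Big[-\langle\bar u^N,\boldsymbol A_1\bar u^N\rangle_{L^2}-\langle u^{i,N},\boldsymbol A_2u^{i,N}\rangle_{L^2}-\langle u^{i,N},(\boldsymbol A_3+\boldsymbol A_3^* )\bar u^N\rangle_{L^2}+\langle b^i,u^{i,N}\rangle_{L^2}+\langle b^0,\bar u^N\rangle_{L^2}+c^i\Big].$$ A Nash equilibrium is $\hat u^N=(\hat u^{1,N},\dots,\hat u^{N,N})\in\mathcal U^N$ with $J^{i,N}(\hat u^{i,N};\hat u^{-i,N})\ge J^{i,N}(v;\hat u^{-i,N})$ for all $i$ and all $v\in\mathcal U$. Define $\boldsymbol G:=\frac{\boldsymbol A_1}{N^2}+\frac{2\boldsymbol A_3}{N}+\hat{\boldsymbol A}_2$ and $\boldsymbol H:=\frac{\boldsymbol A_1}{N}+\boldsymbol A_3$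 with kernels $G=\frac{A_1}{N^2}+\frac{2A_3}N+\hat A_2$, $H=\frac{A_1}N+A_3$, and $\bar b_t:=\frac1N\sum_{i=1}^Nb^i_t$. Here $\overline K:=\frac{N-1}NH+G$, $\overline{\boldsymbol D}_t:=2\lambda\,\mathrm{id}+\frac{N-1}N(\boldsymbol H_t+\boldsymbol H_t^* )+\boldsymbol G_t+\boldsymbol G_t^*$, $\overline a_t:=\frac1{2\lambda}\big(\bar b_t+\frac1Nb^0_t-\langle1_{\{t\le\cdot\}}\overline K(\cdot,t),\overline{\boldsymbol D}_t^{-1}1_{\{t\le\cdot\}}\mathbb E_t[\bar b_\cdot+\frac1Nb^0_\cdot]\rangle_{L^2}\big)$, and $\overline B(t,s):=1_{\{s<t\}}\frac1{2\lambda}\big(\langle1_{\{t\le\cdot\}}\overline K(\cdot,t),\overline{\boldsymbol D}_t^{-1}1_{\{t\le\cdot\}}\overline K(\cdot,s)\rangle_{L^2}-\overline K(t,s)\big)$, with $\overline{\boldsymbol B}$ the integral operator with kernel $\overline B$. *)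

theory Defs
  imports "HOL-Probability.Probability"
begin

definition usual_filtration :: "'a measure \<Rightarrow> (real \<Rightarrow> 'a measure) \<Rightarrow> real \<Rightarrow> bool" where
  "usual_filtration M F T \<longleftrightarrow>
     (\<forall>t\<in>{0..T}. subalgebra M (F t)) \<and>
     (\<forall>s t. 0 \<le> s \<longrightarrow> s \<le> t \<longrightarrow> t \<le> T \<longrightarrow> sets (F s) \<subseteq> sets (F t)) \<and>
     (\<forall>A Z. Z \<in> null_sets M \<longrightarrow> A \<subseteq> Z \<longrightarrow> A \<in> sets (F 0)) \<and>
     (\<forall>t\<in>{0..<T}. sets (F t) = (\<Inter>s\<in>{t<..T}. sets (F s)))"

definition progressive :: "'a measure \<Rightarrow> (real \<Rightarrow> 'a measure) \<Rightarrow> real \<Rightarrow> (real \<Rightarrow> 'a \<Rightarrow> real) \<Rightarrow> bool" where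
  "progressive M F T u \<longleftrightarrow>
     (\<forall>t\<in>{0..T}. (\<lambda>(s, \<omega>). u s \<omega>) \<in> borel_measurable (restrict_space borel {0..t} \<Otimes>\<^sub>M F t))"

definition admissible :: "'a measure \<Rightarrow> (real \<Rightarrow> 'a measure) \<Rightarrow> real \<Rightarrow> (real \<Rightarrow> 'a \<Rightarrow> real) \<Rightarrow> bool" where
  "admissible M F T u \<longleftrightarrow> progressive M F T u \<and>
     (\<integral>\<^sup>+ s. (\<integral>\<^sup>+ \<omega>. ennreal ((u s \<omega>)\<^sup>2) \<partial>M) \<partial>lebesgue_on {0..T}) < \<infinity>"

definition L2fun :: "real \<Rightarrow> (real \<Rightarrow> real) \<Rightarrow> bool" where
  "L2fun T f \<longleftrightarrow> f \<in> borel_measurable (lebesgue_on {0..T}) \<and>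
                   integrable (lebesgue_on {0..T}) (\<lambda>s. (f s)\<^sup>2)"

definition aeq :: "real \<Rightarrow> (real \<Rightarrow> real) \<Rightarrow> (real \<Rightarrow> real) \<Rightarrow> bool" where
  "aeq T f g \<longleftrightarrow> (AE s in lebesgue_on {0..T}. f s = g s)"

definition ip :: "real \<Rightarrow> (real \<Rightarrow> real) \<Rightarrow> (real \<Rightarrow> real) \<Rightarrow> real" where
  "ip T f g = (\<integral>s. f s * g s \<partial>lebesgue_on {0..T})"

definition kop :: "real \<Rightarrow> (real \<Rightarrow> real \<Rightarrow> real) \<Rightarrow> (real \<Rightarrow> real) \<Rightarrow> (real \<Rightarrow> real)" where
  "kop T K f = (\<lambda>s. \<integral>r. K s r * f r \<partial>lebesgue_on {0..T})"

definition adj :: "(real \<Rightarrow> real \<Rightarrow> real) \<Rightarrow> (real \<Rightarrow> real \<Rightarrow> real)" where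
  "adj K = (\<lambda>s r. K r s)"

definition trunc :: "(real \<Rightarrow> real \<Rightarrow> real) \<Rightarrow> real \<Rightarrow> (real \<Rightarrow> real \<Rightarrow> real)" where
  "trunc K t = (\<lambda>s r. if t \<le> r then K s r else 0)"

definition invertible_op :: "real \<Rightarrow> ((real \<Rightarrow> real) \<Rightarrow> (real \<Rightarrow> real)) \<Rightarrow> bool" where
  "invertible_op T L \<longleftrightarrow>
     (\<forall>f. L2fun T f \<longrightarrow> L2fun T (L f)) \<and>
     (\<forall>f g. L2fun T f \<longrightarrow> L2fun T g \<longrightarrow> aeq T f g \<longrightarrow> aeq T (L f) (L g)) \<and>
     (\<forall>f g. L2fun T f \<longrightarrow> L2fun T g \<longrightarrow> aeq T (L f) (L g) \<longrightarrow> aeq T f g) \<and>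
     (\<forall>g. L2fun T g \<longrightarrow> (\<exists>f. L2fun T f \<and> aeq T (L f) g))"

definition op_inv :: "real \<Rightarrow> ((real \<Rightarrow> real) \<Rightarrow> (real \<Rightarrow> real)) \<Rightarrow> (real \<Rightarrow> real) \<Rightarrow> (real \<Rightarrow> real)" where
  "op_inv T L g = (SOME f. L2fun T f \<and> aeq T (L f) g)"

definition kernel_class :: "real \<Rightarrow> (real \<Rightarrow> real \<Rightarrow> real) \<Rightarrow> bool" where
  "kernel_class T G \<longleftrightarrow>
     (\<lambda>(t, s). G t s) \<in> borel_measurable (lborel \<Otimes>\<^sub>M lborel) \<and>
     (\<forall>t\<in>{0..T}. \<forall>s\<in>{0..T}. 0 \<le> G t s) \<and>
     (\<forall>t\<in>{0..T}. \<forall>s\<in>{0..T}. t \<le> s \<longrightarrow> G t s = 0) \<and>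
     (\<forall>f. L2fun T f \<longrightarrow>
        0 \<le> (\<integral>t. (\<integral>s. (G t s + G s t) * f s * f t \<partial>lebesgue_on {0..T}) \<partial>lebesgue_on {0..T})) \<and>
     (\<exists>C. (\<forall>t\<in>{0..T}. (\<integral>\<^sup>+ s. ennreal ((G t s)\<^sup>2) \<partial>lebesgue_on {0..T}) \<le> C) \<and>
          (\<forall>s\<in>{0..T}. (\<integral>\<^sup>+ t. ennreal ((G t s)\<^sup>2) \<partial>lebesgue_on {0..T}) \<le> C) \<and> C < \<infinity>)"

text \<open>Players are indexed by \<open>1..N\<close>; \<open>b 0\<close> is \<open>b^0\<close>. \<open>A2h\<close> is \<open>\<hat>A_2\<close>, so \<open>A_2 = lam id + A2h\<close>.\<close>
definition payoff ::
  "'a measure \<Rightarrow> real \<Rightarrow> nat \<Rightarrow> real \<Rightarrow> (real \<Rightarrow> real \<Rightarrow> real) \<Rightarrow> (real \<Rightarrow> real \<Rightarrow> real) \<Rightarrow>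
   (real \<Rightarrow> real \<Rightarrow> real) \<Rightarrow> (nat \<Rightarrow> real \<Rightarrow> 'a \<Rightarrow> real) \<Rightarrow> (nat \<Rightarrow> 'a \<Rightarrow> real) \<Rightarrow>
   (nat \<Rightarrow> real \<Rightarrow> 'a \<Rightarrow> real) \<Rightarrow> nat \<Rightarrow> real" where
  "payoff M T N lam A1 A2h A3 b c u i =
     (\<integral>\<omega>. (let ui = (\<lambda>t. u i t \<omega>);
              ub = (\<lambda>t. (\<Sum>j\<in>{1..N}. u j t \<omega>) / real N)
          in - ip T ub (kop T A1 ub)
             - (lam * ip T ui ui + ip T ui (kop T A2h ui))
             - ip T ui (kop T (\<lambda>s r. A3 s r + adj A3 s r) ub)
             + ip T (\<lambda>t. b i t \<omega>) ui + ip T (\<lambda>t. b 0 t \<omega>) ub + c i \<omega>) \<partial>M)"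

definition is_Nash ::
  "'a measure \<Rightarrow> (real \<Rightarrow> 'a measure) \<Rightarrow> real \<Rightarrow> nat \<Rightarrow> real \<Rightarrow> (real \<Rightarrow> real \<Rightarrow> real) \<Rightarrow>
   (real \<Rightarrow> real \<Rightarrow> real) \<Rightarrow> (real \<Rightarrow> real \<Rightarrow> real) \<Rightarrow> (nat \<Rightarrow> real \<Rightarrow> 'a \<Rightarrow> real) \<Rightarrow>
   (nat \<Rightarrow> 'a \<Rightarrow> real) \<Rightarrow> (nat \<Rightarrow> real \<Rightarrow> 'a \<Rightarrow> real) \<Rightarrow> bool" where
  "is_Nash M F T N lam A1 A2h A3 b c u \<longleftrightarrow>
     (\<forall>i\<in>{1..N}. admissible M F T (u i)) \<and>
     (\<forall>i\<in>{1..N}. \<forall>v. admissible M F T v \<longrightarrow>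
        payoff M T N lam A1 A2h A3 b c (u(i := v)) i \<le> payoff M T N lam A1 A2h A3 b c u i)"

definition Gker :: "nat \<Rightarrow> (real \<Rightarrow> real \<Rightarrow> real) \<Rightarrow> (real \<Rightarrow> real \<Rightarrow> real) \<Rightarrow> (real \<Rightarrow> real \<Rightarrow> real) \<Rightarrow> real \<Rightarrow> real \<Rightarrow> real" where
  "Gker N A1 A2h A3 = (\<lambda>t s. A1 t s / (real N)\<^sup>2 + 2 * A3 t s / real N + A2h t s)"

definition Hker :: "nat \<Rightarrow> (real \<Rightarrow> real \<Rightarrow> real) \<Rightarrow> (real \<Rightarrow> real \<Rightarrow> real) \<Rightarrow> real \<Rightarrow> real \<Rightarrow> real" where
  "Hker N A1 A3 = (\<lambda>t s. A1 t s / real N + A3 t s)"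

definition Khat :: "nat \<Rightarrow> (real \<Rightarrow> real \<Rightarrow> real) \<Rightarrow> (real \<Rightarrow> real \<Rightarrow> real) \<Rightarrow> (real \<Rightarrow> real \<Rightarrow> real) \<Rightarrow> real \<Rightarrow> real \<Rightarrow> real" where
  "Khat N A1 A2h A3 = (\<lambda>t s. Gker N A1 A2h A3 t s - Hker N A1 A3 t s / real N)"

definition Kbar :: "nat \<Rightarrow> (real \<Rightarrow> real \<Rightarrow> real) \<Rightarrow> (real \<Rightarrow> real \<Rightarrow> real) \<Rightarrow> (real \<Rightarrow> real \<Rightarrow> real) \<Rightarrow> real \<Rightarrow> real \<Rightarrow> real" where
  "Kbar N A1 A2h A3 = (\<lambda>t s. (real N - 1) / real N * Hker N A1 A3 t s + Gker N A1 A2h A3 t s)"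

definition Dop :: "real \<Rightarrow> real \<Rightarrow> real \<Rightarrow> (real \<Rightarrow> real \<Rightarrow> real) \<Rightarrow> (real \<Rightarrow> real \<Rightarrow> real) \<Rightarrow> real \<Rightarrow> (real \<Rightarrow> real) \<Rightarrow> (real \<Rightarrow> real)" where
  "Dop T lam cc H G t f = (\<lambda>s. 2 * lam * f s
       + cc * (kop T (trunc H t) f s + kop T (adj (trunc H t)) f s)
       + kop T (trunc G t) f s + kop T (adj (trunc G t)) f s)"

definition Dtil :: "real \<Rightarrow> nat \<Rightarrow> real \<Rightarrow> (real \<Rightarrow> real \<Rightarrow> real) \<Rightarrow> (real \<Rightarrow> real \<Rightarrow> real) \<Rightarrow> (real \<Rightarrow> real \<Rightarrow> real) \<Rightarrow> real \<Rightarrow> (real \<Rightarrow> real) \<Rightarrow> (real \<Rightarrow> real)" where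
  "Dtil T N lam A1 A2h A3 = Dop T lam (- 1 / real N) (Hker N A1 A3) (Gker N A1 A2h A3)"

definition Dbar :: "real \<Rightarrow> nat \<Rightarrow> real \<Rightarrow> (real \<Rightarrow> real \<Rightarrow> real) \<Rightarrow> (real \<Rightarrow> real \<Rightarrow> real) \<Rightarrow> (real \<Rightarrow> real \<Rightarrow> real) \<Rightarrow> real \<Rightarrow> (real \<Rightarrow> real) \<Rightarrow> (real \<Rightarrow> real)" where
  "Dbar T N lam A1 A2h A3 = Dop T lam ((real N - 1) / real N) (Hker N A1 A3) (Gker N A1 A2h A3)"

definition Bker :: "real \<Rightarrow> real \<Rightarrow> (real \<Rightarrow> (real \<Rightarrow> real) \<Rightarrow> (real \<Rightarrow> real)) \<Rightarrow> (real \<Rightarrow> real \<Rightarrow> real) \<Rightarrow> real \<Rightarrow> real \<Rightarrow> real" where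
  "Bker T lam D K = (\<lambda>t s. if s < t then
       (ip T (\<lambda>r. if t \<le> r then K r t else 0) (op_inv T (D t) (\<lambda>r. if t \<le> r then K r s else 0))
        - K t s) / (2 * lam)
     else 0)"

definition IminusB :: "real \<Rightarrow> (real \<Rightarrow> real \<Rightarrow> real) \<Rightarrow> (real \<Rightarrow> real) \<Rightarrow> (real \<Rightarrow> real)" where
  "IminusB T B f = (\<lambda>t. f t - kop T B f t)"

text \<open>\<open>a_t = (2 lam)^{-1} (X_t - <1_{t\<le>.} K(.,t), D_t^{-1} 1_{t\<le>.} Y_t(.)>)\<close>, where
  \<open>Y t s\<close> stands for \<open>E_t[f_s]\<close>.\<close>
definition acoef :: "real \<Rightarrow> real \<Rightarrow> (real \<Rightarrow> (real \<Rightarrow> real) \<Rightarrow> (real \<Rightarrow> real)) \<Rightarrow> (real \<Rightarrow> real \<Rightarrow> real) \<Rightarrow>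
    (real \<Rightarrow> 'a \<Rightarrow> real) \<Rightarrow> (real \<Rightarrow> real \<Rightarrow> 'a \<Rightarrow> real) \<Rightarrow> real \<Rightarrow> 'a \<Rightarrow> real" where
  "acoef T lam D K X Y t \<omega> =
     (X t \<omega> - ip T (\<lambda>r. if t \<le> r then K r t else 0)
                     (op_inv T (D t) (\<lambda>r. if t \<le> r then Y t r \<omega> else 0))) / (2 * lam)"

definition cond_version :: "'a measure \<Rightarrow> (real \<Rightarrow> 'a measure) \<Rightarrow> real \<Rightarrow> (real \<Rightarrow> 'a \<Rightarrow> real) \<Rightarrow>
    (real \<Rightarrow> real \<Rightarrow> 'a \<Rightarrow> real) \<Rightarrow> bool" where
  "cond_version M F T f Y \<longleftrightarrow>
     (\<lambda>(t, s, \<omega>). Y t s \<omega>) \<in> borel_measurable (borel \<Otimes>\<^sub>M (borel \<Otimes>\<^sub>M M)) \<and>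
     (AE t in lebesgue_on {0..T}.
        (AE \<omega> in M. Y t t \<omega> = real_cond_exp M (F t) (f t) \<omega>) \<and>
        (AE s in lebesgue_on {t..T}. AE \<omega> in M. Y t s \<omega> = real_cond_exp M (F t) (f s) \<omega>))"

definition fbar :: "nat \<Rightarrow> (nat \<Rightarrow> real \<Rightarrow> 'a \<Rightarrow> real) \<Rightarrow> real \<Rightarrow> 'a \<Rightarrow> real" where
  "fbar N b = (\<lambda>s \<omega>. (\<Sum>j\<in>{1..N}. b j s \<omega>) / real N + b 0 s \<omega> / real N)"

text \<open>The process \<open>\<bar>u^N = (id - \<bar>B)^{-1} \<bar>a\<close>, computed with a version \<open>Ybar\<close> of \<open>E_t[\<bar>b_s + b^0_s/N]\<close>.\<close>
definition ubar_proc :: "real \<Rightarrow> nat \<Rightarrow> real \<Rightarrow> (real \<Rightarrow> real \<Rightarrow> real) \<Rightarrow> (real \<Rightarrow> real \<Rightarrow> real) \<Rightarrow>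
    (real \<Rightarrow> real \<Rightarrow> real) \<Rightarrow> (nat \<Rightarrow> real \<Rightarrow> 'a \<Rightarrow> real) \<Rightarrow> (real \<Rightarrow> real \<Rightarrow> 'a \<Rightarrow> real) \<Rightarrow> real \<Rightarrow> 'a \<Rightarrow> real" where
  "ubar_proc T N lam A1 A2h A3 b Ybar = (\<lambda>t \<omega>.
     op_inv T (IminusB T (Bker T lam (Dbar T N lam A1 A2h A3) (Kbar N A1 A2h A3)))
       (\<lambda>s. acoef T lam (Dbar T N lam A1 A2h A3) (Kbar N A1 A2h A3) (fbar N b) Ybar s \<omega>) t)"

definition fi :: "real \<Rightarrow> nat \<Rightarrow> (real \<Rightarrow> real \<Rightarrow> real) \<Rightarrow> (real \<Rightarrow> real \<Rightarrow> real) \<Rightarrow>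
    (nat \<Rightarrow> real \<Rightarrow> 'a \<Rightarrow> real) \<Rightarrow> (real \<Rightarrow> 'a \<Rightarrow> real) \<Rightarrow> nat \<Rightarrow> real \<Rightarrow> 'a \<Rightarrow> real" where
  "fi T N A1 A3 b ub i = (\<lambda>s \<omega>. b i s \<omega> + b 0 s \<omega> / real N
       - kop T (\<lambda>s r. Hker N A1 A3 s r + adj (Hker N A1 A3) s r) (\<lambda>r. ub r \<omega>) s)"

text \<open>\<open>a^i\<close> computed with a version \<open>Y\<close> of \<open>E_t[fi_s]\<close> (diagonal \<open>Y t t\<close> is \<open>E_t[fi_t]\<close>).\<close>
definition ai_proc :: "real \<Rightarrow> nat \<Rightarrow> real \<Rightarrow> (real \<Rightarrow> real \<Rightarrow> real) \<Rightarrow> (real \<Rightarrow> real \<Rightarrow> real) \<Rightarrow>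
    (real \<Rightarrow> real \<Rightarrow> real) \<Rightarrow> (real \<Rightarrow> real \<Rightarrow> 'a \<Rightarrow> real) \<Rightarrow> real \<Rightarrow> 'a \<Rightarrow> real" where
  "ai_proc T N lam A1 A2h A3 Y =
     acoef T lam (Dtil T N lam A1 A2h A3) (Khat N A1 A2h A3) (\<lambda>t \<omega>. Y t t \<omega>) Y"

end

(* Player i's first-order condition is a linear equation
     E_t[(2 lam u + Ku + K*u - f)(t)] = 0 for almost every t,
   where K is Khat and f contains the average of all strategies; averaging over i gives the
   same equation for the average, with Kbar in place of Khat.
   A solution exists by minimising a coercive quadratic energy over the progressive
   square-integrable processes. For uniqueness and the explicit formula, freeze t: on [t,T] the
   path r |-> E_t[u_r] solves an equation with the coercive operator D_t, so that this path can
   be eliminated. What remains is the pathwise Volterra equation (id - B)u = a, and a Volterra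
   operator with kernel bounded in L2 by rows has a contracting power. *)

theory Submission
  imports Defs
begin

section \<open>Square-integrable functions and coercive equations\<close>

text \<open>The formula cannot serve as the candidate: \<open>op_inv\<close> is an arbitrary choice
  made path by path, so nothing is known about its measurability in the scenario. The energy
  minimiser is progressive by construction, and the formula is then proved to be the same class of
  paths.

  Coercivity is hidden in the signs. Although \<open>Khat\<close> is defined as a difference, G -
  H/N = A3/N + A2h, and (N-1)/N H + G = H + \<open>Khat\<close>; so both kernels are sums of
  nonnegative definite ones and one argument covers both.

  The coupling is undone through the average. Let w solve the averaged equation and let each player
  respond to w instead of the true average. The mean of the responses solves the \<open>Khat\<close>
  equation with w frozen in the right-hand side, and so does w; uniqueness makes them equal, and the
  responses form an equilibrium.

  Most of the labour is null sets. E_t[f_s] needs versions jointly measurable in t, s and the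
  scenario; exceptional sets depending on times must become one null set of scenarios before paths
  can be treated; and inverses are shown measurable in t as limits of explicit iterations.\<close>

definition sq_int :: "'a measure \<Rightarrow> ('a \<Rightarrow> real) \<Rightarrow> bool" where
  "sq_int M f \<longleftrightarrow> f \<in> borel_measurable M \<and> integrable M (\<lambda>x. (f x)\<^sup>2)"

lemma sq_int_measurable [measurable_dest]: "sq_int M f \<Longrightarrow> f \<in> borel_measurable M"
  by (simp add: sq_int_def)

lemma sq_intD: "sq_int M f \<Longrightarrow> integrable M (\<lambda>x. (f x)\<^sup>2)"
  by (simp add: sq_int_def)

lemma sq_int_bound:
  assumes "integrable M h" "f \<in> borel_measurable M" "\<And>x. x \<in> space M \<Longrightarrow> (f x)\<^sup>2 \<le> h x"
  shows "sq_int M f"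
proof -
  have "integrable M (\<lambda>x. (f x)\<^sup>2)"
  proof (rule Bochner_Integration.integrable_bound[OF assms(1)])
    show "AE x in M. norm ((f x)\<^sup>2) \<le> norm (h x)"
      by (rule AE_I2) (simp only: real_norm_def abs_power2 order_trans[OF assms(3) abs_ge_self])
  qed (use assms in measurable)
  then show ?thesis using assms by (simp add: sq_int_def)
qed

lemma sq_int_cong_AE:
  assumes "sq_int M f" "g \<in> borel_measurable M" "AE x in M. f x = g x"
  shows "sq_int M g"
proof -
  have [measurable]: "f \<in> borel_measurable M" "g \<in> borel_measurable M" using assms by (auto simp: sq_int_def)
  have "integrable M (\<lambda>x. (g x)\<^sup>2) = integrable M (\<lambda>x. (f x)\<^sup>2)"
    by (rule integrable_cong_AE) (use assms(3) in auto)
  then show ?thesis using assms by (simp add: sq_int_def)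
qed

lemma sq_int_mult_integrable:
  assumes "sq_int M f" "sq_int M g"
  shows "integrable M (\<lambda>x. f x * g x)"
proof (rule Bochner_Integration.integrable_bound)
  show "integrable M (\<lambda>x. (f x)\<^sup>2 + (g x)\<^sup>2)"
    using assms by (auto simp: sq_int_def)
  show "(\<lambda>x. f x * g x) \<in> borel_measurable M" using assms by measurable
  show "AE x in M. norm (f x * g x) \<le> norm ((f x)\<^sup>2 + (g x)\<^sup>2)"
  proof (rule AE_I2)
    fix x
    have "2 * \<bar>f x\<bar> * \<bar>g x\<bar> \<le> (f x)\<^sup>2 + (g x)\<^sup>2"
      using sum_squares_bound[of "\<bar>f x\<bar>" "\<bar>g x\<bar>"] by simp
    moreover have "0 \<le> \<bar>f x\<bar> * \<bar>g x\<bar>" by simp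
    ultimately have "\<bar>f x * g x\<bar> \<le> (f x)\<^sup>2 + (g x)\<^sup>2" unfolding abs_mult by linarith
    then show "norm (f x * g x) \<le> norm ((f x)\<^sup>2 + (g x)\<^sup>2)" by simp
  qed
qed

lemma sq_int_zero [simp]: "sq_int M (\<lambda>x. 0)"
  by (simp add: sq_int_def)

lemma sq_int_cmult: "sq_int M f \<Longrightarrow> sq_int M (\<lambda>x. c * f x)"
  by (auto simp: sq_int_def power_mult_distrib)

lemma sq_int_add:
  assumes "sq_int M f" "sq_int M g"
  shows "sq_int M (\<lambda>x. f x + g x)"
proof -
  have "(\<lambda>x. (f x + g x)\<^sup>2) = (\<lambda>x. (f x)\<^sup>2 + (g x)\<^sup>2 + 2 * (f x * g x))"
    by (auto simp: power2_eq_square algebra_simps)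
  moreover have "integrable M (\<lambda>x. (f x)\<^sup>2 + (g x)\<^sup>2 + 2 * (f x * g x))"
    using assms sq_int_mult_integrable[OF assms] by (auto simp: sq_int_def)
  ultimately show ?thesis using assms by (auto simp: sq_int_def intro: borel_measurable_add)
qed

lemma sq_int_diff:
  assumes "sq_int M f" "sq_int M g"
  shows "sq_int M (\<lambda>x. f x - g x)"
  using sq_int_add[OF assms(1) sq_int_cmult[OF assms(2), of "-1"]] by simp

lemma sq_int_sum:
  assumes "\<And>i. i \<in> A \<Longrightarrow> sq_int M (f i)"
  shows "sq_int M (\<lambda>x. \<Sum>i\<in>A. f i x)"
  using assms by (induction A rule: infinite_finite_induct) (auto intro: sq_int_add)

lemma sq_int_divide: "sq_int M f \<Longrightarrow> sq_int M (\<lambda>x. f x / c)"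
  using sq_int_cmult[of M f "1/c"] by simp

lemma sq_int_restrict:
  assumes "sq_int M f" "A \<in> sets M"
  shows "sq_int M (\<lambda>x. if x \<in> A then f x else 0)"
proof (rule sq_int_bound)
  show "integrable M (\<lambda>x. (f x)\<^sup>2)" using assms by (simp add: sq_int_def)
qed (use assms in \<open>auto\<close>)

text \<open>Serves three purposes: Cauchy-Schwarz, the vanishing of the energy gradient along a
  minimising sequence, and, with \<open>a = 0\<close>, the first-order condition of a player. The
  sign of \<open>c\<close> is part of what is derived.\<close>

lemma quadratic_nonneg_discriminant:
  fixes a b c :: real
  assumes "\<And>s. 0 \<le> a + 2 * s * b + s\<^sup>2 * c"
  shows "b\<^sup>2 \<le> a * c"
proof (cases "c = 0")
  case True
  have "b = 0"
  proof (rule ccontr)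
    assume "b \<noteq> 0"
    \<comment> \<open>At this \<open>s\<close> the expression, which is affine for
      \<open>c = 0\<close>, equals -1.\<close>
    with assms[of "- (a + 1) / (2 * b)"] True show False by (simp add: field_simps)
  qed
  then show ?thesis using True by simp
next
  case False
  have "0 \<le> c"
  proof (rule ccontr)
    assume "\<not> 0 \<le> c"
    then have c: "c < 0" by simp
    \<comment> \<open>Chosen so that \<open>s * (-c)\<close> exceeds
      \<open>\<bar>a\<bar> + 2 * \<bar>b\<bar>\<close> while \<open>s\<close> is at least 1; the
      negative quadratic term then beats the other two.\<close>
    define s where "s = 1 + \<bar>a\<bar> / (-c) + 2 * \<bar>b\<bar> / (-c)"
    have p: "\<bar>a\<bar> / (-c) \<ge> 0" "2 * \<bar>b\<bar> / (-c) \<ge> 0" using c by (auto simp: divide_nonneg_neg)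
    have s1: "s \<ge> 1" unfolding s_def using p by linarith
    have sc: "s * (-c) = (-c) + \<bar>a\<bar> + 2 * \<bar>b\<bar>" using c by (simp add: s_def field_simps)
    have "s\<^sup>2 * (-c) = s * (s * (-c))" by (simp add: power2_eq_square)
    also have "\<dots> = s * ((-c) + \<bar>a\<bar> + 2 * \<bar>b\<bar>)" by (simp only: sc)
    also have "\<dots> = s * (-c) + s * \<bar>a\<bar> + 2 * s * \<bar>b\<bar>" by (simp add: algebra_simps)
    also have "\<dots> > \<bar>a\<bar> + 2 * s * \<bar>b\<bar>"
    proof -
      have "s * (-c) > 0" using s1 c by (intro mult_pos_pos) auto
      moreover have "s * \<bar>a\<bar> \<ge> \<bar>a\<bar>" using s1 by (simp add: mult_le_cancel_right1)
      ultimately show ?thesis by linarith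
    qed
    finally have "s\<^sup>2 * (-c) > \<bar>a\<bar> + 2 * s * \<bar>b\<bar>" .
    moreover have "2 * s * b \<le> 2 * s * \<bar>b\<bar>" using s1 by (intro mult_left_mono) auto
    ultimately have "a + 2 * s * b + s\<^sup>2 * c < 0" by (simp add: abs_if split: if_splits)
    with assms[of s] show False by simp
  qed
  with False have c: "c > 0" by simp
  \<comment> \<open>The minimiser of the quadratic.\<close>
  have "0 \<le> a + 2 * (- b / c) * b + (- b / c)\<^sup>2 * c" by (rule assms)
  also have "\<dots> = a - b\<^sup>2 / c" using c by (simp add: power2_eq_square field_simps)
  finally show ?thesis using c by (simp add: field_simps)
qed

section \<open>Cauchy-Schwarz and completeness in L2\<close>

lemma integral_square_add_scaled:
  assumes "sq_int M f" "sq_int M g"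
  shows "(\<integral>x. (f x + s * g x)\<^sup>2 \<partial>M) = (\<integral>x. (f x)\<^sup>2 \<partial>M) + 2 * s * (\<integral>x. f x * g x \<partial>M) + s\<^sup>2 * (\<integral>x. (g x)\<^sup>2 \<partial>M)"
proof -
  have "(\<integral>x. (f x + s * g x)\<^sup>2 \<partial>M) = (\<integral>x. (f x)\<^sup>2 + 2 * s * (f x * g x) + s\<^sup>2 * (g x)\<^sup>2 \<partial>M)"
    by (rule Bochner_Integration.integral_cong) (auto simp: power2_eq_square algebra_simps)
  also have "\<dots> = (\<integral>x. (f x)\<^sup>2 \<partial>M) + 2 * s * (\<integral>x. f x * g x \<partial>M) + s\<^sup>2 * (\<integral>x. (g x)\<^sup>2 \<partial>M)"
    using sq_int_mult_integrable[OF assms] assms by (simp add: sq_int_def)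
  finally show ?thesis .
qed

lemma Cauchy_Schwarz_integral:
  assumes "sq_int M f" "sq_int M g"
  shows "(\<integral>x. f x * g x \<partial>M)\<^sup>2 \<le> (\<integral>x. (f x)\<^sup>2 \<partial>M) * (\<integral>x. (g x)\<^sup>2 \<partial>M)"
proof (rule quadratic_nonneg_discriminant)
  fix s :: real
  have "0 \<le> (\<integral>x. (f x + s * g x)\<^sup>2 \<partial>M)" by simp
  then show "0 \<le> (\<integral>x. (f x)\<^sup>2 \<partial>M) + 2 * s * (\<integral>x. f x * g x \<partial>M) + s\<^sup>2 * (\<integral>x. (g x)\<^sup>2 \<partial>M)"
    by (simp add: integral_square_add_scaled[OF assms])
qed

lemma integral_square_add_le:
  assumes "sq_int M f" "sq_int M g"
  shows "(\<integral>x. (f x + g x)\<^sup>2 \<partial>M) \<le> 2 * (\<integral>x. (f x)\<^sup>2 \<partial>M) + 2 * (\<integral>x. (g x)\<^sup>2 \<partial>M)"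
proof -
  have "(\<integral>x. (f x + g x)\<^sup>2 \<partial>M) \<le> (\<integral>x. 2 * (f x)\<^sup>2 + 2 * (g x)\<^sup>2 \<partial>M)"
  proof (rule integral_mono)
    show "integrable M (\<lambda>x. (f x + g x)\<^sup>2)" using sq_int_add[OF assms] by (simp add: sq_int_def)
    show "integrable M (\<lambda>x. 2 * (f x)\<^sup>2 + 2 * (g x)\<^sup>2)" using assms by (simp add: sq_int_def)
    show "(f x + g x)\<^sup>2 \<le> 2 * (f x)\<^sup>2 + 2 * (g x)\<^sup>2" for x
      using sum_squares_bound[of "f x" "g x"] by (simp add: power2_eq_square algebra_simps)
  qed
  then show ?thesis using assms by (simp add: sq_int_def)
qed

lemma integral_square_eq_0_AE:
  assumes "sq_int M f" "(\<integral>x. (f x)\<^sup>2 \<partial>M) \<le> 0"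
  shows "AE x in M. f x = 0"
proof -
  have "(\<integral>x. (f x)\<^sup>2 \<partial>M) = 0" using assms(2) by (intro antisym) auto
  then have "AE x in M. (f x)\<^sup>2 = 0"
    using integral_nonneg_eq_0_iff_AE[of M "\<lambda>x. (f x)\<^sup>2"] assms(1) by (auto simp: sq_int_def)
  then show ?thesis by auto
qed

lemma geometric_sum_le:
  fixes x :: real
  assumes "0 \<le> x" "x < 1" "m \<le> n"
  shows "(\<Sum>i=m..<n. x ^ i) \<le> x ^ m / (1 - x)"
proof -
  have "(\<Sum>i=m..<n. x ^ i) * (1 - x) = x ^ m - x ^ n"
    using assms(3)
  proof (induction rule: dec_induct)
    case (step k)
    have "(\<Sum>i=m..<Suc k. x ^ i) * (1 - x) = (\<Sum>i=m..<k. x ^ i) * (1 - x) + x ^ k * (1 - x)"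
      using step.hyps by (simp add: distrib_right)
    also have "\<dots> = x ^ m - x ^ Suc k" unfolding step.IH by (simp add: algebra_simps)
    finally show ?case .
  qed simp
  then have "(\<Sum>i=m..<n. x ^ i) = (x ^ m - x ^ n) / (1 - x)"
    using assms(2) by (simp add: eq_divide_eq)
  also have "\<dots> \<le> x ^ m / (1 - x)"
    using assms by (intro divide_right_mono) auto
  finally show ?thesis .
qed

text \<open>Completeness with an explicit limit: geometric steps force almost sure convergence, so
  the limit in mean square may be taken to be the pointwise \<open>lim\<close>. This is what later
  lets a limit inherit progressive measurability. The steps are weighted by powers of
  \<open>r\<close>; the weighted squares have an integrable sum \<open>S\<close>, and Cauchy-Schwarz
  on the telescoping sum bounds every tail by a multiple of \<open>S\<close>.\<close>

lemma sq_int_geometric_limit: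
  fixes f :: "nat \<Rightarrow> 'a \<Rightarrow> real"
  assumes f: "\<And>n. sq_int M (f n)"
    and d: "\<And>n. (\<integral>x. (f (Suc n) x - f n x)\<^sup>2 \<partial>M) \<le> C * q ^ n"
    and q: "0 \<le> q" "q < 1"
  shows "sq_int M (\<lambda>x. lim (\<lambda>n. f n x))"
    and "(\<lambda>n. \<integral>x. (f n x - lim (\<lambda>n. f n x))\<^sup>2 \<partial>M) \<longlonglongrightarrow> 0"
proof -
  \<comment> \<open>The maximum keeps the ratio positive, so that division by \<open>r ^ n\<close>
    is possible. With \<open>r\<close> the fourth root, weighting costs \<open>r ^ (2 * n)\<close>
    out of \<open>r ^ (4 * n)\<close>, and what remains is still summable.\<close>
  define p where "p = max q (1/16)"
  define r where "r = sqrt (sqrt p)"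
  have r: "0 < r" "r < 1" "r ^ 4 = p"
    using q by (auto simp: r_def p_def) (simp add: numeral_eq_Suc power_mult[symmetric] ac_simps)
  have r2: "(r\<^sup>2)\<^sup>2 = p" using r(3) by (simp add: power_mult[symmetric])
  have C: "0 \<le> C"
  proof -
    have "0 \<le> (\<integral>x. (f (Suc 0) x - f 0 x)\<^sup>2 \<partial>M)" by simp
    with d[of 0] show ?thesis by (simp only: power_0 mult_1_right)
  qed
  have [measurable]: "\<And>n. f n \<in> borel_measurable M" using f by (simp add: sq_int_def)
  define g where "g n x = ((f (Suc n) x - f n x) / r ^ n)\<^sup>2" for n x
  have gI: "integrable M (g n)" for n
    unfolding g_def using sq_int_divide[OF sq_int_diff[OF f f]] by (simp add: sq_int_def)
  have g0: "0 \<le> g n x" for n x by (simp add: g_def)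
  have [measurable]: "g n \<in> borel_measurable M" for n unfolding g_def by measurable
  have gint: "(\<integral>x. g n x \<partial>M) \<le> C * (r\<^sup>2) ^ n" for n
  proof -
    have "(\<integral>x. g n x \<partial>M) = (\<integral>x. (f (Suc n) x - f n x)\<^sup>2 \<partial>M) / (r\<^sup>2) ^ n"
      by (simp add: g_def power_divide power_mult[symmetric] mult.commute)
    also have "\<dots> \<le> C * p ^ n / (r\<^sup>2) ^ n"
    proof (rule divide_right_mono)
      have "C * q ^ n \<le> C * p ^ n" using q C by (intro mult_left_mono power_mono) (auto simp: p_def)
      then show "(\<integral>x. (f (Suc n) x - f n x)\<^sup>2 \<partial>M) \<le> C * p ^ n" using d[of n] by linarith
    qed (use r in auto)
    also have "\<dots> = C * (r\<^sup>2) ^ n"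
      using r by (simp add: r2[symmetric] power2_eq_square power_mult_distrib)
    finally show ?thesis .
  qed
  have sums: "summable (\<lambda>n. C * (r\<^sup>2) ^ n)"
    using r by (intro summable_mult summable_geometric) (simp add: power_less_one_iff abs_square_less_1)
  have gsum: "summable (\<lambda>n. \<integral>x. norm (g n x) \<partial>M)"
    by (rule summable_comparison_test'[OF sums, of 0]) (use gint g0 in \<open>auto simp: integral_nonneg\<close>)
  have fin: "AE x in M. summable (\<lambda>n. g n x)"
  proof -
    have "(\<integral>\<^sup>+x. (\<Sum>n. ennreal (g n x)) \<partial>M) = (\<Sum>n. \<integral>\<^sup>+x. ennreal (g n x) \<partial>M)"
      by (rule nn_integral_suminf) (use gI in \<open>auto simp: g_def\<close>)
    also have "\<dots> = (\<Sum>n. ennreal (\<integral>x. g n x \<partial>M))"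
      by (simp add: nn_integral_eq_integral[OF gI] g0)
    also have "\<dots> = ennreal (\<Sum>n. \<integral>x. g n x \<partial>M)"
      by (rule suminf_ennreal2) (use gsum g0 in auto)
    also have "\<dots> < \<infinity>" by simp
    finally have "(\<integral>\<^sup>+x. (\<Sum>n. ennreal (g n x)) \<partial>M) \<noteq> \<infinity>" by simp
    then have "AE x in M. (\<Sum>n. ennreal (g n x)) \<noteq> \<infinity>"
      by (rule nn_integral_PInf_AE[rotated]) measurable
    then show ?thesis
      by (rule AE_mp) (auto intro!: AE_I2 summable_suminf_not_top simp: g0)
  qed
  define S where "S x = (\<Sum>n. g n x)" for x
  have SI: "integrable M S"
    unfolding S_def by (rule integrable_suminf[OF gI]) (use fin gsum g0 in auto)
  have r21: "r\<^sup>2 < 1" using r(1,2) by (simp add: power_less_one_iff)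
  have key: "(f n x - f m x)\<^sup>2 \<le> (r\<^sup>2) ^ m / (1 - r\<^sup>2) * S x"
    if "summable (\<lambda>n. g n x)" "m \<le> n" for m n x
  proof -
    have "f n x - f m x = (\<Sum>i=m..<n. f (Suc i) x - f i x)"
      using sum_Suc_diff'[OF that(2), of "\<lambda>i. f i x"] by simp
    also have "\<dots> = (\<Sum>i=m..<n. r ^ i * ((f (Suc i) x - f i x) / r ^ i))"
      using r(1) by (intro sum.cong) auto
    finally have "(f n x - f m x)\<^sup>2 = (\<Sum>i=m..<n. r ^ i * ((f (Suc i) x - f i x) / r ^ i))\<^sup>2"
      by (rule arg_cong)
    also have "\<dots> \<le> (\<Sum>i=m..<n. (r ^ i)\<^sup>2) * (\<Sum>i=m..<n. ((f (Suc i) x - f i x) / r ^ i)\<^sup>2)"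
      by (rule Cauchy_Schwarz_ineq_sum)
    also have "\<dots> \<le> (r\<^sup>2) ^ m / (1 - r\<^sup>2) * S x"
    proof (rule mult_mono)
      have "(\<Sum>i=m..<n. (r ^ i)\<^sup>2) = (\<Sum>i=m..<n. (r\<^sup>2) ^ i)"
        by (intro sum.cong refl) (metis power_mult mult.commute)
      also have "\<dots> \<le> (r\<^sup>2) ^ m / (1 - r\<^sup>2)"
        using that(2) r21 by (intro geometric_sum_le) auto
      finally show "(\<Sum>i=m..<n. (r ^ i)\<^sup>2) \<le> (r\<^sup>2) ^ m / (1 - r\<^sup>2)" .
      show "(\<Sum>i=m..<n. ((f (Suc i) x - f i x) / r ^ i)\<^sup>2) \<le> S x"
        unfolding S_def g_def[symmetric] by (rule sum_le_suminf[OF that(1)]) (simp_all add: g0)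
      show "0 \<le> (r\<^sup>2) ^ m / (1 - r\<^sup>2)" using r21 by auto
    qed (auto intro: sum_nonneg)
    finally show ?thesis .
  qed
  have "(\<lambda>m. (r\<^sup>2) ^ m) \<longlonglongrightarrow> 0" by (rule LIMSEQ_power_zero) (simp only: real_norm_def abs_power2 r21)
  then have rlim: "(\<lambda>m. (r\<^sup>2) ^ m / (1 - r\<^sup>2) * c) \<longlonglongrightarrow> 0" for c
    by (intro tendsto_mult_left_zero tendsto_divide_zero)
  have Cau: "(\<lambda>n. f n x) \<longlonglongrightarrow> lim (\<lambda>n. f n x)" if sx: "summable (\<lambda>n. g n x)" for x
  proof -
    have "Cauchy (\<lambda>n. f n x)"
    proof (rule metric_CauchyI)
      fix e :: real assume e: "0 < e"
      have "eventually (\<lambda>m. (r\<^sup>2) ^ m / (1 - r\<^sup>2) * S x < (e/2)\<^sup>2) sequentially"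
        using e by (intro order_tendstoD(2)[OF rlim]) simp
      then obtain m where m: "(r\<^sup>2) ^ m / (1 - r\<^sup>2) * S x < (e/2)\<^sup>2" by (auto simp: eventually_sequentially)
      have *: "\<bar>f n x - f m x\<bar> < e/2" if "n \<ge> m" for n
      proof -
        have "(f n x - f m x)\<^sup>2 < (e/2)\<^sup>2" using key[OF sx that] m by linarith
        then have "\<bar>f n x - f m x\<bar>\<^sup>2 < (e/2)\<^sup>2" by (simp only: power2_abs)
        then show ?thesis using e by (intro power2_less_imp_less[of _ "e/2"]) auto
      qed
      show "\<exists>N. \<forall>k\<ge>N. \<forall>n\<ge>N. dist (f k x) (f n x) < e"
      proof (intro exI[of _ m] allI impI)
        fix k n assume "m \<le> k" "m \<le> n"
        then show "dist (f k x) (f n x) < e" using *[of k] *[of n] unfolding dist_real_def by linarith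
      qed
    qed
    then show ?thesis using real_Cauchy_convergent convergent_LIMSEQ_iff by blast
  qed
  have key2: "(f m x - lim (\<lambda>n. f n x))\<^sup>2 \<le> (r\<^sup>2) ^ m / (1 - r\<^sup>2) * S x" if sx: "summable (\<lambda>n. g n x)" for m x
  proof (rule LIMSEQ_le_const2)
    show "(\<lambda>n. (f n x - f m x)\<^sup>2) \<longlonglongrightarrow> (f m x - lim (\<lambda>n. f n x))\<^sup>2"
      unfolding power2_commute[of "f m x"] by (intro tendsto_intros Cau[OF sx])
    show "\<exists>N. \<forall>n\<ge>N. (f n x - f m x)\<^sup>2 \<le> (r\<^sup>2) ^ m / (1 - r\<^sup>2) * S x" using key[OF sx] by auto
  qed
  \<comment> \<open>\<open>lim\<close> is total, so measurability holds everywhere; its values off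
    the convergence set lie in a null set.\<close>
  have meas[measurable]: "(\<lambda>x. lim (\<lambda>n. f n x)) \<in> borel_measurable M"
    by (rule borel_measurable_lim_metric) simp
  have dI: "integrable M (\<lambda>x. (f m x - lim (\<lambda>n. f n x))\<^sup>2)" for m
  proof (rule Bochner_Integration.integrable_bound)
    show "integrable M (\<lambda>x. (r\<^sup>2) ^ m / (1 - r\<^sup>2) * S x)" using SI by simp
    show "AE x in M. norm ((f m x - lim (\<lambda>n. f n x))\<^sup>2) \<le> norm ((r\<^sup>2) ^ m / (1 - r\<^sup>2) * S x)"
      by (rule eventually_mono[OF fin]) (simp only: real_norm_def abs_power2, rule order_trans[OF key2 abs_ge_self])
  qed measurable
  have dsq: "sq_int M (\<lambda>x. f 0 x - lim (\<lambda>n. f n x))" using dI by (simp add: sq_int_def)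
  show "sq_int M (\<lambda>x. lim (\<lambda>n. f n x))" using sq_int_diff[OF f[of 0] dsq] by simp
  show "(\<lambda>n. \<integral>x. (f n x - lim (\<lambda>n. f n x))\<^sup>2 \<partial>M) \<longlonglongrightarrow> 0"
  proof (rule tendsto_sandwich[OF _ _ tendsto_const])
    show "(\<lambda>m. (r\<^sup>2) ^ m / (1 - r\<^sup>2) * (\<integral>x. S x \<partial>M)) \<longlonglongrightarrow> 0" by (rule rlim)
    show "\<forall>\<^sub>F m in sequentially. (\<integral>x. (f m x - lim (\<lambda>n. f n x))\<^sup>2 \<partial>M) \<le> (r\<^sup>2) ^ m / (1 - r\<^sup>2) * (\<integral>x. S x \<partial>M)"
    proof (intro always_eventually allI)
      fix m
      have "(\<integral>x. (f m x - lim (\<lambda>n. f n x))\<^sup>2 \<partial>M) \<le> (\<integral>x. (r\<^sup>2) ^ m / (1 - r\<^sup>2) * S x \<partial>M)"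
        by (rule integral_mono_AE[OF dI integrable_mult_right[OF SI] eventually_mono[OF fin key2]])
      then show "(\<integral>x. (f m x - lim (\<lambda>n. f n x))\<^sup>2 \<partial>M) \<le> (r\<^sup>2) ^ m / (1 - r\<^sup>2) * (\<integral>x. S x \<partial>M)" by simp
    qed
  qed auto
qed

lemma tendsto_integral_mult_sq_int:
  assumes "\<And>n. sq_int M (f n)" "sq_int M F" "sq_int M g"
    and lim: "(\<lambda>n. \<integral>x. (f n x - F x)\<^sup>2 \<partial>M) \<longlonglongrightarrow> 0"
  shows "(\<lambda>n. \<integral>x. f n x * g x \<partial>M) \<longlonglongrightarrow> (\<integral>x. F x * g x \<partial>M)"
proof -
  have *: "(\<integral>x. f n x * g x \<partial>M) - (\<integral>x. F x * g x \<partial>M) = (\<integral>x. (f n x - F x) * g x \<partial>M)" for n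
    using sq_int_mult_integrable[OF assms(1)[of n] assms(3)] sq_int_mult_integrable[OF assms(2,3)]
    by (simp add: left_diff_distrib)
  have "(\<lambda>n. (\<integral>x. (f n x - F x) * g x \<partial>M)\<^sup>2) \<longlonglongrightarrow> 0"
  proof (rule tendsto_sandwich[OF _ _ tendsto_const])
    have "(\<lambda>n. (\<integral>x. (f n x - F x)\<^sup>2 \<partial>M) * (\<integral>x. (g x)\<^sup>2 \<partial>M)) \<longlonglongrightarrow> 0 * (\<integral>x. (g x)\<^sup>2 \<partial>M)"
      by (intro tendsto_intros lim)
    then show "(\<lambda>n. (\<integral>x. (f n x - F x)\<^sup>2 \<partial>M) * (\<integral>x. (g x)\<^sup>2 \<partial>M)) \<longlonglongrightarrow> 0" by simp
    show "\<forall>\<^sub>F n in sequentially. (\<integral>x. (f n x - F x) * g x \<partial>M)\<^sup>2 \<le> (\<integral>x. (f n x - F x)\<^sup>2 \<partial>M) * (\<integral>x. (g x)\<^sup>2 \<partial>M)"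
      by (intro always_eventually allI Cauchy_Schwarz_integral sq_int_diff assms)
  qed auto
  then have "(\<lambda>n. sqrt ((\<integral>x. (f n x - F x) * g x \<partial>M)\<^sup>2)) \<longlonglongrightarrow> sqrt 0"
    by (rule tendsto_real_sqrt)
  then have "(\<lambda>n. \<integral>x. (f n x - F x) * g x \<partial>M) \<longlonglongrightarrow> 0"
    by (simp add: tendsto_rabs_zero_iff)
  then show ?thesis by (simp add: LIM_zero_iff flip: *)
qed

lemma sq_int_AE_eq_limit:
  assumes "\<And>n. sq_int M (f n)" "sq_int M F" "sq_int M G"
    and F: "(\<lambda>n. \<integral>x. (f n x - F x)\<^sup>2 \<partial>M) \<longlonglongrightarrow> 0"
    and G: "(\<lambda>n. \<integral>x. (f n x - G x)\<^sup>2 \<partial>M) \<longlonglongrightarrow> 0"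
  shows "AE x in M. F x = G x"
proof -
  have FG: "sq_int M (\<lambda>x. F x - G x)" by (intro sq_int_diff assms)
  have "(\<integral>x. (F x - G x)\<^sup>2 \<partial>M) \<le> 0"
  proof (rule LIMSEQ_le_const)
    have "(\<lambda>n. 2 * (\<integral>x. (f n x - F x)\<^sup>2 \<partial>M) + 2 * (\<integral>x. (f n x - G x)\<^sup>2 \<partial>M)) \<longlonglongrightarrow> 2 * 0 + 2 * 0"
      by (intro tendsto_intros F G)
    then show "(\<lambda>n. 2 * (\<integral>x. (f n x - F x)\<^sup>2 \<partial>M) + 2 * (\<integral>x. (f n x - G x)\<^sup>2 \<partial>M)) \<longlonglongrightarrow> 0" by simp
    have "(\<integral>x. (F x - G x)\<^sup>2 \<partial>M) \<le> 2 * (\<integral>x. (f n x - F x)\<^sup>2 \<partial>M) + 2 * (\<integral>x. (f n x - G x)\<^sup>2 \<partial>M)" for n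
      using integral_square_add_le[of M "\<lambda>x. F x - f n x" "\<lambda>x. f n x - G x"] assms
      by (simp add: sq_int_diff power2_commute[of "F _"])
    then show "\<exists>N. \<forall>n\<ge>N. (\<integral>x. (F x - G x)\<^sup>2 \<partial>M) \<le> 2 * (\<integral>x. (f n x - F x)\<^sup>2 \<partial>M) + 2 * (\<integral>x. (f n x - G x)\<^sup>2 \<partial>M)"
      by blast
  qed
  then have "AE x in M. F x - G x = 0" by (rule integral_square_eq_0_AE[OF FG])
  then show ?thesis by simp
qed

section \<open>Fixed points of maps with contracting powers\<close>

text \<open>Up to null sets this is the partial Neumann sum of \<open>g\<close>. The recursive form
  is kept because measurability in parameters is later proved along the recursion.\<close>

definition picard :: "(('a \<Rightarrow> real) \<Rightarrow> ('a \<Rightarrow> real)) \<Rightarrow> ('a \<Rightarrow> real) \<Rightarrow> nat \<Rightarrow> 'a \<Rightarrow> real" where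
  "picard S g n = ((\<lambda>f x. g x + S f x) ^^ n) (\<lambda>_. 0)"

lemma picard_0: "picard S g 0 = (\<lambda>_. 0)"
  by (simp add: picard_def)

lemma picard_Suc: "picard S g (Suc n) = (\<lambda>x. g x + S (picard S g n) x)"
  by (simp add: picard_def)

text \<open>Covers two situations at once: the relaxed iteration of a coercive operator, where each
  step contracts, and a Volterra operator, where only the powers decay. Linearity is asked up to
  null sets, and the constant in front of \<open>q ^ n\<close> may depend on the function.\<close>

locale power_contraction =
  fixes M :: "'a measure" and S :: "('a \<Rightarrow> real) \<Rightarrow> ('a \<Rightarrow> real)" and C q :: real
  assumes S_sq: "\<And>f. sq_int M f \<Longrightarrow> sq_int M (S f)"
    and S_diff: "\<And>f g. sq_int M f \<Longrightarrow> sq_int M g \<Longrightarrow> AE x in M. S (\<lambda>x. f x - g x) x = S f x - S g x"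
    and S_bound: "\<And>f. sq_int M f \<Longrightarrow> (\<integral>x. (S f x)\<^sup>2 \<partial>M) \<le> C * (\<integral>x. (f x)\<^sup>2 \<partial>M)"
    and S_pow: "\<And>f. sq_int M f \<Longrightarrow> \<exists>A. \<forall>n. (\<integral>x. ((S ^^ n) f x)\<^sup>2 \<partial>M) \<le> A * q ^ n"
    and q: "0 \<le> q" "q < 1"
begin

text \<open>Compatibility with equality almost everywhere is a consequence: the bound is applied to
  the difference.\<close>

lemma S_cong:
  assumes "sq_int M f" "sq_int M g" "AE x in M. f x = g x"
  shows "AE x in M. S f x = S g x"
proof -
  have d: "sq_int M (\<lambda>x. f x - g x)" by (intro sq_int_diff assms)
  have [measurable]: "f \<in> borel_measurable M" "g \<in> borel_measurable M" using assms by (auto simp: sq_int_def)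
  have "(\<integral>x. (f x - g x)\<^sup>2 \<partial>M) = (\<integral>x. 0 \<partial>M)"
    by (rule integral_cong_AE) (use assms(3) in auto)
  then have "(\<integral>x. (S (\<lambda>x. f x - g x) x)\<^sup>2 \<partial>M) \<le> 0" using S_bound[OF d] by simp
  then have "AE x in M. S (\<lambda>x. f x - g x) x = 0" by (rule integral_square_eq_0_AE[OF S_sq[OF d]])
  then show ?thesis using S_diff[OF assms(1,2)] by eventually_elim simp
qed

lemma S_funpow_sq: "sq_int M f \<Longrightarrow> sq_int M ((S ^^ n) f)"
  by (induction n) (auto intro: S_sq)

lemma picard_sq: "sq_int M g \<Longrightarrow> sq_int M (picard S g n)"
  by (induction n) (auto simp: picard_0 picard_Suc intro: sq_int_add S_sq)

lemma picard_step:
  assumes "sq_int M g"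
  shows "AE x in M. picard S g (Suc n) x - picard S g n x = (S ^^ n) g x"
proof (induction n)
  case 0
  have "AE x in M. S (\<lambda>_. 0) x = 0"
    using S_diff[OF sq_int_zero sq_int_zero] by (simp add: AE_mp)
  then show ?case by eventually_elim (simp add: picard_0 picard_Suc)
next
  case (Suc n)
  note p = picard_sq[OF assms]
  have "AE x in M. S (\<lambda>x. picard S g (Suc n) x - picard S g n x) x = S ((S ^^ n) g) x"
    by (rule S_cong[OF sq_int_diff[OF p p] S_funpow_sq[OF assms] Suc])
  moreover have "AE x in M. S (\<lambda>x. picard S g (Suc n) x - picard S g n x) x = S (picard S g (Suc n)) x - S (picard S g n) x"
    by (rule S_diff[OF p p])
  ultimately show ?case
    by eventually_elim (simp add: picard_Suc[of _ _ "Suc n"] picard_Suc[of _ _ n])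
qed

text \<open>The increments are the powers of \<open>S\<close> applied to \<open>g\<close>, hence
  geometric. Shifted by one, the iterates converge both to \<open>F\<close> and, by continuity of
  \<open>S\<close>, to \<open>g + S F\<close>; limits in mean square are unique.\<close>

lemma picard_limit:
  assumes "sq_int M g"
  defines "F \<equiv> \<lambda>x. lim (\<lambda>n. picard S g n x)"
  shows "sq_int M F" "AE x in M. F x = g x + S F x"
    and "(\<lambda>n. \<integral>x. (picard S g n x - F x)\<^sup>2 \<partial>M) \<longlonglongrightarrow> 0"
proof -
  note p = picard_sq[OF assms(1)]
  have [measurable]: "\<And>n. picard S g n \<in> borel_measurable M" "\<And>n. (S ^^ n) g \<in> borel_measurable M"
    using p S_funpow_sq[OF assms(1)] by (auto simp: sq_int_def)
  obtain A where A: "\<And>n. (\<integral>x. ((S ^^ n) g x)\<^sup>2 \<partial>M) \<le> A * q ^ n"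
    using S_pow[OF assms(1)] by blast
  have d: "(\<integral>x. (picard S g (Suc n) x - picard S g n x)\<^sup>2 \<partial>M) \<le> A * q ^ n" for n
  proof -
    have "(\<integral>x. (picard S g (Suc n) x - picard S g n x)\<^sup>2 \<partial>M) = (\<integral>x. ((S ^^ n) g x)\<^sup>2 \<partial>M)"
      by (rule integral_cong_AE) (use picard_step[OF assms(1), of n] in auto)
    then show ?thesis using A by simp
  qed
  show F: "sq_int M F" unfolding F_def by (rule sq_int_geometric_limit(1)[OF p d q])
  show L: "(\<lambda>n. \<integral>x. (picard S g n x - F x)\<^sup>2 \<partial>M) \<longlonglongrightarrow> 0"
    unfolding F_def by (rule sq_int_geometric_limit(2)[OF p d q])
  show "AE x in M. F x = g x + S F x"
  proof (rule sq_int_AE_eq_limit[where f="\<lambda>n. picard S g (Suc n)"])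
    show "sq_int M (\<lambda>x. g x + S F x)" by (intro sq_int_add assms S_sq F)
    show "(\<lambda>n. \<integral>x. (picard S g (Suc n) x - F x)\<^sup>2 \<partial>M) \<longlonglongrightarrow> 0" by (rule LIMSEQ_Suc[OF L])
    show "(\<lambda>n. \<integral>x. (picard S g (Suc n) x - (g x + S F x))\<^sup>2 \<partial>M) \<longlonglongrightarrow> 0"
    proof (rule tendsto_sandwich[OF _ _ tendsto_const])
      show "(\<lambda>n. C * (\<integral>x. (picard S g n x - F x)\<^sup>2 \<partial>M)) \<longlonglongrightarrow> 0"
        using tendsto_mult_left[OF L, of C] by simp
      have "(\<integral>x. (picard S g (Suc n) x - (g x + S F x))\<^sup>2 \<partial>M) \<le> C * (\<integral>x. (picard S g n x - F x)\<^sup>2 \<partial>M)" for n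
      proof -
        have [measurable]: "S (\<lambda>x. picard S g n x - F x) \<in> borel_measurable M" "S F \<in> borel_measurable M" "S (picard S g n) \<in> borel_measurable M"
          using S_sq[OF sq_int_diff[OF p F]] S_sq[OF F] S_sq[OF p] by (auto simp: sq_int_def)
        have "(\<integral>x. (picard S g (Suc n) x - (g x + S F x))\<^sup>2 \<partial>M) = (\<integral>x. (S (picard S g n) x - S F x)\<^sup>2 \<partial>M)"
          by (simp add: picard_Suc)
        also have "\<dots> = (\<integral>x. (S (\<lambda>x. picard S g n x - F x) x)\<^sup>2 \<partial>M)"
          by (rule integral_cong_AE) (use S_diff[OF p F, of n] in auto)
        also have "\<dots> \<le> C * (\<integral>x. (picard S g n x - F x)\<^sup>2 \<partial>M)"
          by (rule S_bound[OF sq_int_diff[OF p F]])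
        finally show ?thesis .
      qed
      then show "\<forall>\<^sub>F n in sequentially. (\<integral>x. (picard S g (Suc n) x - (g x + S F x))\<^sup>2 \<partial>M) \<le> C * (\<integral>x. (picard S g n x - F x)\<^sup>2 \<partial>M)"
        by simp
    qed auto
  qed (intro p F)+
qed

text \<open>A fixed point equals all of its images under the powers of \<open>S\<close>, whose norms
  tend to zero.\<close>

lemma fixed_point_zero:
  assumes f: "sq_int M f" and eq: "AE x in M. f x = S f x"
  shows "AE x in M. f x = 0"
proof -
  have iter: "AE x in M. (S ^^ n) f x = f x" for n
  proof (induction n)
    case (Suc n)
    have "AE x in M. S ((S ^^ n) f) x = S f x"
      by (rule S_cong[OF S_funpow_sq[OF f] f Suc])
    then show ?case using eq by eventually_elim simp
  qed simp
  obtain A where A: "\<And>n. (\<integral>x. ((S ^^ n) f x)\<^sup>2 \<partial>M) \<le> A * q ^ n"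
    using S_pow[OF f] by blast
  have "(\<integral>x. (f x)\<^sup>2 \<partial>M) \<le> A * q ^ n" for n
  proof -
    have [measurable]: "f \<in> borel_measurable M" "(S ^^ n) f \<in> borel_measurable M"
      using f S_funpow_sq[OF f] by (auto simp: sq_int_def)
    have "(\<integral>x. (f x)\<^sup>2 \<partial>M) = (\<integral>x. ((S ^^ n) f x)\<^sup>2 \<partial>M)"
      by (rule integral_cong_AE) (use iter[of n] in auto)
    then show ?thesis using A by simp
  qed
  moreover have "(\<lambda>n. A * q ^ n) \<longlonglongrightarrow> 0"
    using q by (intro tendsto_mult_right_zero LIMSEQ_power_zero) simp
  ultimately have "(\<integral>x. (f x)\<^sup>2 \<partial>M) \<le> 0"
    by (intro LIMSEQ_le_const[where X="\<lambda>n. A * q ^ n"]) auto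
  then show ?thesis by (rule integral_square_eq_0_AE[OF f])
qed

end

text \<open>Riesz--Lax--Milgram for a symmetric form, by minimising the energy
  \<open>\<langle>v, L v\<rangle> / 2 - \<langle>v, f\<rangle>\<close>: the parallelogram identity makes a minimising sequence Cauchy.\<close>
lemma symmetric_coercive_weak_solution:
  fixes M :: "'a measure" and V :: "('a \<Rightarrow> real) set"
  assumes V0: "(\<lambda>_. 0) \<in> V"
    and V_lin: "\<And>u v s. u \<in> V \<Longrightarrow> v \<in> V \<Longrightarrow> (\<lambda>x. u x + s * v x) \<in> V"
    and V_sq: "\<And>u. u \<in> V \<Longrightarrow> sq_int M u"
    and V_lim: "\<And>u. (\<And>n. u n \<in> V) \<Longrightarrow> sq_int M (\<lambda>x. lim (\<lambda>n. u n x)) \<Longrightarrow> (\<lambda>x. lim (\<lambda>n. u n x)) \<in> V"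
    and L_sq: "\<And>u. sq_int M u \<Longrightarrow> sq_int M (L u)"
    and L_lin: "\<And>u v s. sq_int M u \<Longrightarrow> sq_int M v \<Longrightarrow> AE x in M. L (\<lambda>x. u x + s * v x) x = L u x + s * L v x"
    and L_sym: "\<And>u v. sq_int M u \<Longrightarrow> sq_int M v \<Longrightarrow> (\<integral>x. u x * L v x \<partial>M) = (\<integral>x. v x * L u x \<partial>M)"
    and c: "c > 0"
    and L_coercive: "\<And>u. sq_int M u \<Longrightarrow> c * (\<integral>x. (u x)\<^sup>2 \<partial>M) \<le> (\<integral>x. u x * L u x \<partial>M)"
    and f: "sq_int M f"
  obtains u where "u \<in> V" "\<And>v. v \<in> V \<Longrightarrow> (\<integral>x. v x * L u x \<partial>M) = (\<integral>x. v x * f x \<partial>M)"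
proof -
  define \<Phi> where "\<Phi> v = (\<integral>x. v x * L v x \<partial>M) / 2 - (\<integral>x. v x * f x \<partial>M)" for v
  have expand: "\<Phi> (\<lambda>x. u x + s * v x) = \<Phi> u + s * ((\<integral>x. v x * L u x \<partial>M) - (\<integral>x. v x * f x \<partial>M)) + s\<^sup>2 * (\<integral>x. v x * L v x \<partial>M) / 2"
    if u: "sq_int M u" and v: "sq_int M v" for u v s
  proof -
    have [measurable]: "u \<in> borel_measurable M" "v \<in> borel_measurable M" "L u \<in> borel_measurable M" "L v \<in> borel_measurable M"
      "L (\<lambda>x. u x + s * v x) \<in> borel_measurable M"
      using u v L_sq[OF u] L_sq[OF v] L_sq[OF sq_int_add[OF u sq_int_cmult[OF v]]] by (auto simp: sq_int_def)
    note i = sq_int_mult_integrable[OF u L_sq[OF u]] sq_int_mult_integrable[OF u L_sq[OF v]]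
      sq_int_mult_integrable[OF v L_sq[OF u]] sq_int_mult_integrable[OF v L_sq[OF v]]
      sq_int_mult_integrable[OF u f] sq_int_mult_integrable[OF v f]
    have "(\<integral>x. (u x + s * v x) * L (\<lambda>x. u x + s * v x) x \<partial>M)
        = (\<integral>x. u x * L u x + s * (u x * L v x) + s * (v x * L u x) + s\<^sup>2 * (v x * L v x) \<partial>M)"
      by (rule integral_cong_AE)
         (use L_lin[OF u v, of s] in \<open>auto simp: algebra_simps power2_eq_square\<close>)
    also have "\<dots> = (\<integral>x. u x * L u x \<partial>M) + s * (\<integral>x. u x * L v x \<partial>M) + s * (\<integral>x. v x * L u x \<partial>M) + s\<^sup>2 * (\<integral>x. v x * L v x \<partial>M)"
      using i by simp
    finally have 1: "(\<integral>x. (u x + s * v x) * L (\<lambda>x. u x + s * v x) x \<partial>M) = (\<integral>x. u x * L u x \<partial>M) + 2 * s * (\<integral>x. v x * L u x \<partial>M) + s\<^sup>2 * (\<integral>x. v x * L v x \<partial>M)"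
      using L_sym[OF u v] by simp
    have "(\<integral>x. (u x + s * v x) * f x \<partial>M) = (\<integral>x. u x * f x + s * (v x * f x) \<partial>M)"
      by (simp add: algebra_simps)
    also have "\<dots> = (\<integral>x. u x * f x \<partial>M) + s * (\<integral>x. v x * f x \<partial>M)" using i by simp
    finally show ?thesis unfolding \<Phi>_def 1 by (simp add: algebra_simps add_divide_distrib)
  qed
  have lower: "\<Phi> v \<ge> - (\<integral>x. (f x)\<^sup>2 \<partial>M) / (2 * c)" if v: "sq_int M v" for v
  proof -
    \<comment> \<open>Young's inequality with weight \<open>c\<close>, matched to the coercivity
      constant so that the quadratic part of the energy absorbs the linear part.\<close>
    have "0 \<le> (\<integral>x. (f x + (- c) * v x)\<^sup>2 \<partial>M)" by simp
    then have "2 * c * (\<integral>x. f x * v x \<partial>M) \<le> (\<integral>x. (f x)\<^sup>2 \<partial>M) + c * (c * (\<integral>x. (v x)\<^sup>2 \<partial>M))"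
      unfolding integral_square_add_scaled[OF f v] by (simp add: power2_eq_square)
    also have "\<dots> \<le> (\<integral>x. (f x)\<^sup>2 \<partial>M) + c * (\<integral>x. v x * L v x \<partial>M)"
      using L_coercive[OF v] c by (intro add_left_mono mult_left_mono) auto
    finally show ?thesis using c unfolding \<Phi>_def by (simp add: field_simps)
  qed
  define J where "J = (INF v\<in>V. \<Phi> v)"
  have bdd: "bdd_below (\<Phi> ` V)" using lower V_sq by (intro bdd_belowI2) auto
  have J_le: "J \<le> \<Phi> v" if "v \<in> V" for v unfolding J_def by (rule cINF_lower[OF bdd that])
  have "\<exists>v\<in>V. \<Phi> v < J + (1/2) ^ n" for n
    using cINF_less_iff[of V \<Phi> "J + (1/2) ^ n"] V0 bdd unfolding J_def by auto
  then obtain u where uV: "\<And>n. u n \<in> V" and uJ: "\<And>n. \<Phi> (u n) < J + (1/2) ^ n" by metis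
  note us = V_sq[OF uV]
  have d: "(\<integral>x. (u (Suc n) x - u n x)\<^sup>2 \<partial>M) \<le> (8 / c) * (1/2) ^ n" for n
  proof -
    \<comment> \<open>Midpoint and difference of consecutive iterates. The energy at the midpoint is
      at least the infimum, so the form evaluated at the difference is controlled by the two energy
      gaps.\<close>
    define w \<delta> where "w = (\<lambda>x. (1/2) * (u n x + 1 * u (Suc n) x))" and "\<delta> = (\<lambda>x. u (Suc n) x - u n x)"
    have wV: "w \<in> V" using V_lin[OF V0 V_lin[OF uV uV], of "1/2" n 1 "Suc n"] by (simp add: w_def)
    have ds: "sq_int M \<delta>" unfolding \<delta>_def by (intro sq_int_diff us)
    have "\<Phi> (\<lambda>x. w x + (1/2) * \<delta> x) = \<Phi> (u (Suc n))" "\<Phi> (\<lambda>x. w x + (-1/2) * \<delta> x) = \<Phi> (u n)"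
      by (auto intro!: arg_cong[of _ _ \<Phi>] simp: w_def \<delta>_def field_simps)
    then have "\<Phi> (u (Suc n)) + \<Phi> (u n) = 2 * \<Phi> w + (\<integral>x. \<delta> x * L \<delta> x \<partial>M) / 4"
      unfolding expand[OF V_sq[OF wV] ds] by (simp add: power2_eq_square field_simps)
    moreover have "\<Phi> (u (Suc n)) + \<Phi> (u n) \<le> 2 * J + 2 * (1/2) ^ n"
      using uJ[of n] uJ[of "Suc n"] by (simp add: field_simps)
    ultimately have "(\<integral>x. \<delta> x * L \<delta> x \<partial>M) \<le> 8 * (1/2) ^ n" using J_le[OF wV] by simp
    with L_coercive[OF ds] have "c * (\<integral>x. (\<delta> x)\<^sup>2 \<partial>M) \<le> 8 * (1/2) ^ n" by linarith
    then show ?thesis using c by (simp add: \<delta>_def field_simps)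
  qed
  define U where "U = (\<lambda>x. lim (\<lambda>n. u n x))"
  have Us: "sq_int M U" unfolding U_def by (rule sq_int_geometric_limit(1)[OF us d]) auto
  have UL: "(\<lambda>n. \<integral>x. (u n x - U x)\<^sup>2 \<partial>M) \<longlonglongrightarrow> 0"
    unfolding U_def by (rule sq_int_geometric_limit(2)[OF us d]) auto
  \<comment> \<open>The subspace is only assumed closed under the pointwise \<open>lim\<close>; the
    limit in mean square was constructed in exactly that form.\<close>
  have UV: "U \<in> V" unfolding U_def by (rule V_lim[OF uV]) (use Us in \<open>simp add: U_def\<close>)
  show thesis
  proof (rule that[OF UV])
    fix v assume v: "v \<in> V"
    note vs = V_sq[OF v]
    define e where "e n = (\<integral>x. v x * L (u n) x \<partial>M) - (\<integral>x. v x * f x \<partial>M)" for n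
    have e_le: "(e n)\<^sup>2 \<le> (1/2) ^ n * (2 * (\<integral>x. v x * L v x \<partial>M))" for n
    proof -
      \<comment> \<open>Moving from \<open>u n\<close> along \<open>v\<close> cannot lower the
        energy by more than its gap \<open>(1/2) ^ n\<close>; nonnegativity for every
        \<open>s\<close> then bounds the slope \<open>e n\<close>.\<close>
      have "0 \<le> (1/2) ^ n + 2 * s * (e n / 2) + s\<^sup>2 * ((\<integral>x. v x * L v x \<partial>M) / 2)" for s
        using J_le[OF V_lin[OF uV[of n] v, of s]] uJ[of n] unfolding expand[OF us vs] e_def by simp
      from quadratic_nonneg_discriminant[OF this] show ?thesis by (simp add: power_divide)
    qed
    have "(\<lambda>n. (e n)\<^sup>2) \<longlonglongrightarrow> 0"
    proof (rule tendsto_sandwich[OF _ _ tendsto_const])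
      show "(\<lambda>n. (1/2) ^ n * (2 * (\<integral>x. v x * L v x \<partial>M))) \<longlonglongrightarrow> 0"
        by (intro tendsto_mult_left_zero LIMSEQ_power_zero) simp
    qed (use e_le in auto)
    then have "(\<lambda>n. sqrt ((e n)\<^sup>2)) \<longlonglongrightarrow> sqrt 0" by (rule tendsto_real_sqrt)
    then have e0: "e \<longlonglongrightarrow> 0" by (simp add: tendsto_rabs_zero_iff)
    have "(\<lambda>n. \<integral>x. u n x * L v x \<partial>M) \<longlonglongrightarrow> (\<integral>x. U x * L v x \<partial>M)"
      by (rule tendsto_integral_mult_sq_int[OF us Us L_sq[OF vs] UL])
    then have "(\<lambda>n. \<integral>x. v x * L (u n) x \<partial>M) \<longlonglongrightarrow> (\<integral>x. v x * L U x \<partial>M)"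
      by (simp add: L_sym[OF us vs] L_sym[OF Us vs])
    then have "e \<longlonglongrightarrow> (\<integral>x. v x * L U x \<partial>M) - (\<integral>x. v x * f x \<partial>M)"
      unfolding e_def by (intro tendsto_intros)
    from LIMSEQ_unique[OF this e0] show "(\<integral>x. v x * L U x \<partial>M) = (\<integral>x. v x * f x \<partial>M)" by simp
  qed
qed

section \<open>Integral operators on an interval\<close>

lemma L2fun_iff_sq_int: "L2fun T f \<longleftrightarrow> sq_int (lebesgue_on {0..T}) f"
  by (simp add: L2fun_def sq_int_def)

lemma aeq_sym: "aeq T f g \<Longrightarrow> aeq T g f"
  unfolding aeq_def by (rule eventually_mono) auto

lemma aeq_trans: "aeq T f g \<Longrightarrow> aeq T g h \<Longrightarrow> aeq T f h"
  unfolding aeq_def by (rule eventually_elim2) auto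

text \<open>Time carries the Lebesgue sigma-algebra in the integrals but the Borel one in
  progressive measurability; this identity map is the bridge between them.\<close>

lemma measurable_lebesgue_on_borel: "(\<lambda>x. x) \<in> lebesgue_on {0..T::real} \<rightarrow>\<^sub>M borel"
  by (intro measurable_restrict_space1 measurable_completion) simp

lemma measurable_into_lebesgue_on_real:
  "f \<in> N \<rightarrow>\<^sub>M lebesgue_on {0..T::real} \<Longrightarrow> f \<in> borel_measurable N"
  by (drule measurable_compose[OF _ measurable_lebesgue_on_borel]) simp

lemma finite_measure_lebesgue_on_Icc: "finite_measure (lebesgue_on {0..T::real})"
  by (rule finite_measure_lebesgue_on) simp

section \<open>Kernels with uniformly square-integrable rows\<close>

locale horizon =
  fixes T :: real
  assumes T_pos: "T > 0"
begin

abbreviation I :: "real measure" where "I \<equiv> lebesgue_on {0..T}"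

sublocale I: finite_measure I
  by (rule finite_measure_lebesgue_on_Icc)

sublocale II: pair_sigma_finite I I ..

lemma space_I [simp]: "space I = {0..T}" by simp

lemma integral_const_I: "(\<integral>x. c \<partial>I) = c * T"
  using T_pos by (simp add: measure_restrict_space)

definition rowbd :: "(real \<Rightarrow> real \<Rightarrow> real) \<Rightarrow> real \<Rightarrow> bool" where
  "rowbd K C \<longleftrightarrow> case_prod K \<in> borel_measurable (I \<Otimes>\<^sub>M I) \<and>
     (\<forall>s\<in>{0..T}. sq_int I (K s) \<and> (\<integral>r. (K s r)\<^sup>2 \<partial>I) \<le> C)"

lemma rowbd_measurable:
  assumes "rowbd K C" "f \<in> N \<rightarrow>\<^sub>M I" "g \<in> N \<rightarrow>\<^sub>M I"
  shows "(\<lambda>x. K (f x) (g x)) \<in> borel_measurable N"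
proof -
  have "(\<lambda>x. case_prod K (f x, g x)) \<in> borel_measurable N"
    by (rule measurable_compose[OF measurable_Pair[OF assms(2,3)]]) (use assms(1) in \<open>simp add: rowbd_def\<close>)
  then show ?thesis by simp
qed

lemma rowbd_sq: "rowbd K C \<Longrightarrow> s \<in> {0..T} \<Longrightarrow> sq_int I (K s)"
  and rowbd_le: "rowbd K C \<Longrightarrow> s \<in> {0..T} \<Longrightarrow> (\<integral>r. (K s r)\<^sup>2 \<partial>I) \<le> C"
  by (auto simp: rowbd_def)

lemma rowbd_nonneg: assumes "rowbd K C" shows "0 \<le> C"
proof -
  have "0 \<le> (\<integral>r. (K 0 r)\<^sup>2 \<partial>I)" by simp
  also have "\<dots> \<le> C" using assms T_pos by (intro rowbd_le) auto
  finally show ?thesis .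
qed

lemma rowbdI:
  assumes "case_prod K \<in> borel_measurable (I \<Otimes>\<^sub>M I)"
    and "\<And>s. s \<in> {0..T} \<Longrightarrow> sq_int I (K s)" "\<And>s. s \<in> {0..T} \<Longrightarrow> (\<integral>r. (K s r)\<^sup>2 \<partial>I) \<le> C"
  shows "rowbd K C"
  using assms by (simp add: rowbd_def)

lemma rowbd_add:
  assumes "rowbd K C" "rowbd L D"
  shows "rowbd (\<lambda>s r. K s r + L s r) (2 * C + 2 * D)"
proof (rule rowbdI)
  have [measurable]: "case_prod K \<in> borel_measurable (I \<Otimes>\<^sub>M I)" "case_prod L \<in> borel_measurable (I \<Otimes>\<^sub>M I)"
    using assms by (auto simp: rowbd_def)
  have "(\<lambda>p. case_prod K p + case_prod L p) \<in> borel_measurable (I \<Otimes>\<^sub>M I)" by measurable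
  then show "(\<lambda>(s, r). K s r + L s r) \<in> borel_measurable (I \<Otimes>\<^sub>M I)" by (simp add: case_prod_beta')
  fix s assume s: "s \<in> {0..T}"
  note sq = rowbd_sq[OF assms(1) s] rowbd_sq[OF assms(2) s]
  show "sq_int I (\<lambda>r. K s r + L s r)" by (intro sq_int_add sq)
  show "(\<integral>r. (K s r + L s r)\<^sup>2 \<partial>I) \<le> 2 * C + 2 * D"
    using integral_square_add_le[OF sq] rowbd_le[OF assms(1) s] rowbd_le[OF assms(2) s] by linarith
qed

lemma rowbd_cmult:
  assumes "rowbd K C"
  shows "rowbd (\<lambda>s r. c * K s r) (c\<^sup>2 * C)"
proof (rule rowbdI)
  have [measurable]: "case_prod K \<in> borel_measurable (I \<Otimes>\<^sub>M I)"
    using assms by (auto simp: rowbd_def)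
  have "(\<lambda>p. c * case_prod K p) \<in> borel_measurable (I \<Otimes>\<^sub>M I)" by measurable
  then show "(\<lambda>(s, r). c * K s r) \<in> borel_measurable (I \<Otimes>\<^sub>M I)" by (simp add: case_prod_beta')
  fix s assume s: "s \<in> {0..T}"
  show "sq_int I (\<lambda>r. c * K s r)" by (intro sq_int_cmult rowbd_sq[OF assms s])
  show "(\<integral>r. (c * K s r)\<^sup>2 \<partial>I) \<le> c\<^sup>2 * C"
    using rowbd_le[OF assms s] by (simp add: power_mult_distrib mult_left_mono)
qed

lemma rowbd_if:
  assumes "rowbd K C" and [measurable]: "Measurable.pred (I \<Otimes>\<^sub>M I) (case_prod P)"
  shows "rowbd (\<lambda>s r. if P s r then K s r else 0) C"
proof (rule rowbdI)
  have [measurable]: "case_prod K \<in> borel_measurable (I \<Otimes>\<^sub>M I)"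
    using assms by (auto simp: rowbd_def)
  have "(\<lambda>p. if case_prod P p then case_prod K p else 0) \<in> borel_measurable (I \<Otimes>\<^sub>M I)" by measurable
  then show *: "(\<lambda>(s, r). if P s r then K s r else 0) \<in> borel_measurable (I \<Otimes>\<^sub>M I)"
    by (simp add: case_prod_beta')
  fix s assume s: "s \<in> {0..T}"
  have m: "(\<lambda>r. if P s r then K s r else 0) \<in> borel_measurable I"
    using measurable_compose[OF measurable_Pair1'[of s I I] *] s by simp
  show sq: "sq_int I (\<lambda>r. if P s r then K s r else 0)"
    by (rule sq_int_bound[OF sq_intD[OF rowbd_sq[OF assms(1) s]] m]) auto
  have "(\<integral>r. (if P s r then K s r else 0)\<^sup>2 \<partial>I) \<le> (\<integral>r. (K s r)\<^sup>2 \<partial>I)"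
    by (rule integral_mono[OF sq_intD[OF sq] sq_intD[OF rowbd_sq[OF assms(1) s]]]) auto
  then show "(\<integral>r. (if P s r then K s r else 0)\<^sup>2 \<partial>I) \<le> C" using rowbd_le[OF assms(1) s] by linarith
qed

lemma pred_le_fst [measurable]: "Measurable.pred (I \<Otimes>\<^sub>M I) (\<lambda>(s, r). t \<le> s)"
  and pred_le_snd [measurable]: "Measurable.pred (I \<Otimes>\<^sub>M I) (\<lambda>(s, r). t \<le> r)"
proof -
  have [measurable]: "fst \<in> borel_measurable (I \<Otimes>\<^sub>M I)" "snd \<in> borel_measurable (I \<Otimes>\<^sub>M I)"
    by (auto intro: measurable_into_lebesgue_on_real)
  have "Measurable.pred (I \<Otimes>\<^sub>M I) (\<lambda>p. t \<le> fst p)" "Measurable.pred (I \<Otimes>\<^sub>M I) (\<lambda>p. t \<le> snd p)" by measurable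
  then show "Measurable.pred (I \<Otimes>\<^sub>M I) (\<lambda>(s, r). t \<le> s)" "Measurable.pred (I \<Otimes>\<^sub>M I) (\<lambda>(s, r). t \<le> r)"
    by (simp_all add: case_prod_beta')
qed

lemma measurable_kop:
  assumes "rowbd K C" "f \<in> borel_measurable I"
  shows "kop T K f \<in> borel_measurable I"
proof -
  have [measurable]: "case_prod K \<in> borel_measurable (I \<Otimes>\<^sub>M I)" "f \<in> borel_measurable I"
    using assms by (auto simp: rowbd_def)
  have "(\<lambda>p. case_prod K p * f (snd p)) \<in> borel_measurable (I \<Otimes>\<^sub>M I)" by measurable
  then have "(\<lambda>(s, r). K s r * f r) \<in> borel_measurable (I \<Otimes>\<^sub>M I)" by (simp add: case_prod_beta')
  then show ?thesis unfolding kop_def by (rule I.borel_measurable_lebesgue_integral)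
qed

lemma kop_square_le:
  assumes "rowbd K C" "sq_int I f" "s \<in> {0..T}"
  shows "(kop T K f s)\<^sup>2 \<le> C * (\<integral>r. (f r)\<^sup>2 \<partial>I)"
proof -
  have "(kop T K f s)\<^sup>2 \<le> (\<integral>r. (K s r)\<^sup>2 \<partial>I) * (\<integral>r. (f r)\<^sup>2 \<partial>I)"
    unfolding kop_def by (rule Cauchy_Schwarz_integral[OF rowbd_sq[OF assms(1,3)] assms(2)])
  also have "\<dots> \<le> C * (\<integral>r. (f r)\<^sup>2 \<partial>I)"
    by (rule mult_right_mono[OF rowbd_le[OF assms(1,3)]]) simp
  finally show ?thesis .
qed

lemma sq_int_kop:
  assumes "rowbd K C" "sq_int I f"
  shows "sq_int I (kop T K f)"
proof (rule sq_int_bound)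
  show "integrable I (\<lambda>_. C * (\<integral>r. (f r)\<^sup>2 \<partial>I))" by simp
qed (use measurable_kop[OF assms(1)] kop_square_le[OF assms] assms(2) in \<open>auto simp: sq_int_def\<close>)

lemma integral_kop_square_le:
  assumes "rowbd K C" "sq_int I f"
  shows "(\<integral>s. (kop T K f s)\<^sup>2 \<partial>I) \<le> C * T * (\<integral>r. (f r)\<^sup>2 \<partial>I)"
proof -
  have "(\<integral>s. (kop T K f s)\<^sup>2 \<partial>I) \<le> (\<integral>s. C * (\<integral>r. (f r)\<^sup>2 \<partial>I) \<partial>I)"
    by (rule integral_mono[OF sq_intD[OF sq_int_kop[OF assms]]]) (use kop_square_le[OF assms] in auto)
  then show ?thesis by (simp add: integral_const_I mult_ac del: lebesgue_integral_const)
qed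

lemma kop_add_scaled:
  assumes "rowbd K C" "sq_int I f" "sq_int I g" "s \<in> {0..T}"
  shows "kop T K (\<lambda>r. f r + c * g r) s = kop T K f s + c * kop T K g s"
proof -
  have "kop T K (\<lambda>r. f r + c * g r) s = (\<integral>r. K s r * f r + c * (K s r * g r) \<partial>I)"
    unfolding kop_def by (rule Bochner_Integration.integral_cong) (auto simp: algebra_simps)
  also have "\<dots> = kop T K f s + c * kop T K g s"
    using sq_int_mult_integrable[OF rowbd_sq[OF assms(1,4)] assms(2)] sq_int_mult_integrable[OF rowbd_sq[OF assms(1,4)] assms(3)]
    by (simp add: kop_def)
  finally show ?thesis .
qed

lemma kop_diff:
  assumes "rowbd K C" "sq_int I f" "sq_int I g" "s \<in> {0..T}"
  shows "kop T K (\<lambda>r. f r - g r) s = kop T K f s - kop T K g s"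
  using kop_add_scaled[OF assms, of "-1"] by simp

lemma kop_add_kernel:
  assumes "rowbd K C" "rowbd L D" "sq_int I f" "s \<in> {0..T}"
  shows "kop T (\<lambda>s r. K s r + L s r) f s = kop T K f s + kop T L f s"
  using sq_int_mult_integrable[OF rowbd_sq[OF assms(1,4)] assms(3)] sq_int_mult_integrable[OF rowbd_sq[OF assms(2,4)] assms(3)]
  by (simp add: kop_def distrib_right)

lemma kop_cmult_kernel: "kop T (\<lambda>s r. c * K s r) f s = c * kop T K f s"
  by (simp add: kop_def mult.assoc)

lemma kop_cong_AE:
  assumes "rowbd K C" "f \<in> borel_measurable I" "g \<in> borel_measurable I" "aeq T f g" "s \<in> {0..T}"
  shows "kop T K f s = kop T K g s"
proof -
  have [measurable]: "K s \<in> borel_measurable I" "f \<in> borel_measurable I" "g \<in> borel_measurable I"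
    using rowbd_sq[OF assms(1,5)] assms by auto
  show ?thesis unfolding kop_def
    by (rule integral_cong_AE) (use assms(4) in \<open>auto simp: aeq_def\<close>)
qed

text \<open>Fubini. A row bound on \<open>K\<close> alone makes the double integral absolutely
  convergent: by Cauchy-Schwarz the inner integral of absolute values is at most a constant times
  \<open>\<bar>f s\<bar>\<close>, which is integrable over a bounded interval.\<close>

lemma kop_adjoint:
  assumes "rowbd K C" "sq_int I f" "sq_int I g"
  shows "(\<integral>s. f s * kop T K g s \<partial>I) = (\<integral>r. kop T (adj K) f r * g r \<partial>I)"
proof -
  have [measurable]: "case_prod K \<in> borel_measurable (I \<Otimes>\<^sub>M I)" "f \<in> borel_measurable I" "g \<in> borel_measurable I"
    using assms by (auto simp: rowbd_def sq_int_def)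
  have m: "(\<lambda>(s, r). f s * (K s r * g r)) \<in> borel_measurable (I \<Otimes>\<^sub>M I)"
  proof -
    have "(\<lambda>p. f (fst p) * (case_prod K p * g (snd p))) \<in> borel_measurable (I \<Otimes>\<^sub>M I)" by measurable
    then show ?thesis by (simp add: case_prod_beta')
  qed
  define c where "c = sqrt (C * (\<integral>r. (g r)\<^sup>2 \<partial>I))"
  have K: "sq_int I (K s)" if "s \<in> {0..T}" for s using rowbd_sq[OF assms(1) that] .
  have absg: "sq_int I (\<lambda>r. \<bar>g r\<bar>)" using assms(3) by (auto simp: sq_int_def)
  have absK: "sq_int I (\<lambda>r. \<bar>K s r\<bar>)" if "s \<in> {0..T}" for s
    using K[OF that] by (auto simp: sq_int_def)
  have inner: "(\<integral>r. norm (f s * (K s r * g r)) \<partial>I) \<le> c * \<bar>f s\<bar>" if s: "s \<in> {0..T}" for s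
  proof -
    have "(\<integral>r. \<bar>K s r\<bar> * \<bar>g r\<bar> \<partial>I)\<^sup>2 \<le> (\<integral>r. \<bar>K s r\<bar>\<^sup>2 \<partial>I) * (\<integral>r. \<bar>g r\<bar>\<^sup>2 \<partial>I)"
      by (rule Cauchy_Schwarz_integral[OF absK[OF s] absg])
    also have "\<dots> \<le> C * (\<integral>r. (g r)\<^sup>2 \<partial>I)"
      using rowbd_le[OF assms(1) s] by (simp add: mult_right_mono)
    finally have "(\<integral>r. \<bar>K s r\<bar> * \<bar>g r\<bar> \<partial>I) \<le> c"
      unfolding c_def by (rule real_le_rsqrt)
    then have "\<bar>f s\<bar> * (\<integral>r. \<bar>K s r\<bar> * \<bar>g r\<bar> \<partial>I) \<le> \<bar>f s\<bar> * c"
      by (rule mult_left_mono) simp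
    then show ?thesis by (simp add: abs_mult mult.commute)
  qed
  have int: "integrable (I \<Otimes>\<^sub>M I) (\<lambda>(s, r). f s * (K s r * g r))"
  proof (rule II.Fubini_integrable[OF m])
    have fint: "integrable I f"
      using sq_int_mult_integrable[OF assms(2), of "\<lambda>_. 1"] by (simp add: sq_int_def)
    have [measurable]: "(\<lambda>(s, r). norm (f s * (K s r * g r))) \<in> borel_measurable (I \<Otimes>\<^sub>M I)"
      using measurable_compose[OF m borel_measurable_norm] by (simp add: case_prod_beta')
    show "integrable I (\<lambda>s. \<integral>r. norm (case (s, r) of (s, r) \<Rightarrow> f s * (K s r * g r)) \<partial>I)"
    proof (rule Bochner_Integration.integrable_bound[of _ "\<lambda>s. c * \<bar>f s\<bar>"])
      show "integrable I (\<lambda>s. c * \<bar>f s\<bar>)" using fint by simp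
      show "(\<lambda>s. \<integral>r. norm (case (s, r) of (s, r) \<Rightarrow> f s * (K s r * g r)) \<partial>I) \<in> borel_measurable I"
        by measurable
      show "AE s in I. norm (\<integral>r. norm (case (s, r) of (s, r) \<Rightarrow> f s * (K s r * g r)) \<partial>I) \<le> norm (c * \<bar>f s\<bar>)"
      proof (rule AE_I2)
        fix s assume "s \<in> space I"
        then have s: "s \<in> {0..T}" by simp
        have "0 \<le> (\<integral>r. norm (f s * (K s r * g r)) \<partial>I)" by simp
        then show "norm (\<integral>r. norm (case (s, r) of (s, r) \<Rightarrow> f s * (K s r * g r)) \<partial>I) \<le> norm (c * \<bar>f s\<bar>)"
          using inner[OF s] by simp
      qed
    qed
    show "AE s in I. integrable I (\<lambda>r. case (s, r) of (s, r) \<Rightarrow> f s * (K s r * g r))"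
      by (rule AE_I2) (use sq_int_mult_integrable[OF K assms(3)] in simp)
  qed
  have "(\<integral>s. f s * kop T K g s \<partial>I) = (\<integral>s. (\<integral>r. f s * (K s r * g r) \<partial>I) \<partial>I)"
    by (simp add: kop_def)
  also have "\<dots> = (\<integral>r. (\<integral>s. f s * (K s r * g r) \<partial>I) \<partial>I)"
    by (rule II.Fubini_integral[OF int, symmetric])
  also have "\<dots> = (\<integral>r. kop T (adj K) f r * g r \<partial>I)"
  proof (intro Bochner_Integration.integral_cong refl)
    fix r
    have "(\<lambda>s. f s * (K s r * g r)) = (\<lambda>s. (K s r * f s) * g r)" by (auto simp: mult_ac)
    then show "(\<integral>s. f s * (K s r * g r) \<partial>I) = kop T (adj K) f r * g r"
      by (simp add: kop_def adj_def)
  qed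
  finally show ?thesis .
qed

section \<open>Inverses of operators on L2\<close>

text \<open>Since \<open>e * D = id - S\<close>, the equation \<open>D f = g\<close> is the fixed
  point equation for \<open>f\<close> with data \<open>e * g\<close>. The second claim is the only
  access to the arbitrary choice in \<open>op_inv\<close> as a limit of explicit iterates, and the
  source of its measurability in parameters.\<close>

lemma invertible_op_contraction:
  assumes "power_contraction I S C q" and e: "e > 0"
    and D: "\<And>f s. sq_int I f \<Longrightarrow> s \<in> {0..T} \<Longrightarrow> e * D f s = f s - S f s"
  shows "invertible_op T D"
    and "sq_int I g \<Longrightarrow> (\<lambda>n. \<integral>x. (picard S (\<lambda>x. e * g x) n x - op_inv T D g x)\<^sup>2 \<partial>I) \<longlonglongrightarrow> 0"
proof -
  interpret power_contraction I S C q by fact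
  have D': "D f s = (1 / e) * (f s - S f s)" if "sq_int I f" "s \<in> {0..T}" for f s
    using D[OF that] e by (simp add: field_simps)
  have Dsq: "sq_int I (D f)" if f: "sq_int I f" for f
  proof -
    have "sq_int I (\<lambda>s. (1 / e) * (f s - S f s))" by (intro sq_int_cmult sq_int_diff f S_sq)
    moreover have "sq_int I (D f) = sq_int I (\<lambda>s. (1 / e) * (f s - S f s))"
      unfolding sq_int_def
      by (intro arg_cong2[where f="(\<and>)"] measurable_cong Bochner_Integration.integrable_cong refl) (use D'[OF f] in auto)
    ultimately show ?thesis by simp
  qed
  have sol: "\<exists>f. sq_int I f \<and> aeq T (D f) g \<and> (\<lambda>n. \<integral>x. (picard S (\<lambda>x. e * g x) n x - f x)\<^sup>2 \<partial>I) \<longlonglongrightarrow> 0" if g: "sq_int I g" for g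
  proof -
    note p = picard_limit[OF sq_int_cmult[OF g, of e]]
    let ?F = "\<lambda>x. lim (\<lambda>n. picard S (\<lambda>x. e * g x) n x)"
    have "AE x in I. D ?F x = g x"
      using p(2) AE_space
    proof eventually_elim
      case (elim x)
      then have "e * D ?F x = e * g x" using D[OF p(1), of x] by simp
      then show ?case using e by simp
    qed
    then show ?thesis using p(1,3) unfolding aeq_def by blast
  qed
  have inj: "aeq T f g" if f: "sq_int I f" and g: "sq_int I g" and eq: "aeq T (D f) (D g)" for f g
  proof -
    have "AE x in I. f x - g x = S (\<lambda>x. f x - g x) x"
      using eq[unfolded aeq_def] S_diff[OF f g] AE_space
    proof eventually_elim
      case (elim x)
      have "f x - S f x = g x - S g x" using D[OF f, of x] D[OF g, of x] elim by simp
      then show ?case using elim by simp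
    qed
    then have "AE x in I. f x - g x = 0" by (rule fixed_point_zero[OF sq_int_diff[OF f g]])
    then show ?thesis by (simp add: aeq_def)
  qed
  have cong: "aeq T (D f) (D g)" if f: "sq_int I f" and g: "sq_int I g" and eq: "aeq T f g" for f g
    unfolding aeq_def using eq[unfolded aeq_def] S_cong[OF f g eq[unfolded aeq_def]] AE_space
    by eventually_elim (use D'[OF f] D'[OF g] in auto)
  show "invertible_op T D"
    unfolding invertible_op_def L2fun_iff_sq_int
  proof (intro conjI allI impI)
    fix f assume "sq_int I f" then show "sq_int I (D f)" by (rule Dsq)
  next
    fix f g assume "sq_int I f" "sq_int I g" "aeq T f g" then show "aeq T (D f) (D g)" by (rule cong)
  next
    fix f g assume "sq_int I f" "sq_int I g" "aeq T (D f) (D g)" then show "aeq T f g" by (rule inj)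
  next
    fix g assume "sq_int I g"
    from sol[OF this] show "\<exists>f. sq_int I f \<and> aeq T (D f) g" by (elim exE conjE) (intro exI conjI)
  qed
  assume g: "sq_int I g"
  obtain f where f: "sq_int I f" "aeq T (D f) g" "(\<lambda>n. \<integral>x. (picard S (\<lambda>x. e * g x) n x - f x)\<^sup>2 \<partial>I) \<longlonglongrightarrow> 0"
    using sol[OF g] by (elim exE conjE)
  have o: "sq_int I (op_inv T D g) \<and> aeq T (D (op_inv T D g)) g"
    unfolding op_inv_def L2fun_iff_sq_int by (rule someI[of "\<lambda>f. sq_int I f \<and> aeq T (D f) g" f]) (simp add: f(1,2))
  have fo: "aeq T f (op_inv T D g)"
    by (rule inj[OF f(1) conjunct1[OF o] aeq_trans[OF f(2) aeq_sym[OF conjunct2[OF o]]]])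
  have pm [measurable]: "picard S (\<lambda>x. e * g x) n \<in> borel_measurable I" for n
    using picard_sq[OF sq_int_cmult[OF g]] by (simp add: sq_int_def)
  have [measurable]: "f \<in> borel_measurable I" "op_inv T D g \<in> borel_measurable I" using f o by (auto simp: sq_int_def)
  have "(\<integral>x. (picard S (\<lambda>x. e * g x) n x - op_inv T D g x)\<^sup>2 \<partial>I) = (\<integral>x. (picard S (\<lambda>x. e * g x) n x - f x)\<^sup>2 \<partial>I)" for n
    by (rule integral_cong_AE) (use fo in \<open>auto simp: aeq_def\<close>)
  then show "(\<lambda>n. \<integral>x. (picard S (\<lambda>x. e * g x) n x - op_inv T D g x)\<^sup>2 \<partial>I) \<longlonglongrightarrow> 0" using f(3) by simp
qed

lemma invertible_op_inv:
  assumes "invertible_op T D" "sq_int I g"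
  shows "sq_int I (op_inv T D g)" "aeq T (D (op_inv T D g)) g"
proof -
  have "\<forall>g. L2fun T g \<longrightarrow> (\<exists>f. L2fun T f \<and> aeq T (D f) g)"
    using assms(1) unfolding invertible_op_def by (elim conjE)
  then obtain f where "sq_int I f" "aeq T (D f) g"
    using assms(2) unfolding L2fun_iff_sq_int by metis
  then have "sq_int I (op_inv T D g) \<and> aeq T (D (op_inv T D g)) g"
    unfolding op_inv_def L2fun_iff_sq_int by (intro someI[of "\<lambda>f. sq_int I f \<and> aeq T (D f) g" f] conjI)
  then show "sq_int I (op_inv T D g)" "aeq T (D (op_inv T D g)) g" by auto
qed

text \<open>A known solution both witnesses that the choice succeeds and identifies its outcome. It
  will be applied to the right-hand side \<open>acoef\<close>, for which a solution is at hand
  before any regularity in time.\<close>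

lemma op_inv_aeq:
  assumes "invertible_op T D" "sq_int I f" "aeq T (D f) g"
  shows "aeq T f (op_inv T D g)" "sq_int I (op_inv T D g)"
proof -
  have o: "sq_int I (op_inv T D g) \<and> aeq T (D (op_inv T D g)) g"
    unfolding op_inv_def L2fun_iff_sq_int by (rule someI[of "\<lambda>f. sq_int I f \<and> aeq T (D f) g" f]) (simp add: assms(2,3))
  have "\<forall>f g. sq_int I f \<longrightarrow> sq_int I g \<longrightarrow> aeq T (D f) (D g) \<longrightarrow> aeq T f g"
    using assms(1) unfolding invertible_op_def L2fun_iff_sq_int by (elim conjE)
  then show "aeq T f (op_inv T D g)"
    using assms(2) o aeq_trans[OF assms(3) aeq_sym[OF conjunct2[OF o]]] by simp
  show "sq_int I (op_inv T D g)" using o by simp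
qed

text \<open>The equality is literal and not up to null sets, because the two choice operators range
  over the same predicate. Formulas containing \<open>op_inv\<close> may therefore be
  rewritten.\<close>

lemma op_inv_cong:
  assumes "\<And>f s. sq_int I f \<Longrightarrow> s \<in> {0..T} \<Longrightarrow> D f s = D' f s"
  shows "op_inv T D = op_inv T D'"
proof
  fix g
  have "(L2fun T f \<and> aeq T (D f) g) = (L2fun T f \<and> aeq T (D' f) g)" for f
    unfolding L2fun_iff_sq_int aeq_def
    by (intro conj_cong refl AE_cong) (use assms in auto)
  then show "op_inv T D g = op_inv T D' g" unfolding op_inv_def by presburger
qed

section \<open>Coercive operators: a multiple of the identity plus a symmetric kernel\<close>

definition symD :: "real \<Rightarrow> (real \<Rightarrow> real \<Rightarrow> real) \<Rightarrow> (real \<Rightarrow> real) \<Rightarrow> (real \<Rightarrow> real)" where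
  "symD lam k f = (\<lambda>s. 2 * lam * f s + kop T k f s)"

lemma sq_int_symD: "rowbd k C \<Longrightarrow> sq_int I f \<Longrightarrow> sq_int I (symD lam k f)"
  unfolding symD_def by (intro sq_int_add sq_int_cmult sq_int_kop)

lemma kop_symmetric:
  assumes k: "rowbd k C" and sym: "\<And>s r. s \<in> {0..T} \<Longrightarrow> r \<in> {0..T} \<Longrightarrow> k s r = k r s"
    and f: "sq_int I f" and g: "sq_int I g"
  shows "(\<integral>s. f s * kop T k g s \<partial>I) = (\<integral>s. kop T k f s * g s \<partial>I)"
proof -
  have "kop T (adj k) f r = kop T k f r" if "r \<in> {0..T}" for r
    unfolding kop_def adj_def by (rule Bochner_Integration.integral_cong) (use sym that in auto)
  then have "(\<integral>r. kop T (adj k) f r * g r \<partial>I) = (\<integral>r. kop T k f r * g r \<partial>I)"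
    by (intro Bochner_Integration.integral_cong) auto
  then show ?thesis using kop_adjoint[OF k f g] by simp
qed

lemma symD_symmetric:
  assumes k: "rowbd k C" and sym: "\<And>s r. s \<in> {0..T} \<Longrightarrow> r \<in> {0..T} \<Longrightarrow> k s r = k r s"
    and f: "sq_int I f" and g: "sq_int I g"
  shows "(\<integral>s. f s * symD lam k g s \<partial>I) = (\<integral>s. symD lam k f s * g s \<partial>I)"
proof -
  note i = sq_int_mult_integrable[OF f g] sq_int_mult_integrable[OF f sq_int_kop[OF k g]]
    sq_int_mult_integrable[OF sq_int_kop[OF k f] g]
  have ks: "(\<integral>s. f s * kop T k g s \<partial>I) = (\<integral>s. kop T k f s * g s \<partial>I)"
    by (rule kop_symmetric[OF k _ f g]) (rule sym)
  have "(\<integral>s. f s * symD lam k g s \<partial>I) = (\<integral>s. 2 * lam * (f s * g s) + f s * kop T k g s \<partial>I)"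
    unfolding symD_def by (rule Bochner_Integration.integral_cong) (auto simp: algebra_simps)
  also have "\<dots> = 2 * lam * (\<integral>s. f s * g s \<partial>I) + (\<integral>s. kop T k f s * g s \<partial>I)"
    using i ks by simp
  also have "\<dots> = (\<integral>s. 2 * lam * (f s * g s) + kop T k f s * g s \<partial>I)"
    using i by simp
  also have "\<dots> = (\<integral>s. symD lam k f s * g s \<partial>I)"
    unfolding symD_def by (rule Bochner_Integration.integral_cong) (auto simp: algebra_simps)
  finally show ?thesis .
qed

lemma symD_coercive:
  assumes k: "rowbd k C" and pos: "0 \<le> (\<integral>s. f s * kop T k f s \<partial>I)" and f: "sq_int I f"
  shows "2 * lam * (\<integral>s. (f s)\<^sup>2 \<partial>I) \<le> (\<integral>s. f s * symD lam k f s \<partial>I)"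
proof -
  note i = sq_intD[OF f] sq_int_mult_integrable[OF f sq_int_kop[OF k f]]
  have "(\<integral>s. f s * symD lam k f s \<partial>I) = (\<integral>s. 2 * lam * (f s)\<^sup>2 + f s * kop T k f s \<partial>I)"
    unfolding symD_def by (rule Bochner_Integration.integral_cong) (auto simp: algebra_simps power2_eq_square)
  also have "\<dots> = 2 * lam * (\<integral>s. (f s)\<^sup>2 \<partial>I) + (\<integral>s. f s * kop T k f s \<partial>I)"
    using i by simp
  finally show ?thesis using pos by linarith
qed

text \<open>With coercivity constant 2 lam and squared operator norm at most CD = 8 lam^2 + 2 C T,
  one step of size e multiplies the squared norm by at most 1 - 4 lam e + CD e^2. This e = 2 lam /
  CD is the minimiser.\<close>

definition relax :: "real \<Rightarrow> real \<Rightarrow> real" where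
  "relax lam C = 2 * lam / (8 * lam\<^sup>2 + 2 * (C * T))"

lemma relax_pos: "lam > 0 \<Longrightarrow> 0 \<le> C \<Longrightarrow> 0 < relax lam C"
  using T_pos unfolding relax_def by (intro divide_pos_pos add_pos_nonneg) auto

text \<open>Richardson iteration: subtracting a small multiple of a bounded coercive operator from
  the identity contracts. The rate is the minimum of the quadratic bound in the step size.\<close>

lemma symD_contraction:
  assumes k: "rowbd k C" and pos: "\<And>f. sq_int I f \<Longrightarrow> 0 \<le> (\<integral>s. f s * kop T k f s \<partial>I)" and lam: "lam > 0"
  defines "CD \<equiv> 8 * lam\<^sup>2 + 2 * (C * T)"
  shows "power_contraction I (\<lambda>f s. f s - relax lam C * symD lam k f s) (1 - 4 * lam\<^sup>2 / CD) (1 - 4 * lam\<^sup>2 / CD)"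
proof -
  define e where "e = relax lam C"
  define q where "q = 1 - 4 * lam\<^sup>2 / CD"
  define S where "S f = (\<lambda>s. f s - e * symD lam k f s)" for f
  have C0: "0 \<le> C * T" using rowbd_nonneg[OF k] T_pos by simp
  have CD: "CD > 0" "CD \<ge> 8 * lam\<^sup>2" using C0 lam unfolding CD_def by (auto intro: add_pos_nonneg)
  have e: "e = 2 * lam / CD" by (simp add: e_def relax_def CD_def)
  have q: "0 \<le> q" "q < 1" using CD lam by (auto simp: q_def field_simps)
  have Dbound: "(\<integral>s. (symD lam k f s)\<^sup>2 \<partial>I) \<le> CD * (\<integral>s. (f s)\<^sup>2 \<partial>I)" if f: "sq_int I f" for f
  proof -
    have "(\<integral>s. (symD lam k f s)\<^sup>2 \<partial>I) \<le> 2 * (\<integral>s. (2 * lam * f s)\<^sup>2 \<partial>I) + 2 * (\<integral>s. (kop T k f s)\<^sup>2 \<partial>I)"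
      unfolding symD_def by (rule integral_square_add_le[OF sq_int_cmult[OF f] sq_int_kop[OF k f]])
    also have "(\<integral>s. (2 * lam * f s)\<^sup>2 \<partial>I) = 4 * lam\<^sup>2 * (\<integral>s. (f s)\<^sup>2 \<partial>I)"
      by (simp add: power_mult_distrib)
    finally show ?thesis
      using integral_kop_square_le[OF k f] by (simp add: CD_def algebra_simps)
  qed
  have Sbound: "(\<integral>s. (S f s)\<^sup>2 \<partial>I) \<le> q * (\<integral>s. (f s)\<^sup>2 \<partial>I)" if f: "sq_int I f" for f
  proof -
    define A where "A = (\<integral>s. (f s)\<^sup>2 \<partial>I)"
    have "(\<integral>s. (S f s)\<^sup>2 \<partial>I) = A - 2 * e * (\<integral>s. f s * symD lam k f s \<partial>I) + e\<^sup>2 * (\<integral>s. (symD lam k f s)\<^sup>2 \<partial>I)"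
      using integral_square_add_scaled[OF f sq_int_symD[OF k f], of "-e" lam] by (simp add: S_def A_def)
    also have "\<dots> \<le> A - 2 * e * (2 * lam * A) + e\<^sup>2 * (CD * A)"
    proof -
      have "2 * e * (2 * lam * A) \<le> 2 * e * (\<integral>s. f s * symD lam k f s \<partial>I)"
        unfolding A_def using symD_coercive[OF k pos[OF f] f] CD lam by (intro mult_left_mono) (auto simp: e)
      moreover have "e\<^sup>2 * (\<integral>s. (symD lam k f s)\<^sup>2 \<partial>I) \<le> e\<^sup>2 * (CD * A)"
        unfolding A_def using Dbound[OF f] by (intro mult_left_mono) auto
      ultimately show ?thesis by linarith
    qed
    also have "\<dots> = q * A" using CD by (simp add: e q_def field_simps power2_eq_square)
    finally show ?thesis by (simp add: A_def)
  qed
  have Ssq: "sq_int I (S f)" if f: "sq_int I f" for f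
    unfolding S_def by (intro sq_int_diff sq_int_cmult sq_int_symD[OF k] f)
  have "power_contraction I S q q"
  proof
    fix f g assume f: "sq_int I f" and g: "sq_int I g"
    show "AE x in I. S (\<lambda>x. f x - g x) x = S f x - S g x"
      by (rule AE_I2) (simp add: S_def symD_def kop_diff[OF k f g] algebra_simps)
  next
    fix f assume f: "sq_int I f"
    have "sq_int I ((S ^^ n) f) \<and> (\<integral>x. ((S ^^ n) f x)\<^sup>2 \<partial>I) \<le> (\<integral>x. (f x)\<^sup>2 \<partial>I) * q ^ n" for n
    proof (induction n)
      case (Suc n)
      then have "(\<integral>x. (S ((S ^^ n) f) x)\<^sup>2 \<partial>I) \<le> q * ((\<integral>x. (f x)\<^sup>2 \<partial>I) * q ^ n)"
        using q by (intro order_trans[OF Sbound] mult_left_mono) auto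
      then show ?case using Suc Ssq by (simp add: mult_ac)
    qed (use f in simp)
    then show "\<exists>A. \<forall>n. (\<integral>x. ((S ^^ n) f x)\<^sup>2 \<partial>I) \<le> A * q ^ n" by blast
  qed (use Ssq Sbound q in auto)
  then show ?thesis unfolding S_def e_def q_def .
qed

lemma symD_invertible:
  assumes k: "rowbd k C" and pos: "\<And>f. sq_int I f \<Longrightarrow> 0 \<le> (\<integral>s. f s * kop T k f s \<partial>I)" and lam: "lam > 0"
  shows "invertible_op T (symD lam k)"
  by (rule invertible_op_contraction(1)[OF symD_contraction[OF k pos lam] relax_pos[OF lam rowbd_nonneg[OF k]]])
     auto

text \<open>Stated for pairings with a fixed \<open>h\<close>, since only pairings occur in the
  formulas and numbers are unaffected by the choice of representative.\<close>

lemma symD_op_inv_limit: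
  assumes k: "rowbd k C" and pos: "\<And>f. sq_int I f \<Longrightarrow> 0 \<le> (\<integral>s. f s * kop T k f s \<partial>I)" and lam: "lam > 0"
    and g: "sq_int I g" and h: "sq_int I h"
  shows "(\<lambda>n. \<integral>x. picard (\<lambda>f s. f s - relax lam C * symD lam k f s) (\<lambda>x. relax lam C * g x) n x * h x \<partial>I)
      \<longlonglongrightarrow> (\<integral>x. op_inv T (symD lam k) g x * h x \<partial>I)"
proof (rule tendsto_integral_mult_sq_int)
  note pc = symD_contraction[OF k pos lam]
  show "sq_int I (picard (\<lambda>f s. f s - relax lam C * symD lam k f s) (\<lambda>x. relax lam C * g x) n)" for n
    by (rule power_contraction.picard_sq[OF pc sq_int_cmult[OF g]])
  show "sq_int I (op_inv T (symD lam k) g)"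
    by (rule invertible_op_inv(1)[OF symD_invertible[OF k pos lam] g])
  show "(\<lambda>n. \<integral>x. (picard (\<lambda>f s. f s - relax lam C * symD lam k f s) (\<lambda>x. relax lam C * g x) n x
      - op_inv T (symD lam k) g x)\<^sup>2 \<partial>I) \<longlonglongrightarrow> 0"
    by (rule invertible_op_contraction(2)[OF pc relax_pos[OF lam rowbd_nonneg[OF k]] _ g]) auto
qed (rule h)

lemma symD_op_inv_bound:
  assumes k: "rowbd k C" and pos: "\<And>f. sq_int I f \<Longrightarrow> 0 \<le> (\<integral>s. f s * kop T k f s \<partial>I)" and lam: "lam > 0"
    and g: "sq_int I g"
  shows "(\<integral>x. (op_inv T (symD lam k) g x)\<^sup>2 \<partial>I) \<le> (\<integral>x. (g x)\<^sup>2 \<partial>I) / (4 * lam\<^sup>2)"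
proof -
  define p where "p = op_inv T (symD lam k) g"
  note inv = invertible_op_inv[OF symD_invertible[OF k pos lam] g, folded p_def]
  have p: "sq_int I p" by (rule inv(1))
  have eq: "aeq T (symD lam k p) g" by (rule inv(2))
  define A where "A = (\<integral>x. (p x)\<^sup>2 \<partial>I)"
  define B where "B = (\<integral>x. (g x)\<^sup>2 \<partial>I)"
  have A0: "0 \<le> A" unfolding A_def by simp
  have [measurable]: "p \<in> borel_measurable I" "g \<in> borel_measurable I" "symD lam k p \<in> borel_measurable I"
    using p g sq_int_symD[OF k p] by auto
  have "2 * lam * A \<le> (\<integral>x. p x * symD lam k p x \<partial>I)"
    unfolding A_def by (rule symD_coercive[OF k pos[OF p] p])
  also have "\<dots> = (\<integral>x. p x * g x \<partial>I)"
    by (rule integral_cong_AE) (use eq in \<open>auto simp: aeq_def\<close>)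
  finally have "(2 * lam * A)\<^sup>2 \<le> (\<integral>x. p x * g x \<partial>I)\<^sup>2"
    using lam A0 by (intro power_mono) auto
  also have "\<dots> \<le> A * B" unfolding A_def B_def by (rule Cauchy_Schwarz_integral[OF p g])
  finally have "A * (4 * lam\<^sup>2 * A) \<le> A * B" by (simp add: power2_eq_square mult_ac)
  then have "4 * lam\<^sup>2 * A \<le> B"
    using A0 by (cases "A = 0") (auto simp: B_def)
  then show ?thesis using lam unfolding A_def[symmetric] B_def[symmetric] p_def[symmetric]
    by (simp add: field_simps)
qed

section \<open>Volterra operators\<close>

text \<open>Integrating the exponential weight over the past gains the factor \<open>1 / b\<close>;
  a large \<open>b\<close> is what makes Volterra iterates shrink.\<close>

lemma integral_exp_le:
  assumes "b > 0" "t \<in> {0..T}"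
  shows "(\<integral>s. (if s < t then exp (b * s) else 0) \<partial>I) \<le> exp (b * t) / b"
proof -
  have hb: "has_bochner_integral lborel (\<lambda>x. exp (b * x) * indicator {0..t} x) (exp (b * t) / b - exp (b * 0) / b)"
    using assms by (intro has_bochner_integral_FTC_Icc_nonneg) (auto intro!: derivative_eq_intros continuous_intros)
  have "(\<integral>s. (if s < t then exp (b * s) else 0) \<partial>I) = (\<integral>s. indicator {0..T} s * (if s < t then exp (b * s) else 0) \<partial>lebesgue)"
    by (subst integral_restrict_space) auto
  also have "\<dots> = (\<integral>s. indicator {0..T} s * (if s < t then exp (b * s) else 0) \<partial>lborel)"
    by (rule integral_completion) measurable
  also have "\<dots> \<le> (\<integral>s. exp (b * s) * indicator {0..t} s \<partial>lborel)"
    by (rule integral_mono_AE') (use hb assms in \<open>auto simp: has_bochner_integral_iff indicator_def\<close>)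
  also have "\<dots> = exp (b * t) / b - 1 / b" using hb by (simp add: has_bochner_integral_iff)
  also have "\<dots> \<le> exp (b * t) / b" using assms by simp
  finally show ?thesis .
qed

text \<open>Picard iteration: a bound \<open>(f t)\<^sup>2 \<le> A e\<^sup>b\<^sup>t\<close> with \<open>b = 2 C\<close> improves by a factor \<open>1/2\<close> under the Volterra operator.\<close>
lemma volterra_contraction:
  assumes B: "rowbd B C" and V: "\<And>t s. t \<in> {0..T} \<Longrightarrow> s \<in> {0..T} \<Longrightarrow> t \<le> s \<Longrightarrow> B t s = 0" and C: "C > 0"
  shows "power_contraction I (kop T B) (C * T) (1/2)"
proof
  fix f g assume f: "sq_int I f" and g: "sq_int I g"
  show "AE x in I. kop T B (\<lambda>x. f x - g x) x = kop T B f x - kop T B g x"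
    by (rule AE_I2) (simp add: kop_diff[OF B f g])
next
  fix f assume f: "sq_int I f"
  define b where "b = 2 * C"
  \<comment> \<open>Twice the bound on the squared first iterate, so that the claim with exponent
    \<open>Suc n\<close> already holds at \<open>n = 0\<close>.\<close>
  define A where "A = 2 * C * (\<integral>s. (f s)\<^sup>2 \<partial>I)"
  have b: "b > 0" and A: "0 \<le> A" using C by (auto simp: b_def A_def)
  have sq: "sq_int I ((kop T B ^^ n) f)" for n
    by (induction n) (auto intro: f sq_int_kop[OF B])
  have step: "(kop T B h t)\<^sup>2 \<le> A' / 2 * exp (b * t)"
    if h: "sq_int I h" and hb: "\<And>s. s \<in> {0..T} \<Longrightarrow> (h s)\<^sup>2 \<le> A' * exp (b * s)" and A': "0 \<le> A'" and t: "t \<in> {0..T}" for h A' t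
  proof -
    have m: "{s \<in> space I. s < t} \<in> sets I"
      using measurable_lebesgue_on_borel by measurable
    \<comment> \<open>By the Volterra property only the past of \<open>h\<close> matters at time
      \<open>t\<close>; cutting it off before applying the row bound leaves an integral over
      \<open>s < t\<close>.\<close>
    define h' where "h' s = (if s \<in> {s \<in> space I. s < t} then h s else 0)" for s
    have h': "sq_int I h'" unfolding h'_def by (rule sq_int_restrict[OF h m])
    have "kop T B h t = kop T B h' t"
      unfolding kop_def by (rule Bochner_Integration.integral_cong) (use V t in \<open>auto simp: h'_def\<close>)
    then have "(kop T B h t)\<^sup>2 \<le> C * (\<integral>s. (h' s)\<^sup>2 \<partial>I)"
      using kop_square_le[OF B h' t] by simp
    also have "(\<integral>s. (h' s)\<^sup>2 \<partial>I) \<le> (\<integral>s. A' * (if s < t then exp (b * s) else 0) \<partial>I)"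
    proof (rule integral_mono[OF sq_intD[OF h']])
      have [measurable]: "(\<lambda>s. s) \<in> borel_measurable I" by (rule measurable_lebesgue_on_borel)
      have "integrable I (\<lambda>s. if s < t then exp (b * s) else 0)"
        by (rule I.integrable_const_bound[of _ "exp (b * T)"]) (use b in \<open>auto intro!: AE_I2\<close>)
      then show "integrable I (\<lambda>s. A' * (if s < t then exp (b * s) else 0))" by simp
      show "(h' s)\<^sup>2 \<le> A' * (if s < t then exp (b * s) else 0)" if "s \<in> space I" for s
        using hb that by (auto simp: h'_def)
    qed
    also have "(\<integral>s. A' * (if s < t then exp (b * s) else 0) \<partial>I) \<le> A' * (exp (b * t) / b)"
      using mult_left_mono[OF integral_exp_le[OF b t] A'] by simp
    finally have "(kop T B h t)\<^sup>2 \<le> C * (A' * (exp (b * t) / b))" using C by simp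
    also have "\<dots> = A' / 2 * exp (b * t)" using C by (simp add: b_def)
    finally show ?thesis .
  qed
  have pt: "((kop T B ^^ Suc n) f t)\<^sup>2 \<le> A * (1/2) ^ Suc n * exp (b * t)" if "t \<in> {0..T}" for n t
    using that
  proof (induction n arbitrary: t)
    case 0
    have "(kop T B f t)\<^sup>2 \<le> A / 2 * 1" using kop_square_le[OF B f 0] by (simp add: A_def)
    also have "\<dots> \<le> A / 2 * exp (b * t)" using 0 A b by (intro mult_left_mono) auto
    finally show ?case by simp
  next
    case (Suc n)
    have "(kop T B ((kop T B ^^ Suc n) f) t)\<^sup>2 \<le> A * (1/2) ^ Suc n / 2 * exp (b * t)"
      by (rule step[OF sq Suc.IH _ Suc.prems]) (use A in auto)
    then show ?case by simp
  qed
  \<comment> \<open>The first entry handles the zeroth power, the second the integral over the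
    interval of the pointwise bound for all higher powers.\<close>
  define A2 where "A2 = max (\<integral>s. (f s)\<^sup>2 \<partial>I) (A * exp (b * T) * T)"
  have "(\<integral>x. ((kop T B ^^ n) f x)\<^sup>2 \<partial>I) \<le> A2 * (1/2) ^ n" for n
  proof (cases n)
    case (Suc m)
    have "(\<integral>x. ((kop T B ^^ n) f x)\<^sup>2 \<partial>I) \<le> (\<integral>x. A * (1/2) ^ n * exp (b * T) \<partial>I)"
    proof (rule integral_mono[OF sq_intD[OF sq]])
      fix x assume "x \<in> space I"
      then have x: "x \<in> {0..T}" by simp
      have "((kop T B ^^ n) f x)\<^sup>2 \<le> A * (1/2) ^ n * exp (b * x)" using pt[OF x, of m] Suc by simp
      also have "\<dots> \<le> A * (1/2) ^ n * exp (b * T)" using x b A by (intro mult_left_mono) auto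
      finally show "((kop T B ^^ n) f x)\<^sup>2 \<le> A * (1/2) ^ n * exp (b * T)" .
    qed simp
    also have "\<dots> = (A * exp (b * T) * T) * (1/2) ^ n" unfolding integral_const_I by simp
    also have "\<dots> \<le> A2 * (1/2) ^ n" by (rule mult_right_mono) (auto simp: A2_def)
    finally show ?thesis .
  qed (simp add: A2_def)
  then show "\<exists>A. \<forall>n. (\<integral>x. ((kop T B ^^ n) f x)\<^sup>2 \<partial>I) \<le> A * (1/2) ^ n" by blast
qed (use sq_int_kop[OF B] integral_kop_square_le[OF B] in auto)

lemma volterra_invertible:
  assumes B: "rowbd B C" and V: "\<And>t s. t \<in> {0..T} \<Longrightarrow> s \<in> {0..T} \<Longrightarrow> t \<le> s \<Longrightarrow> B t s = 0"
  shows "invertible_op T (IminusB T B)"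
proof (rule invertible_op_contraction(1))
  \<comment> \<open>Enlarged so that the constant is strictly positive even for the zero
    kernel.\<close>
  have "rowbd B (C + 1)" using B unfolding rowbd_def by fastforce
  then show "power_contraction I (kop T B) ((C + 1) * T) (1/2)"
    using rowbd_nonneg[OF B] by (intro volterra_contraction V) auto
  show "(1::real) > 0" by simp
qed (auto simp: IminusB_def)

section \<open>Nonnegative definite Volterra kernels\<close>

text \<open>A cone: stable under sums and nonnegative multiples, so that it contains every kernel
  built from the three given ones. Positivity is stated for \<open>K\<close> alone, which is half of
  the symmetrised form by adjointness. One constant bounds rows and columns.\<close>

definition good :: "(real \<Rightarrow> real \<Rightarrow> real) \<Rightarrow> real \<Rightarrow> bool" where
  "good K C \<longleftrightarrow> rowbd K C \<and> rowbd (adj K) C \<and>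
     (\<forall>s\<in>{0..T}. \<forall>r\<in>{0..T}. s \<le> r \<longrightarrow> K s r = 0) \<and>
     (\<forall>f. sq_int I f \<longrightarrow> 0 \<le> (\<integral>s. f s * kop T K f s \<partial>I))"

lemma good_add:
  assumes K: "good K C" and L: "good L D"
  shows "good (\<lambda>s r. K s r + L s r) (2 * C + 2 * D)"
proof -
  have KL: "rowbd K C" "rowbd L D" "rowbd (adj K) C" "rowbd (adj L) D" using K L by (auto simp: good_def)
  have "0 \<le> (\<integral>s. f s * kop T (\<lambda>s r. K s r + L s r) f s \<partial>I)" if f: "sq_int I f" for f
  proof -
    have "(\<integral>s. f s * kop T (\<lambda>s r. K s r + L s r) f s \<partial>I) = (\<integral>s. f s * kop T K f s + f s * kop T L f s \<partial>I)"
      by (rule Bochner_Integration.integral_cong) (auto simp: kop_add_kernel[OF KL(1,2) f] distrib_left)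
    also have "\<dots> = (\<integral>s. f s * kop T K f s \<partial>I) + (\<integral>s. f s * kop T L f s \<partial>I)"
      using sq_int_mult_integrable[OF f sq_int_kop[OF KL(1) f]] sq_int_mult_integrable[OF f sq_int_kop[OF KL(2) f]] by simp
    finally show ?thesis using K L f by (simp add: good_def)
  qed
  moreover have "adj (\<lambda>s r. K s r + L s r) = (\<lambda>s r. adj K s r + adj L s r)" by (simp add: adj_def)
  ultimately show ?thesis
    using K L rowbd_add[OF KL(1,2)] rowbd_add[OF KL(3,4)] unfolding good_def by auto
qed

lemma good_cmult:
  assumes K: "good K C" and c: "0 \<le> c"
  shows "good (\<lambda>s r. c * K s r) (c\<^sup>2 * C)"
proof -
  have "0 \<le> (\<integral>s. f s * kop T (\<lambda>s r. c * K s r) f s \<partial>I)" if f: "sq_int I f" for f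
  proof -
    have "(\<integral>s. f s * kop T (\<lambda>s r. c * K s r) f s \<partial>I) = c * (\<integral>s. f s * kop T K f s \<partial>I)"
      by (simp add: kop_cmult_kernel mult.left_commute)
    then show ?thesis using K f c by (simp add: good_def)
  qed
  moreover have "adj (\<lambda>s r. c * K s r) = (\<lambda>s r. c * adj K s r)" by (simp add: adj_def)
  ultimately show ?thesis
    using K rowbd_cmult unfolding good_def by auto
qed

lemma measurable_pair_lborel: "case_prod K \<in> borel_measurable (lborel \<Otimes>\<^sub>M lborel) \<Longrightarrow> case_prod K \<in> borel_measurable (I \<Otimes>\<^sub>M I)"
proof -
  assume K: "case_prod K \<in> borel_measurable (lborel \<Otimes>\<^sub>M lborel)"
  have "(\<lambda>p. (fst p, snd p)) \<in> (I \<Otimes>\<^sub>M I) \<rightarrow>\<^sub>M (lborel \<Otimes>\<^sub>M lborel)"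
    by (intro measurable_Pair) (auto intro!: measurable_into_lebesgue_on_real simp: measurable_lborel1)
  from measurable_compose[OF this K] show ?thesis by simp
qed

lemma integrable_of_nn_bound:
  fixes D :: ennreal
  assumes f: "f \<in> borel_measurable I" and le: "(\<integral>\<^sup>+ r. ennreal ((f r)\<^sup>2) \<partial>I) \<le> D" and D: "D < \<infinity>"
  shows "sq_int I f" "(\<integral>r. (f r)\<^sup>2 \<partial>I) \<le> enn2real D"
proof -
  have [measurable]: "f \<in> borel_measurable I" by fact
  have "(\<integral>\<^sup>+ r. ennreal (norm ((f r)\<^sup>2)) \<partial>I) < \<infinity>" using le D by simp
  then have i: "integrable I (\<lambda>r. (f r)\<^sup>2)" by (intro integrableI_bounded) auto
  then show "sq_int I f" by (simp add: sq_int_def)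
  have "ennreal (\<integral>r. (f r)\<^sup>2 \<partial>I) \<le> D" using nn_integral_eq_integral[OF i] le by simp
  then show "(\<integral>r. (f r)\<^sup>2 \<partial>I) \<le> enn2real D"
    using D by (metis enn2real_ennreal enn2real_mono integral_nonneg_AE AE_I2 zero_le_power2 infinity_ennreal_def)
qed

lemma kernel_class_good:
  assumes "kernel_class T G"
  obtains C where "good G C"
proof -
  have G: "case_prod G \<in> borel_measurable (I \<Otimes>\<^sub>M I)"
    using assms by (intro measurable_pair_lborel) (simp add: kernel_class_def)
  have G': "case_prod (adj G) \<in> borel_measurable (I \<Otimes>\<^sub>M I)"
    using measurable_compose[OF measurable_pair_swap' G] by (simp add: adj_def case_prod_beta')
  obtain D where D: "\<And>t. t \<in> {0..T} \<Longrightarrow> (\<integral>\<^sup>+ s. ennreal ((G t s)\<^sup>2) \<partial>I) \<le> D"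
    "\<And>s. s \<in> {0..T} \<Longrightarrow> (\<integral>\<^sup>+ t. ennreal ((G t s)\<^sup>2) \<partial>I) \<le> D" "D < \<infinity>"
    using assms unfolding kernel_class_def by blast
  have mG: "G s \<in> borel_measurable I" and mG': "adj G s \<in> borel_measurable I" if "s \<in> {0..T}" for s
    using measurable_compose[OF measurable_Pair1'[of s I I] G] measurable_compose[OF measurable_Pair1'[of s I I] G'] that
    by simp_all
  have rG: "rowbd G (enn2real D)"
    using integrable_of_nn_bound[OF mG D(1) D(3)] G by (intro rowbdI) auto
  have D2: "(\<integral>\<^sup>+ t. ennreal ((adj G s t)\<^sup>2) \<partial>I) \<le> D" if "s \<in> {0..T}" for s
    using D(2)[OF that] by (simp add: adj_def)
  have rG': "rowbd (adj G) (enn2real D)"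
    using integrable_of_nn_bound[OF mG' D2 D(3)] G' by (intro rowbdI) auto
  have pos: "0 \<le> (\<integral>s. f s * kop T G f s \<partial>I)" if f: "sq_int I f" for f
  proof -
    have "0 \<le> (\<integral>t. (\<integral>s. (G t s + G s t) * f s * f t \<partial>I) \<partial>I)"
      using assms f unfolding kernel_class_def L2fun_iff_sq_int by blast
    also have "\<dots> = (\<integral>t. f t * kop T G f t + kop T (adj G) f t * f t \<partial>I)"
    proof (rule Bochner_Integration.integral_cong[OF refl])
      fix t assume "t \<in> space I"
      then have t: "t \<in> {0..T}" by simp
      have "(\<integral>s. (G t s + G s t) * f s * f t \<partial>I) = kop T (\<lambda>s r. G s r + adj G s r) f t * f t"
        unfolding kop_def adj_def by simp
      then show "(\<integral>s. (G t s + G s t) * f s * f t \<partial>I) = f t * kop T G f t + kop T (adj G) f t * f t"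
        using kop_add_kernel[OF rG rG' f t] by (simp add: algebra_simps)
    qed
    also have "\<dots> = 2 * (\<integral>s. f s * kop T G f s \<partial>I)"
      using sq_int_mult_integrable[OF f sq_int_kop[OF rG f]] sq_int_mult_integrable[OF sq_int_kop[OF rG' f] f]
        kop_adjoint[OF rG f f] by simp
    finally show ?thesis by simp
  qed
  have "good G (enn2real D)"
    using rG rG' pos assms unfolding good_def kernel_class_def by blast
  then show thesis by (rule that)
qed

text \<open>The kernel of the truncated operator plus its adjoint. For a Volterra \<open>K\<close>
  it vanishes on the time square unless both arguments are at least \<open>t\<close>:
  \<open>K s r\<close> requires \<open>r < s\<close>, so truncating one variable truncates
  both.\<close>

definition symk :: "(real \<Rightarrow> real \<Rightarrow> real) \<Rightarrow> real \<Rightarrow> real \<Rightarrow> real \<Rightarrow> real" where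
  "symk K t = (\<lambda>s r. (if t \<le> r then K s r else 0) + (if t \<le> s then adj K s r else 0))"

lemma rowbd_trunc: "rowbd K C \<Longrightarrow> rowbd (trunc K t) C"
  unfolding trunc_def by (rule rowbd_if[OF _ pred_le_snd])

lemma rowbd_adj_trunc: "rowbd (adj K) C \<Longrightarrow> rowbd (adj (trunc K t)) C"
  unfolding trunc_def adj_def by (rule rowbd_if[OF _ pred_le_fst])

lemma symk_eq: "symk K t = (\<lambda>s r. trunc K t s r + adj (trunc K t) s r)"
  by (simp add: symk_def trunc_def adj_def fun_eq_iff)

text \<open>The coefficient \<open>c\<close> may be negative, in which case the separate terms are
  not positive; only after merging them into one kernel can coercivity be seen.\<close>

lemma Dop_eq_symD:
  assumes H: "rowbd H C" "rowbd (adj H) C" and G: "rowbd G D" "rowbd (adj G) D"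
    and f: "sq_int I f" and s: "s \<in> {0..T}"
  shows "Dop T lam c H G t f s = symD lam (symk (\<lambda>s r. c * H s r + G s r) t) f s"
proof -
  note r = rowbd_trunc[OF H(1), of t] rowbd_adj_trunc[OF H(2), of t] rowbd_trunc[OF G(1), of t] rowbd_adj_trunc[OF G(2), of t]
  have "symk (\<lambda>s r. c * H s r + G s r) t = (\<lambda>s r. (c * (trunc H t s r + adj (trunc H t) s r)) + (trunc G t s r + adj (trunc G t) s r))"
    by (auto simp: symk_def trunc_def adj_def fun_eq_iff distrib_left)
  then have "kop T (symk (\<lambda>s r. c * H s r + G s r) t) f s
     = c * (kop T (trunc H t) f s + kop T (adj (trunc H t)) f s) + (kop T (trunc G t) f s + kop T (adj (trunc G t)) f s)"
    by (simp add: kop_add_kernel[OF rowbd_cmult[OF rowbd_add[OF r(1,2)]] rowbd_add[OF r(3,4)] f s]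
        kop_cmult_kernel kop_add_kernel[OF r(1,2) f s] kop_add_kernel[OF r(3,4) f s])
  then show ?thesis by (simp add: Dop_def symD_def)
qed

end

section \<open>The Volterra equation obtained by freezing time\<close>

text \<open>One abstract kernel, to be instantiated twice: for the response of a player and for the
  average.\<close>

locale volterra = horizon +
  fixes K :: "real \<Rightarrow> real \<Rightarrow> real" and C lam :: real
  assumes good_K: "good K C" and lam: "lam > 0"
begin

lemma K: "rowbd K C" and K': "rowbd (adj K) C"
  and K_volterra: "s \<in> {0..T} \<Longrightarrow> r \<in> {0..T} \<Longrightarrow> s \<le> r \<Longrightarrow> K s r = 0"
  and K_pos: "sq_int I f \<Longrightarrow> 0 \<le> (\<integral>s. f s * kop T K f s \<partial>I)"
  using good_K by (auto simp: good_def)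

lemma C_nonneg: "0 \<le> C" by (rule rowbd_nonneg[OF K])

abbreviation D :: "real \<Rightarrow> (real \<Rightarrow> real) \<Rightarrow> real \<Rightarrow> real" where "D t \<equiv> symD lam (symk K t)"

abbreviation col :: "real \<Rightarrow> real \<Rightarrow> real \<Rightarrow> real" where "col t s \<equiv> (\<lambda>r. if t \<le> r then K r s else 0)"

abbreviation B :: "real \<Rightarrow> real \<Rightarrow> real" where "B \<equiv> Bker T lam D K"

lemma rowbd_symk: "rowbd (symk K t) (4 * C)"
  using rowbd_add[OF rowbd_trunc[OF K] rowbd_adj_trunc[OF K'], of t t] by (simp add: symk_eq)

lemma symk_sym: "symk K t s r = symk K t r s"
  by (simp add: symk_def adj_def)

text \<open>The truncated kernel sees only the part of \<open>f\<close> after \<open>t\<close>, and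
  on that part it acts as \<open>K\<close> plus its adjoint; so the form is twice the form of
  \<open>K\<close> at the cut-off function.\<close>

lemma symk_pos:
  assumes f: "sq_int I f"
  shows "0 \<le> (\<integral>s. f s * kop T (symk K t) f s \<partial>I)"
proof -
  have m: "{s \<in> space I. t \<le> s} \<in> sets I" using measurable_lebesgue_on_borel by measurable
  define h where "h s = (if s \<in> {s \<in> space I. t \<le> s} then f s else 0)" for s
  have h: "sq_int I h" unfolding h_def by (rule sq_int_restrict[OF f m])
  have "(\<integral>s. f s * kop T (symk K t) f s \<partial>I) = (\<integral>s. h s * kop T K h s + kop T (adj K) h s * h s \<partial>I)"
  proof (rule Bochner_Integration.integral_cong[OF refl])
    fix s assume "s \<in> space I"
    then have s: "s \<in> {0..T}" by simp
    have "f s * kop T (symk K t) f s = (\<integral>r. f s * (symk K t s r * f r) \<partial>I)" by (simp add: kop_def)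
    also have "\<dots> = (\<integral>r. h s * ((K s r + adj K s r) * h r) \<partial>I)"
      by (rule Bochner_Integration.integral_cong[OF refl])
         (use s in \<open>auto simp: symk_def h_def adj_def K_volterra\<close>)
    also have "\<dots> = h s * kop T (\<lambda>s r. K s r + adj K s r) h s" by (simp add: kop_def)
    finally show "f s * kop T (symk K t) f s = h s * kop T K h s + kop T (adj K) h s * h s"
      using kop_add_kernel[OF K K' h s] by (simp add: algebra_simps)
  qed
  also have "\<dots> = 2 * (\<integral>s. h s * kop T K h s \<partial>I)"
    using sq_int_mult_integrable[OF h sq_int_kop[OF K h]] sq_int_mult_integrable[OF sq_int_kop[OF K' h] h]
      kop_adjoint[OF K h h] by simp
  finally show ?thesis using K_pos[OF h] by simp
qed

lemma D_invertible: "invertible_op T (D t)"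
  by (rule symD_invertible[OF rowbd_symk symk_pos lam])

lemmas op_inv_D = invertible_op_inv[OF D_invertible]

lemma D_sym: "sq_int I f \<Longrightarrow> sq_int I g \<Longrightarrow> (\<integral>s. f s * D t g s \<partial>I) = (\<integral>s. D t f s * g s \<partial>I)"
  by (rule symD_symmetric[OF rowbd_symk symk_sym])

text \<open>Insert \<open>D t (op_inv T (D t) g)\<close> for \<open>g\<close> and use the symmetry
  of \<open>D t\<close>.\<close>

lemma op_inv_adjoint:
  assumes g: "sq_int I g" and p: "sq_int I p"
  shows "(\<integral>s. g s * p s \<partial>I) = (\<integral>s. op_inv T (D t) g s * D t p s \<partial>I)"
proof -
  have [measurable]: "g \<in> borel_measurable I" "p \<in> borel_measurable I" "D t (op_inv T (D t) g) \<in> borel_measurable I"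
    using g p sq_int_symD[OF rowbd_symk op_inv_D(1)[OF g]] by auto
  have "(\<integral>s. g s * p s \<partial>I) = (\<integral>s. D t (op_inv T (D t) g) s * p s \<partial>I)"
    by (rule integral_cong_AE) (use op_inv_D(2)[OF g, of t] in \<open>auto simp: aeq_def\<close>)
  then show ?thesis using D_sym[OF op_inv_D(1)[OF g] p] by simp
qed

lemma op_inv_symmetric:
  assumes g: "sq_int I g" and h: "sq_int I h"
  shows "(\<integral>s. g s * op_inv T (D t) h s \<partial>I) = (\<integral>s. op_inv T (D t) g s * h s \<partial>I)"
proof -
  have [measurable]: "h \<in> borel_measurable I" "op_inv T (D t) g \<in> borel_measurable I" "D t (op_inv T (D t) h) \<in> borel_measurable I"
    using h sq_int_symD[OF rowbd_symk op_inv_D(1)[OF h]] op_inv_D(1)[OF g] by auto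
  have "(\<integral>s. g s * op_inv T (D t) h s \<partial>I) = (\<integral>s. op_inv T (D t) g s * D t (op_inv T (D t) h) s \<partial>I)"
    by (rule op_inv_adjoint[OF g op_inv_D(1)[OF h]])
  also have "\<dots> = (\<integral>s. op_inv T (D t) g s * h s \<partial>I)"
    by (rule integral_cong_AE) (use op_inv_D(2)[OF h, of t] in \<open>auto simp: aeq_def\<close>)
  finally show ?thesis .
qed

text \<open>A truncated column of \<open>K\<close> is a truncated row of \<open>adj K\<close>; here
  the column bound enters.\<close>

lemma rowbd_col: "rowbd (\<lambda>s. col t s) C"
  using rowbd_if[OF K' pred_le_snd, of t] unfolding adj_def .

lemma sq_int_col: "s \<in> {0..T} \<Longrightarrow> sq_int I (col t s)"
  by (rule rowbd_sq[OF rowbd_col])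

lemma col_norm: "s \<in> {0..T} \<Longrightarrow> (\<integral>r. (col t s r)\<^sup>2 \<partial>I) \<le> C"
  by (rule rowbd_le[OF rowbd_col])

lemma K_measurable: "f \<in> N \<rightarrow>\<^sub>M I \<Longrightarrow> g \<in> N \<rightarrow>\<^sub>M I \<Longrightarrow> (\<lambda>x. K (f x) (g x)) \<in> borel_measurable N"
  by (rule rowbd_measurable[OF K])

lemma sets_le_I:
  assumes "f \<in> N \<rightarrow>\<^sub>M I" "g \<in> N \<rightarrow>\<^sub>M I"
  shows "{x \<in> space N. f x \<le> g x} \<in> sets N"
proof -
  note [measurable] = assms[THEN measurable_into_lebesgue_on_real]
  show ?thesis by measurable
qed

lemma col_measurable:
  assumes "f \<in> N \<rightarrow>\<^sub>M I" "g \<in> N \<rightarrow>\<^sub>M I" "h \<in> N \<rightarrow>\<^sub>M I"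
  shows "(\<lambda>x. col (f x) (g x) (h x)) \<in> borel_measurable N"
  by (intro measurable_If K_measurable measurable_const sets_le_I assms) simp

lemma symk_measurable:
  assumes "f \<in> N \<rightarrow>\<^sub>M I" "g \<in> N \<rightarrow>\<^sub>M I" "h \<in> N \<rightarrow>\<^sub>M I"
  shows "(\<lambda>x. symk K (f x) (g x) (h x)) \<in> borel_measurable N"
  unfolding symk_def adj_def
  by (intro borel_measurable_add measurable_If K_measurable measurable_const sets_le_I assms) simp_all

text \<open>Explicit approximations of \<open>D t\<close> inverted on the column
  \<open>col t s\<close>. The step size is uniform in \<open>t\<close>, so that the recursion can be
  followed jointly in all variables.\<close>

definition iter :: "nat \<Rightarrow> real \<Rightarrow> real \<Rightarrow> real \<Rightarrow> real" where
  "iter n t s = picard (\<lambda>f s. f s - relax lam (4 * C) * D t f s) (\<lambda>x. relax lam (4 * C) * col t s x) n"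

lemma iter_measurable:
  "(\<lambda>x. iter n (fst (fst x)) (snd (fst x)) (snd x)) \<in> borel_measurable ((I \<Otimes>\<^sub>M I) \<Otimes>\<^sub>M I)"
proof (induction n)
  case 0
  show ?case by (simp add: iter_def picard_0)
next
  case (Suc n)
  note [measurable] = Suc
  have eq: "iter (Suc n) t s r = relax lam (4 * C) * col t s r + (iter n t s r
     - relax lam (4 * C) * (2 * lam * iter n t s r + (\<integral>r'. symk K t r r' * iter n t s r' \<partial>I)))" for t s r
    by (simp add: iter_def picard_Suc symD_def kop_def)
  have [measurable]: "(\<lambda>x. col (fst (fst x)) (snd (fst x)) (snd x)) \<in> borel_measurable ((I \<Otimes>\<^sub>M I) \<Otimes>\<^sub>M I)"
    by (rule col_measurable) measurable
  have 1: "(\<lambda>y. iter n (fst (fst (fst y))) (snd (fst (fst y))) (snd y)) \<in> borel_measurable (((I \<Otimes>\<^sub>M I) \<Otimes>\<^sub>M I) \<Otimes>\<^sub>M I)"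
    using measurable_compose[OF _ Suc, of "\<lambda>y. (fst (fst y), snd y)" "((I \<Otimes>\<^sub>M I) \<Otimes>\<^sub>M I) \<Otimes>\<^sub>M I"] by simp
  have 2: "(\<lambda>y. symk K (fst (fst (fst y))) (snd (fst y)) (snd y)) \<in> borel_measurable (((I \<Otimes>\<^sub>M I) \<Otimes>\<^sub>M I) \<Otimes>\<^sub>M I)"
    by (rule symk_measurable) measurable
  have "(\<lambda>(x, r'). symk K (fst (fst x)) (snd x) r' * iter n (fst (fst x)) (snd (fst x)) r') \<in> borel_measurable (((I \<Otimes>\<^sub>M I) \<Otimes>\<^sub>M I) \<Otimes>\<^sub>M I)"
    using borel_measurable_times[OF 2 1] by (simp add: case_prod_beta')
  then have [measurable]: "(\<lambda>x. \<integral>r'. symk K (fst (fst x)) (snd x) r' * iter n (fst (fst x)) (snd (fst x)) r' \<partial>I) \<in> borel_measurable ((I \<Otimes>\<^sub>M I) \<Otimes>\<^sub>M I)"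
    by (rule I.borel_measurable_lebesgue_integral)
  show ?case unfolding eq by measurable
qed

text \<open>The inverse is chosen separately for each pair of times, but its pairing with a column
  is a pointwise limit of pairings of the jointly measurable \<open>iter\<close>.\<close>

lemma resolvent_measurable:
  "(\<lambda>x. \<integral>r. op_inv T (D (fst x)) (col (fst x) (snd x)) r * col (fst x) (fst x) r \<partial>I) \<in> borel_measurable (I \<Otimes>\<^sub>M I)"
proof (rule borel_measurable_LIMSEQ_real)
  fix x assume "x \<in> space (I \<Otimes>\<^sub>M I)"
  then have x: "fst x \<in> {0..T}" "snd x \<in> {0..T}" by (auto simp: space_pair_measure)
  show "(\<lambda>n. \<integral>r. iter n (fst x) (snd x) r * col (fst x) (fst x) r \<partial>I)
      \<longlonglongrightarrow> (\<integral>r. op_inv T (D (fst x)) (col (fst x) (snd x)) r * col (fst x) (fst x) r \<partial>I)"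
    unfolding iter_def
    by (rule symD_op_inv_limit[OF rowbd_symk symk_pos lam sq_int_col[OF x(2)] sq_int_col[OF x(1)]])
next
  fix n
  have 1: "(\<lambda>y. col (fst (fst y)) (fst (fst y)) (snd y)) \<in> borel_measurable ((I \<Otimes>\<^sub>M I) \<Otimes>\<^sub>M I)"
    by (rule col_measurable) measurable
  have "(\<lambda>(x, r). iter n (fst x) (snd x) r * col (fst x) (fst x) r) \<in> borel_measurable ((I \<Otimes>\<^sub>M I) \<Otimes>\<^sub>M I)"
    using borel_measurable_times[OF iter_measurable[of n] 1] by (simp add: case_prod_beta')
  then show "(\<lambda>x. \<integral>r. iter n (fst x) (snd x) r * col (fst x) (fst x) r \<partial>I) \<in> borel_measurable (I \<Otimes>\<^sub>M I)"
    by (rule I.borel_measurable_lebesgue_integral)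
qed

lemma B_eq: "B t s = (if s < t then ((\<integral>r. op_inv T (D t) (col t s) r * col t t r \<partial>I) - K t s) / (2 * lam) else 0)"
  by (simp add: Bker_def ip_def mult.commute)

text \<open>The resolvent term \<open>R\<close> is bounded pointwise: the columns have squared norm
  at most \<open>C\<close> and the inverse has norm at most 1 / (2 lam). The factors 2 come from
  squaring a difference, the last denominator from the prefactor 1 / (2 lam).\<close>

lemma rowbd_B: "rowbd B ((2 * (C\<^sup>2 / (4 * lam\<^sup>2) * T) + 2 * C) / (4 * lam\<^sup>2))"
proof -
  define R where "R t s = (\<integral>r. op_inv T (D t) (col t s) r * col t t r \<partial>I)" for t s
  have R: "rowbd R (C\<^sup>2 / (4 * lam\<^sup>2) * T)"
  proof (rule rowbdI)
    show Rm: "case_prod R \<in> borel_measurable (I \<Otimes>\<^sub>M I)"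
      using resolvent_measurable unfolding R_def case_prod_beta' .
    fix t assume t: "t \<in> {0..T}"
    have le: "(R t s)\<^sup>2 \<le> C\<^sup>2 / (4 * lam\<^sup>2)" if s: "s \<in> {0..T}" for s
    proof -
      have "(R t s)\<^sup>2 \<le> (\<integral>r. (op_inv T (D t) (col t s) r)\<^sup>2 \<partial>I) * (\<integral>r. (col t t r)\<^sup>2 \<partial>I)"
        unfolding R_def by (rule Cauchy_Schwarz_integral[OF op_inv_D(1)[OF sq_int_col[OF s]] sq_int_col[OF t]])
      also have "\<dots> \<le> C / (4 * lam\<^sup>2) * C"
      proof (rule mult_mono)
        have "(\<integral>r. (op_inv T (D t) (col t s) r)\<^sup>2 \<partial>I) \<le> (\<integral>r. (col t s r)\<^sup>2 \<partial>I) / (4 * lam\<^sup>2)"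
          by (rule symD_op_inv_bound[OF rowbd_symk symk_pos lam sq_int_col[OF s]])
        also have "\<dots> \<le> C / (4 * lam\<^sup>2)" by (rule divide_right_mono[OF col_norm[OF s]]) simp
        finally show "(\<integral>r. (op_inv T (D t) (col t s) r)\<^sup>2 \<partial>I) \<le> C / (4 * lam\<^sup>2)" .
      qed (use col_norm[OF t] C_nonneg in auto)
      finally show ?thesis by (simp add: power2_eq_square)
    qed
    have m: "R t \<in> borel_measurable I"
      using measurable_compose[OF measurable_Pair1'[of t I I] Rm] t by simp
    show sq: "sq_int I (R t)"
      by (rule sq_int_bound[of _ "\<lambda>_. C\<^sup>2 / (4 * lam\<^sup>2)"]) (use le m in auto)
    have "(\<integral>s. (R t s)\<^sup>2 \<partial>I) \<le> (\<integral>s. C\<^sup>2 / (4 * lam\<^sup>2) \<partial>I)"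
      by (rule integral_mono[OF sq_intD[OF sq]]) (use le in auto)
    then show "(\<integral>s. (R t s)\<^sup>2 \<partial>I) \<le> C\<^sup>2 / (4 * lam\<^sup>2) * T" by (simp only: integral_const_I)
  qed
  have "rowbd (\<lambda>t s. - 1 * K t s) C" using rowbd_cmult[OF K, of "-1"] by simp
  from rowbd_cmult[OF rowbd_add[OF R this], of "1 / (2 * lam)"]
  have 1: "rowbd (\<lambda>t s. 1 / (2 * lam) * (R t s + - 1 * K t s)) ((2 * (C\<^sup>2 / (4 * lam\<^sup>2) * T) + 2 * C) / (4 * lam\<^sup>2))"
    by (simp add: power_divide power_mult_distrib)
  have 2: "Measurable.pred (I \<Otimes>\<^sub>M I) (\<lambda>(t, s). s < t)"
  proof -
    have [measurable]: "fst \<in> borel_measurable (I \<Otimes>\<^sub>M I)" "snd \<in> borel_measurable (I \<Otimes>\<^sub>M I)"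
      by (auto intro: measurable_into_lebesgue_on_real)
    have "Measurable.pred (I \<Otimes>\<^sub>M I) (\<lambda>p. snd p < fst p)" by measurable
    then show ?thesis by (simp add: case_prod_beta')
  qed
  have "B = (\<lambda>t s. if s < t then 1 / (2 * lam) * (R t s + - 1 * K t s) else 0)"
    by (auto simp: fun_eq_iff B_eq R_def)
  then show ?thesis using rowbd_if[OF 1 2] by simp
qed

lemma IminusB_invertible: "invertible_op T (IminusB T B)"
  by (rule volterra_invertible[OF rowbd_B]) (simp add: B_eq)

text \<open>For fixed \<open>t\<close>, \<open>m\<close> plays the role of a path of \<open>\<lambda>r. E\<^sub>t[u\<^sub>r]\<close>: it agrees with \<open>u\<close> before \<open>t\<close>, and after \<open>t\<close>
  it solves \<open>D\<^sub>t m = 1\<^sub>{t\<le>\<cdot>} (y - \<integral>\<^sub>0\<^sup>t K(\<cdot>, s) u\<^sub>s ds)\<close>, so it can be eliminated from the equation at time \<open>t\<close>.\<close>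
lemma pathwise_representation:
  assumes t: "t \<in> {0..T}" and u: "sq_int I u" and m: "sq_int I m" and y: "y \<in> borel_measurable I"
    and y_eq: "AE s in I. t \<le> s \<longrightarrow> y s = 2 * lam * m s + kop T (\<lambda>s r. K s r + adj K s r) m s"
    and past: "AE r in I. r \<le> t \<longrightarrow> m r = u r"
    and X: "X = 2 * lam * u t + kop T (\<lambda>s r. K s r + adj K s r) m t"
  shows "IminusB T B u t = (X - ip T (col t t) (op_inv T (D t) (\<lambda>r. if t \<le> r then y r else 0))) / (2 * lam)"
proof -
  have m_lt [measurable]: "{s \<in> space I. s < t} \<in> sets I" "{s \<in> space I. t \<le> s} \<in> sets I"
    using measurable_lebesgue_on_borel by measurable
  \<comment> \<open>The future of \<open>m\<close> is the unknown to be eliminated; the past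
    \<open>v\<close> is the known control, and \<open>W\<close> is its contribution to the equation
    after \<open>t\<close>.\<close>
  define p where "p s = (if s \<in> {s \<in> space I. t \<le> s} then m s else 0)" for s
  define v where "v s = (if s \<in> {s \<in> space I. s < t} then u s else 0)" for s
  define W where "W s = (if s \<in> {s \<in> space I. t \<le> s} then kop T K v s else 0)" for s
  define Y where "Y r = (if t \<le> r then y r else 0)" for r
  have p: "sq_int I p" unfolding p_def by (rule sq_int_restrict[OF m m_lt(2)])
  have v: "sq_int I v" unfolding v_def by (rule sq_int_restrict[OF u m_lt(1)])
  have W: "sq_int I W" unfolding W_def by (rule sq_int_restrict[OF sq_int_kop[OF K v] m_lt(2)])
  have ct: "sq_int I (col t t)" by (rule sq_int_col[OF t])
  \<comment> \<open>For \<open>s\<close> at or after \<open>t\<close> the adjoint looks only at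
    times later than \<open>s\<close>, so the past enters through \<open>K\<close> alone.\<close>
  have split: "kop T (\<lambda>s r. K s r + adj K s r) m s = kop T K v s + kop T (symk K t) p s"
    if s: "s \<in> {0..T}" "t \<le> s" for s
  proof -
    have vp: "aeq T m (\<lambda>r. v r + 1 * p r)"
      unfolding aeq_def using past AE_space by eventually_elim (auto simp: v_def p_def)
    have vps: "sq_int I (\<lambda>r. v r + 1 * p r)" by (intro sq_int_add v sq_int_cmult p)
    have "kop T K m s = kop T K (\<lambda>r. v r + 1 * p r) s"
      by (rule kop_cong_AE[OF K _ _ vp s(1)]) (use m vps in auto)
    also have "\<dots> = kop T K v s + kop T K p s" using kop_add_scaled[OF K v p s(1), of 1] by simp
    finally have 1: "kop T K m s = kop T K v s + kop T K p s" .
    have 2: "kop T (adj K) m s = kop T (adj K) p s"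
      unfolding kop_def by (rule Bochner_Integration.integral_cong[OF refl])
        (use s t in \<open>auto simp: p_def adj_def K_volterra\<close>)
    have 3: "kop T (symk K t) p s = kop T (\<lambda>s r. K s r + adj K s r) p s"
      unfolding kop_def by (rule Bochner_Integration.integral_cong[OF refl])
        (use s in \<open>auto simp: p_def symk_def\<close>)
    show ?thesis
      unfolding 3 kop_add_kernel[OF K K' m s(1)] kop_add_kernel[OF K K' p s(1)] 1 2 by simp
  qed
  \<comment> \<open>Both sides vanish before \<open>t\<close>, where the truncated kernel is zero
    and all functions are cut off, so the equation holds on the whole interval.\<close>
  have Dp: "aeq T (D t p) (\<lambda>s. Y s - W s)"
    unfolding aeq_def using y_eq AE_space
  proof eventually_elim
    case (elim s)
    then have s: "s \<in> {0..T}" by simp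
    show ?case
    proof (cases "t \<le> s")
      case True
      then show ?thesis using elim split[OF s True] by (simp add: symD_def Y_def W_def p_def)
    next
      case False
      have "kop T (symk K t) p s = (\<integral>r. 0 \<partial>I)"
        unfolding kop_def by (rule Bochner_Integration.integral_cong[OF refl])
          (use s False in \<open>auto simp: symk_def p_def K_volterra\<close>)
      then show ?thesis using False by (simp add: symD_def Y_def W_def p_def)
    qed
  qed
  have Dps: "sq_int I (D t p)" by (rule sq_int_symD[OF rowbd_symk p])
  have Ym: "Y \<in> borel_measurable I"
  proof -
    have [measurable]: "y \<in> borel_measurable I" "(\<lambda>r. r) \<in> borel_measurable I" using y measurable_lebesgue_on_borel by auto
    show ?thesis unfolding Y_def by measurable
  qed
  \<comment> \<open>Square-integrability of the cut-off data is read off from the equation.\<close>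
  have Y: "sq_int I Y"
    by (rule sq_int_cong_AE[OF sq_int_add[OF Dps W] Ym]) (use Dp in \<open>auto simp: aeq_def\<close>)
  \<comment> \<open>By symmetry the inverse is moved onto the column at time \<open>t\<close>; the
    pairing with the unknown future \<open>p\<close> becomes a pairing of \<open>q\<close> with data
    and past.\<close>
  define q where "q = op_inv T (D t) (col t t)"
  have q: "sq_int I q" unfolding q_def by (rule op_inv_D(1)[OF ct])
  have [measurable]: "q \<in> borel_measurable I" "D t p \<in> borel_measurable I" "Y \<in> borel_measurable I" "W \<in> borel_measurable I"
    using q Dps Y W by auto
  have "(\<integral>r. col t t r * p r \<partial>I) = (\<integral>r. q r * D t p r \<partial>I)"
    unfolding q_def by (rule op_inv_adjoint[OF ct p])
  also have "\<dots> = (\<integral>r. q r * Y r - q r * W r \<partial>I)"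
    by (rule integral_cong_AE) (use Dp in \<open>auto simp: aeq_def right_diff_distrib\<close>)
  also have "\<dots> = (\<integral>r. q r * Y r \<partial>I) - (\<integral>r. q r * W r \<partial>I)"
    using sq_int_mult_integrable[OF q Y] sq_int_mult_integrable[OF q W] by simp
  also have "(\<integral>r. q r * Y r \<partial>I) = ip T (col t t) (op_inv T (D t) Y)"
    unfolding ip_def q_def by (rule op_inv_symmetric[OF ct Y, symmetric])
  finally have cp: "(\<integral>r. col t t r * p r \<partial>I) = ip T (col t t) (op_inv T (D t) Y) - (\<integral>r. q r * W r \<partial>I)" .
  have symt: "kop T (symk K t) p t = (\<integral>r. col t t r * p r \<partial>I)"
    unfolding kop_def by (rule Bochner_Integration.integral_cong[OF refl])
      (use t in \<open>auto simp: symk_def p_def adj_def K_volterra\<close>)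
  have X': "X = 2 * lam * u t + kop T K v t + (\<integral>r. col t t r * p r \<partial>I)"
    using X split[OF t order_refl] symt by simp
  \<comment> \<open>\<open>W\<close> is the operator with kernel \<open>K1\<close> applied to the
    past, and the rows of \<open>adj K1\<close> are the truncated columns. Transposing onto
    \<open>q\<close> produces precisely the resolvent part of the kernel \<open>B\<close>.\<close>
  define K1 where "K1 = (\<lambda>s r. if t \<le> s then K s r else 0)"
  have K1: "rowbd K1 C" unfolding K1_def by (rule rowbd_if[OF K pred_le_fst])
  have "(\<integral>r. q r * W r \<partial>I) = (\<integral>r. q r * kop T K1 v r \<partial>I)"
    by (rule Bochner_Integration.integral_cong[OF refl]) (auto simp: W_def K1_def kop_def)
  also have "\<dots> = (\<integral>r. kop T (adj K1) q r * v r \<partial>I)" by (rule kop_adjoint[OF K1 q v])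
  finally have qW: "(\<integral>r. q r * W r \<partial>I) = (\<integral>r. kop T (adj K1) q r * v r \<partial>I)" .
  have K1': "adj K1 = (\<lambda>r. col t r)" by (auto simp: adj_def K1_def fun_eq_iff)
  have res: "kop T (adj K1) q r = ip T (col t t) (op_inv T (D t) (col t r))" if r: "r \<in> {0..T}" for r
  proof -
    have "kop T (adj K1) q r = (\<integral>s. q s * col t r s \<partial>I)" by (simp add: kop_def K1' mult.commute)
    also have "\<dots> = ip T (col t t) (op_inv T (D t) (col t r))"
      unfolding q_def ip_def by (rule op_inv_symmetric[OF ct sq_int_col[OF r], symmetric])
    finally show ?thesis .
  qed
  have "kop T B u t = (\<integral>r. (1 / (2 * lam)) * (kop T (adj K1) q r * v r - K t r * v r) \<partial>I)"
    unfolding kop_def[of T B]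
    by (rule Bochner_Integration.integral_cong[OF refl])
       (auto simp: Bker_def res v_def algebra_simps diff_divide_distrib add_divide_distrib)
  also have "\<dots> = (1 / (2 * lam)) * ((\<integral>r. kop T (adj K1) q r * v r \<partial>I) - kop T K v t)"
    using sq_int_mult_integrable[OF sq_int_kop[OF _ q] v, of "adj K1"] rowbd_col[of t]
      sq_int_mult_integrable[OF rowbd_sq[OF K t] v] by (simp add: K1' kop_def[of T K])
  finally have Bu: "kop T B u t = (1 / (2 * lam)) * ((\<integral>r. q r * W r \<partial>I) - kop T K v t)" using qW by simp
  show ?thesis
    unfolding IminusB_def Bu X' cp Y_def[symmetric] using lam by (simp add: field_simps)
qed

end

section \<open>Progressive versions of conditional expectations\<close>

lemma AE_tendsto_0_of_summable:
  fixes f :: "nat \<Rightarrow> 'a \<Rightarrow> real"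
  assumes [measurable]: "\<And>n. f n \<in> borel_measurable M" and f0: "\<And>n x. x \<in> space M \<Longrightarrow> 0 \<le> f n x"
    and sum: "(\<Sum>n. \<integral>\<^sup>+x. ennreal (f n x) \<partial>M) < \<infinity>"
  shows "AE x in M. summable (\<lambda>n. f n x)"
proof -
  have "(\<integral>\<^sup>+x. (\<Sum>n. ennreal (f n x)) \<partial>M) = (\<Sum>n. \<integral>\<^sup>+x. ennreal (f n x) \<partial>M)"
    by (rule nn_integral_suminf) measurable
  with sum have "(\<integral>\<^sup>+x. (\<Sum>n. ennreal (f n x)) \<partial>M) \<noteq> \<infinity>" by simp
  then have "AE x in M. (\<Sum>n. ennreal (f n x)) \<noteq> \<infinity>"
    by (rule nn_integral_PInf_AE[rotated]) measurable
  then show ?thesis using AE_space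
    by eventually_elim (auto intro!: summable_suminf_not_top simp: f0)
qed

text \<open>After the shift the two integrals cancel on the common interval; what is left is at most
  the last stretch of length \<open>h\<close>, where the integrand is at most 1, minus a nonnegative
  term. No continuity of the monotone function enters.\<close>

lemma mono_shift_integral_le:
  fixes \<phi> :: "real \<Rightarrow> real"
  assumes mono: "mono \<phi>" and b: "\<And>t. 0 \<le> \<phi> t" "\<And>t. \<phi> t \<le> 1" and h: "0 \<le> h"
  shows "(\<integral>t. indicator {0..T} t * (\<phi> t - \<phi> (t - h)) \<partial>lborel) \<le> h"
proof -
  have [measurable]: "\<phi> \<in> borel_measurable borel" by (rule borel_measurable_mono[OF mono])
  have int: "integrable lborel (\<lambda>t. indicator {a..c} t * f t)"
    if [measurable]: "f \<in> borel_measurable borel" and "\<And>t. 0 \<le> f t" "\<And>t. f t \<le> 1" for a c :: real and f :: "real \<Rightarrow> real"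
  proof (rule Bochner_Integration.integrable_bound)
    show "integrable lborel (indicator {a..c} :: real \<Rightarrow> real)" by (cases "a \<le> c") auto
    show "AE x in lborel. norm (indicator {a..c} x * f x) \<le> norm (indicator {a..c} x :: real)"
      using that by (intro AE_I2) (auto simp: indicator_def)
  qed measurable
  have i1: "integrable lborel (\<lambda>t. indicator {0..T} t * \<phi> t)"
    and i2: "integrable lborel (\<lambda>t. indicator {0..T} t * \<phi> (t - h))"
    and i3: "integrable lborel (\<lambda>t. indicator {-h..T-h} t * \<phi> t)"
    using b by (auto intro!: int)
  have "(\<integral>t. indicator {0..T} t * \<phi> (t - h) \<partial>lborel) = (\<integral>t. indicator {0..T} (h + t) * \<phi> ((h + t) - h) \<partial>lborel)"
    using lborel_integral_real_affine[of 1 "\<lambda>t. indicator {0..T} t * \<phi> (t - h)" h] by simp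
  also have "\<dots> = (\<integral>t. indicator {-h..T-h} t * \<phi> t \<partial>lborel)"
    by (rule Bochner_Integration.integral_cong) (auto simp: indicator_def)
  finally have sh: "(\<integral>t. indicator {0..T} t * \<phi> (t - h) \<partial>lborel) = (\<integral>t. indicator {-h..T-h} t * \<phi> t \<partial>lborel)" .
  have "(\<integral>t. indicator {0..T} t * (\<phi> t - \<phi> (t - h)) \<partial>lborel)
      = (\<integral>t. indicator {0..T} t * \<phi> t \<partial>lborel) - (\<integral>t. indicator {-h..T-h} t * \<phi> t \<partial>lborel)"
    using i1 i2 by (simp add: right_diff_distrib flip: sh)
  also have "\<dots> = (\<integral>t. indicator {0..T} t * \<phi> t - indicator {-h..T-h} t * \<phi> t \<partial>lborel)"
    using i1 i3 by simp
  also have "\<dots> \<le> (\<integral>t. indicator {T-h..T} t \<partial>lborel)"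
  proof (rule integral_mono)
    show "integrable lborel (\<lambda>t. indicator {0..T} t * \<phi> t - indicator {-h..T-h} t * \<phi> t)" using i1 i3 by simp
    show "integrable lborel (indicator {T-h..T} :: real \<Rightarrow> real)" using h by (cases "T-h \<le> T") auto
    show "indicator {0..T} t * \<phi> t - indicator {-h..T-h} t * \<phi> t \<le> indicator {T-h..T} t" for t
      using b[of t] h by (auto simp: indicator_def)
  qed
  also have "\<dots> = h" using h by simp
  finally show ?thesis .
qed

section \<open>Conditional expectation: Jensen and monotone convergence\<close>

context finite_measure_subalgebra
begin

lemma integrable_of_sq_int: "sq_int M X \<Longrightarrow> integrable M X"
  using sq_int_mult_integrable[of M X "\<lambda>_. 1"] by (simp add: sq_int_def)

lemma sq_int_real_cond_exp:
  assumes X: "sq_int M X"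
  shows "sq_int M (real_cond_exp M F X)" "(\<integral>x. (real_cond_exp M F X x)\<^sup>2 \<partial>M) \<le> (\<integral>x. (X x)\<^sup>2 \<partial>M)"
proof -
  note X2 = sq_intD[OF X]
  have le: "AE x in M. (real_cond_exp M F X x)\<^sup>2 \<le> real_cond_exp M F (\<lambda>x. (X x)\<^sup>2) x"
    by (rule real_cond_exp_jensens_inequality(2)[where I=UNIV and q="\<lambda>x. x\<^sup>2", OF integrable_of_sq_int[OF X]])
       (use X2 convex_power2 in auto)
  have i: "integrable M (\<lambda>x. (real_cond_exp M F X x)\<^sup>2)"
    by (rule Bochner_Integration.integrable_bound[OF real_cond_exp_int(1)[OF X2]])
       (use le in \<open>auto elim!: eventually_mono\<close>)
  then show "sq_int M (real_cond_exp M F X)" by (simp add: sq_int_def)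
  have "(\<integral>x. (real_cond_exp M F X x)\<^sup>2 \<partial>M) \<le> (\<integral>x. real_cond_exp M F (\<lambda>x. (X x)\<^sup>2) x \<partial>M)"
    by (rule integral_mono_AE[OF i real_cond_exp_int(1)[OF X2] le])
  then show "(\<integral>x. (real_cond_exp M F X x)\<^sup>2 \<partial>M) \<le> (\<integral>x. (X x)\<^sup>2 \<partial>M)"
    by (simp add: real_cond_exp_int(2)[OF X2])
qed

lemma nn_cond_exp_zero: "AE x in M. nn_cond_exp M F (\<lambda>_. 0) x = 0"
  by (rule AE_symmetric[OF nn_cond_exp_F_meas]) simp

lemma nn_cond_exp_finite:
  assumes [measurable]: "f \<in> borel_measurable M" and "(\<integral>\<^sup>+x. f x \<partial>M) < \<infinity>"
  shows "AE x in M. nn_cond_exp M F f x < \<infinity>"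
proof -
  have "(\<integral>\<^sup>+x. nn_cond_exp M F f x \<partial>M) = (\<integral>\<^sup>+x. f x \<partial>M)"
    using nn_cond_exp_intg[of "\<lambda>_. 1" f] by simp
  then have "(\<integral>\<^sup>+x. nn_cond_exp M F f x \<partial>M) \<noteq> \<infinity>" using assms(2) by simp
  then have "AE x in M. nn_cond_exp M F f x \<noteq> \<infinity>" by (rule nn_integral_PInf_AE[rotated]) simp
  then show ?thesis by (rule eventually_mono) (simp add: top.not_eq_extremum)
qed

lemma nn_cond_exp_indicator:
  assumes [measurable]: "A \<in> sets M"
  shows "AE x in M. nn_cond_exp M F (indicator A) x = ennreal (real_cond_exp M F (indicator A) x)"
proof -
  have "AE x in M. nn_cond_exp M F (indicator A) x < \<infinity>"
    by (rule nn_cond_exp_finite) (simp_all add: less_top[symmetric])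
  then show ?thesis using nn_cond_exp_zero
  proof eventually_elim
    case (elim x)
    have "(\<lambda>x. ennreal (- indicator A x)) = (\<lambda>_. 0)" by (auto simp: indicator_def ennreal_neg)
    moreover have "(\<lambda>x. ennreal (indicator A x)) = indicator A" by (auto simp: indicator_def)
    ultimately show ?case using elim by (simp add: real_cond_exp_def)
  qed
qed

text \<open>Conditional monotone convergence, obtained by testing the supremum on sets of the
  subalgebra.\<close>

lemma nn_cond_exp_SUP:
  fixes h :: "nat \<Rightarrow> 'a \<Rightarrow> ennreal"
  assumes [measurable]: "\<And>n. h n \<in> borel_measurable M" and inc: "incseq h"
  shows "AE x in M. (SUP n. nn_cond_exp M F (h n) x) = nn_cond_exp M F (\<lambda>x. SUP n. h n x) x"
proof (rule nn_cond_exp_charact)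
  fix A assume A: "A \<in> sets F"
  have [measurable]: "A \<in> sets M" using A subalg by (auto simp: subalgebra_def)
  have mono: "AE x in M. nn_cond_exp M F (h n) x \<le> nn_cond_exp M F (h (Suc n)) x" for n
    by (rule nn_cond_exp_mono) (use inc in \<open>auto simp: incseq_Suc_iff le_fun_def\<close>)
  have "(\<integral>\<^sup>+x\<in>A. (SUP n. h n x) \<partial>M) = (\<integral>\<^sup>+x. (SUP n. h n x * indicator A x) \<partial>M)"
    by (intro nn_integral_cong) (auto simp: indicator_def)
  also have "\<dots> = (SUP n. \<integral>\<^sup>+x\<in>A. h n x \<partial>M)"
    by (rule nn_integral_monotone_convergence_SUP)
       (use inc in \<open>auto simp: incseq_Suc_iff le_fun_def intro!: mult_right_mono\<close>)
  also have "\<dots> = (SUP n. \<integral>\<^sup>+x\<in>A. nn_cond_exp M F (h n) x \<partial>M)"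
    using nn_cond_exp_intg[of "indicator A" "h _"] A by (simp add: mult.commute)
  also have "\<dots> = (\<integral>\<^sup>+x. (SUP n. nn_cond_exp M F (h n) x * indicator A x) \<partial>M)"
  proof (rule nn_integral_monotone_convergence_SUP_AE[symmetric])
    show "AE x in M. nn_cond_exp M F (h n) x * indicator A x \<le> nn_cond_exp M F (h (Suc n)) x * indicator A x" for n
      using mono[of n] by eventually_elim (rule mult_right_mono, auto)
  qed measurable
  also have "\<dots> = (\<integral>\<^sup>+x\<in>A. (SUP n. nn_cond_exp M F (h n) x) \<partial>M)"
    by (intro nn_integral_cong) (auto simp: indicator_def)
  finally show "(\<integral>\<^sup>+x\<in>A. (SUP n. h n x) \<partial>M) = (\<integral>\<^sup>+x\<in>A. (SUP n. nn_cond_exp M F (h n) x) \<partial>M)" .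
qed measurable

end

section \<open>Closed martingales sampled on dyadic grids\<close>

locale filtered = horizon T + prob_space M for T :: real and M :: "'a measure" +
  fixes F :: "real \<Rightarrow> 'a measure"
  assumes usual: "usual_filtration M F T"
begin

lemma subalg: "t \<in> {0..T} \<Longrightarrow> subalgebra M (F t)"
  using usual by (simp add: usual_filtration_def)

lemma cond: "t \<in> {0..T} \<Longrightarrow> finite_measure_subalgebra M (F t)"
  using subalg by unfold_locales

lemma F_mono: "0 \<le> s \<Longrightarrow> s \<le> t \<Longrightarrow> t \<le> T \<Longrightarrow> sets (F s) \<subseteq> sets (F t)"
  using usual by (simp add: usual_filtration_def)

lemma space_F: "t \<in> {0..T} \<Longrightarrow> space (F t) = space M"
  using subalg by (simp add: subalgebra_def)

lemma F_subset_M: "t \<in> {0..T} \<Longrightarrow> sets (F t) \<subseteq> sets M"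
  using subalg by (simp add: subalgebra_def)

lemma subalgebra_F: "0 \<le> s \<Longrightarrow> s \<le> t \<Longrightarrow> t \<le> T \<Longrightarrow> subalgebra (F t) (F s)"
  using F_mono space_F[of s] space_F[of t] by (simp add: subalgebra_def)

text \<open>Pythagoras: the increment is orthogonal to the earlier projection.\<close>

lemma cond_exp_increment:
  assumes X: "sq_int M X" and st: "0 \<le> s" "s \<le> t" "t \<le> T"
  shows "(\<integral>\<omega>. (real_cond_exp M (F t) X \<omega> - real_cond_exp M (F s) X \<omega>)\<^sup>2 \<partial>M)
    = (\<integral>\<omega>. (real_cond_exp M (F t) X \<omega>)\<^sup>2 \<partial>M) - (\<integral>\<omega>. (real_cond_exp M (F s) X \<omega>)\<^sup>2 \<partial>M)"
proof -
  interpret S: finite_measure_subalgebra M "F s" using st by (intro cond) auto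
  interpret E: finite_measure_subalgebra M "F t" using st by (intro cond) auto
  let ?s = "real_cond_exp M (F s) X" and ?t = "real_cond_exp M (F t) X"
  note sq = S.sq_int_real_cond_exp(1)[OF X] E.sq_int_real_cond_exp(1)[OF X]
  have m: "?s \<in> borel_measurable (F t)"
    by (rule measurable_from_subalg[OF subalgebra_F[OF st]]) simp
  have Xm: "X \<in> borel_measurable M" using X by (simp add: sq_int_def)
  have "(\<integral>\<omega>. ?s \<omega> * ?t \<omega> \<partial>M) = (\<integral>\<omega>. ?s \<omega> * X \<omega> \<partial>M)"
    by (rule E.real_cond_exp_intg(2)[OF sq_int_mult_integrable[OF sq(1) X] m Xm])
  also have "\<dots> = (\<integral>\<omega>. ?s \<omega> * ?s \<omega> \<partial>M)"
    by (rule S.real_cond_exp_intg(2)[OF sq_int_mult_integrable[OF sq(1) X] _ Xm, symmetric]) simp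
  finally have eq: "(\<integral>\<omega>. ?t \<omega> * ?s \<omega> \<partial>M) = (\<integral>\<omega>. (?s \<omega>)\<^sup>2 \<partial>M)" by (simp add: power2_eq_square mult.commute)
  show ?thesis
    using integral_square_add_scaled[OF sq(2,1), of "-1"] eq by simp
qed

text \<open>The dyadic point just at or below \<open>t\<close>. Sampling from the left keeps the
  approximations adapted.\<close>

definition grid :: "nat \<Rightarrow> real \<Rightarrow> real" where
  "grid n t = T * real (nat \<lfloor>2 ^ n * t / T\<rfloor>) / 2 ^ n"

lemma grid_bounds:
  assumes "0 \<le> t"
  shows "0 \<le> grid n t" "grid n t \<le> t" "t - T / 2 ^ n \<le> grid n t"
proof -
  define k where "k = \<lfloor>2 ^ n * t / T\<rfloor>"
  have k0: "0 \<le> k" unfolding k_def using assms T_pos by simp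
  then have g: "grid n t = T * of_int k / 2 ^ n" by (simp add: grid_def flip: k_def)
  show "0 \<le> grid n t" using T_pos by (simp add: grid_def)
  have "of_int k \<le> 2 ^ n * t / T" "2 ^ n * t / T < of_int k + 1" unfolding k_def by linarith+
  then have "T * of_int k \<le> 2 ^ n * t" "2 ^ n * t \<le> T * of_int k + T" using T_pos by (auto simp: field_simps)
  then have "T * of_int k / 2 ^ n \<le> t" "t \<le> (T * of_int k + T) / 2 ^ n"
    by (simp_all add: pos_divide_le_eq pos_le_divide_eq mult.commute)
  then show "grid n t \<le> t" "t - T / 2 ^ n \<le> grid n t" unfolding g by (simp_all add: add_divide_distrib)
qed

lemma borel_measurable_grid_process:
  assumes t0: "t0 \<in> {0..T}" and e: "\<And>s. s \<in> {0..T} \<Longrightarrow> e s \<in> borel_measurable (F s)"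
  shows "(\<lambda>(t, \<omega>). e (grid n t) \<omega> :: real) \<in> borel_measurable (restrict_space borel {0..t0} \<Otimes>\<^sub>M F t0)"
proof -
  let ?N = "restrict_space borel {0..t0} \<Otimes>\<^sub>M F t0"
  define a where "a k = T * real k / 2 ^ n" for k
  \<comment> \<open>Measurability is required for every index, also for grid points beyond
    \<open>t0\<close>; these are replaced by zero and never selected.\<close>
  have 1: "(\<lambda>x. if a k \<le> t0 then e (a k) (snd x) else 0) \<in> borel_measurable ?N" for k
  proof (cases "a k \<le> t0")
    case True
    then have ak: "0 \<le> a k" "a k \<le> t0" "t0 \<le> T" using t0 T_pos by (auto simp: a_def)
    have "e (a k) \<in> borel_measurable (F t0)"
      by (rule measurable_from_subalg[OF subalgebra_F[OF ak] e]) (use ak in auto)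
    then show ?thesis using True by simp
  qed simp
  have 2: "(\<lambda>x. nat \<lfloor>2 ^ n * fst x / T\<rfloor>) \<in> ?N \<rightarrow>\<^sub>M count_space UNIV"
  proof -
    have [measurable]: "fst \<in> borel_measurable ?N"
      by (rule measurable_compose[OF measurable_fst, of "\<lambda>x. x"]) (simp add: measurable_restrict_space1)
    show ?thesis by measurable
  qed
  have "(\<lambda>x. if a (nat \<lfloor>2 ^ n * fst x / T\<rfloor>) \<le> t0 then e (a (nat \<lfloor>2 ^ n * fst x / T\<rfloor>)) (snd x) else 0) \<in> borel_measurable ?N"
    by (rule measurable_compose_countable[OF 1 2])
  moreover have "(\<lambda>x. if a (nat \<lfloor>2 ^ n * fst x / T\<rfloor>) \<le> t0 then e (a (nat \<lfloor>2 ^ n * fst x / T\<rfloor>)) (snd x) else 0) x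
      = (case x of (t, \<omega>) \<Rightarrow> e (grid n t) \<omega>)" if "x \<in> space ?N" for x
    using that grid_bounds[of "fst x" n] by (auto simp: space_pair_measure a_def grid_def space_restrict_space)
  ultimately show ?thesis by (subst (asm) measurable_cong) auto
qed

text \<open>The martingale \<open>E\<^sub>t[X]\<close> is sampled on dyadic grids from the left. As \<open>t \<mapsto> E[(E\<^sub>t[X])\<^sup>2]\<close> is monotone,
  the squared errors are summable in \<open>n\<close> for almost every \<open>t\<close>, which yields almost sure convergence.\<close>
lemma martingale_version:
  assumes X: "sq_int M X"
  obtains m :: "real \<Rightarrow> 'a \<Rightarrow> real" where
    "\<And>t0. t0 \<in> {0..T} \<Longrightarrow> (\<lambda>(t, \<omega>). m t \<omega>) \<in> borel_measurable (restrict_space borel {0..t0} \<Otimes>\<^sub>M F t0)"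
    "AE t in I. AE \<omega> in M. m t \<omega> = real_cond_exp M (F t) X \<omega>"
proof -
  define e where "e t = real_cond_exp M (F t) X" for t
  \<comment> \<open>A strictly positive bound on the second moments, used to normalise them to the
    unit interval.\<close>
  define c where "c = (\<integral>\<omega>. (X \<omega>)\<^sup>2 \<partial>M) + 1"
  have c: "c > 0" unfolding c_def by (simp add: add_nonneg_pos)
  \<comment> \<open>Extends the second-moment function to the whole line as a monotone function, so
    that it may be shifted to the left of 0.\<close>
  define clip where "clip t = max 0 (min T t)" for t
  have clip: "clip t \<in> {0..T}" for t using T_pos by (auto simp: clip_def)
  define \<psi> where "\<psi> t = (\<integral>\<omega>. (e t \<omega>)\<^sup>2 \<partial>M)" for t
  define \<phi> where "\<phi> t = \<psi> (clip t) / c" for t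
  have esq: "sq_int M (e t)" and \<psi>le: "\<psi> t \<le> c" if "t \<in> {0..T}" for t
  proof -
    interpret E: finite_measure_subalgebra M "F t" by (rule cond[OF that])
    show "sq_int M (e t)" "\<psi> t \<le> c"
      using E.sq_int_real_cond_exp[OF X] by (auto simp: e_def \<psi>_def c_def)
  qed
  have incr: "(\<integral>\<omega>. (e t \<omega> - e s \<omega>)\<^sup>2 \<partial>M) = \<psi> t - \<psi> s" if "0 \<le> s" "s \<le> t" "t \<le> T" for s t
    unfolding e_def \<psi>_def by (rule cond_exp_increment[OF X that])
  have \<psi>mono: "\<psi> s \<le> \<psi> t" if "0 \<le> s" "s \<le> t" "t \<le> T" for s t
  proof -
    have "0 \<le> (\<integral>\<omega>. (e t \<omega> - e s \<omega>)\<^sup>2 \<partial>M)" by simp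
    then show ?thesis using incr[OF that] by simp
  qed
  have \<phi>: "mono \<phi>" "\<And>t. 0 \<le> \<phi> t" "\<And>t. \<phi> t \<le> 1"
  proof -
    show "mono \<phi>" unfolding \<phi>_def using c T_pos
      by (intro monoI divide_right_mono \<psi>mono) (auto simp: clip_def)
    show "0 \<le> \<phi> t" "\<phi> t \<le> 1" for t
      using \<psi>le[OF clip, of t] c by (auto simp: \<phi>_def \<psi>_def)
  qed
  have [measurable]: "\<phi> \<in> borel_measurable borel" by (rule borel_measurable_mono[OF \<phi>(1)])
  define d where "d n t = \<phi> t - \<phi> (t - T / 2 ^ n)" for n t
  have d0: "0 \<le> d n t" for n t using \<phi>(1) T_pos by (auto simp: d_def mono_def)
  have [measurable]: "d n \<in> borel_measurable borel" for n unfolding d_def by measurable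
  have dint: "(\<integral>\<^sup>+t. ennreal (indicator {0..T} t * d n t) \<partial>lborel) \<le> ennreal (T * (1/2) ^ n)" for n
  proof -
    have "integrable lborel (\<lambda>t. indicator {0..T} t * d n t)"
    proof (rule Bochner_Integration.integrable_bound)
      show "integrable lborel (indicator {0..T} :: real \<Rightarrow> real)" using T_pos by simp
      show "AE x in lborel. norm (indicator {0..T} x * d n x) \<le> norm (indicator {0..T} x :: real)"
      proof (rule AE_I2)
        fix x
        have "d n x \<le> 1" using \<phi>(2)[of "x - T / 2 ^ n"] \<phi>(3)[of x] by (simp add: d_def)
        then show "norm (indicator {0..T} x * d n x) \<le> norm (indicator {0..T} x :: real)"
          using d0[of n x] by (auto simp: indicator_def)
      qed
    qed measurable
    then have "(\<integral>\<^sup>+t. ennreal (indicator {0..T} t * d n t) \<partial>lborel) = ennreal (\<integral>t. indicator {0..T} t * d n t \<partial>lborel)"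
      by (rule nn_integral_eq_integral) (use d0 in auto)
    also have "\<dots> \<le> ennreal (T / 2 ^ n)"
      unfolding d_def by (intro ennreal_leI mono_shift_integral_le \<phi>) (use T_pos in auto)
    finally show ?thesis by (simp add: power_divide)
  qed
  \<comment> \<open>The increments over mesh \<open>T / 2 ^ n\<close> have integrals at most
    \<open>T / 2 ^ n\<close>; these are summable, so the increments themselves are summable for
    almost every \<open>t\<close>.\<close>
  have "AE t in lborel. summable (\<lambda>n. indicator {0..T} t * d n t)"
  proof (rule AE_tendsto_0_of_summable)
    have "(\<Sum>n. \<integral>\<^sup>+t. ennreal (indicator {0..T} t * d n t) \<partial>lborel) \<le> (\<Sum>n. ennreal (T * (1/2) ^ n))"
      by (intro suminf_le dint) auto
    also have "\<dots> = ennreal (\<Sum>n. T * (1/2) ^ n)"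
      by (rule suminf_ennreal2) (use T_pos in \<open>auto intro!: summable_mult summable_geometric\<close>)
    finally show "(\<Sum>n. \<integral>\<^sup>+t. ennreal (indicator {0..T} t * d n t) \<partial>lborel) < \<infinity>"
      by (simp add: le_less_trans)
  qed (use d0 in auto)
  then have "AE t in lebesgue. summable (\<lambda>n. indicator {0..T} t * d n t)" by (rule AE_completion)
  then have sumd: "AE t in I. summable (\<lambda>n. d n t)"
    by (subst AE_restrict_space_iff) (auto elim!: eventually_mono)
  define m where "m t \<omega> = lim (\<lambda>n. e (grid n t) \<omega>)" for t \<omega>
  show thesis
  proof (rule that[of m])
    fix t0 assume t0: "t0 \<in> {0..T}"
    have "(\<lambda>x. lim (\<lambda>n. (case x of (t, \<omega>) \<Rightarrow> e (grid n t) \<omega>))) \<in> borel_measurable (restrict_space borel {0..t0} \<Otimes>\<^sub>M F t0)"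
      by (rule borel_measurable_lim_metric) (rule borel_measurable_grid_process[OF t0], simp add: e_def)
    then show "(\<lambda>(t, \<omega>). m t \<omega>) \<in> borel_measurable (restrict_space borel {0..t0} \<Otimes>\<^sub>M F t0)"
      by (simp add: m_def case_prod_beta')
  next
    show "AE t in I. AE \<omega> in M. m t \<omega> = real_cond_exp M (F t) X \<omega>"
      using sumd AE_space
    proof eventually_elim
      case (elim t)
      then have t: "0 \<le> t" "t \<le> T" by auto
      note g = grid_bounds[OF t(1)]
      have gT: "grid n t \<in> {0..T}" for n using g[of n] t by auto
      have [measurable]: "e t \<in> borel_measurable M" "\<And>n. e (grid n t) \<in> borel_measurable M"
        using esq[of t] esq[OF gT] t by (auto simp: sq_int_def)
      have le: "(\<integral>\<omega>. (e t \<omega> - e (grid n t) \<omega>)\<^sup>2 \<partial>M) \<le> c * d n t" for n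
      proof -
        \<comment> \<open>The grid point lies within one mesh width of \<open>t\<close>, so by
          monotonicity the error is at most the increment \<open>d n t\<close>.\<close>
        have "clip (t - T / 2 ^ n) \<le> grid n t" using g[of n] by (auto simp: clip_def)
        then have "\<psi> (clip (t - T / 2 ^ n)) \<le> \<psi> (grid n t)"
          using gT[of n] clip[of "t - T / 2 ^ n"] by (intro \<psi>mono) auto
        moreover have "clip t = t" using t by (simp add: clip_def)
        ultimately show ?thesis using c incr[OF g(1,2) t(2), of n] by (simp add: d_def \<phi>_def right_diff_distrib)
      qed
      have "AE \<omega> in M. summable (\<lambda>n. (e t \<omega> - e (grid n t) \<omega>)\<^sup>2)"
      proof (rule AE_tendsto_0_of_summable)
        have "(\<integral>\<^sup>+\<omega>. ennreal ((e t \<omega> - e (grid n t) \<omega>)\<^sup>2) \<partial>M) \<le> ennreal (c * d n t)" for n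
          using le[of n] nn_integral_eq_integral[OF sq_intD[OF sq_int_diff[OF esq[of t] esq[OF gT]]], of n] t
          by (auto intro: ennreal_leI)
        then have "(\<Sum>n. \<integral>\<^sup>+\<omega>. ennreal ((e t \<omega> - e (grid n t) \<omega>)\<^sup>2) \<partial>M) \<le> (\<Sum>n. ennreal (c * d n t))"
          by (intro suminf_le) auto
        also have "\<dots> = ennreal (\<Sum>n. c * d n t)"
          by (rule suminf_ennreal2) (use elim d0 c in \<open>auto intro: summable_mult\<close>)
        finally show "(\<Sum>n. \<integral>\<^sup>+\<omega>. ennreal ((e t \<omega> - e (grid n t) \<omega>)\<^sup>2) \<partial>M) < \<infinity>"
          by (simp add: le_less_trans)
      qed auto
      then show ?case
      proof eventually_elim
        case (elim \<omega>)
        have "(\<lambda>n. sqrt ((e t \<omega> - e (grid n t) \<omega>)\<^sup>2)) \<longlonglongrightarrow> sqrt 0"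
          by (intro tendsto_real_sqrt summable_LIMSEQ_zero elim)
        then have "(\<lambda>n. e t \<omega> - e (grid n t) \<omega>) \<longlonglongrightarrow> 0" by (simp add: tendsto_rabs_zero_iff)
        from tendsto_diff[OF tendsto_const[of "e t \<omega>"] this] have "(\<lambda>n. e (grid n t) \<omega>) \<longlonglongrightarrow> e t \<omega>" by simp
        then show ?case by (simp add: m_def limI e_def)
      qed
    qed
  qed
qed

section \<open>Versions measurable jointly in both times and the scenario\<close>

abbreviation J :: "real measure" where "J \<equiv> restrict_space borel {0..T}"

sublocale IM: pair_sigma_finite I M ..

text \<open>Progressive in the conditioning time, with the inner time as a free Borel parameter.
  Values are extended nonnegative so that monotone limits stay inside the class.\<close>

definition prog3 :: "(real \<Rightarrow> real \<Rightarrow> 'a \<Rightarrow> ennreal) \<Rightarrow> bool" where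
  "prog3 Y \<longleftrightarrow> (\<forall>t0\<in>{0..T}. (\<lambda>(t, s, \<omega>). Y t s \<omega>) \<in> borel_measurable (restrict_space borel {0..t0} \<Otimes>\<^sub>M (borel \<Otimes>\<^sub>M F t0)))"

text \<open>The exceptional set of conditioning times does not depend on \<open>s\<close>; only the
  null set of scenarios does. This order survives countable suprema and permits evaluation at any
  \<open>s\<close>, in particular on the diagonal.\<close>

definition version_of :: "(real \<times> 'a \<Rightarrow> ennreal) \<Rightarrow> (real \<Rightarrow> real \<Rightarrow> 'a \<Rightarrow> ennreal) \<Rightarrow> bool" where
  "version_of h Y \<longleftrightarrow> prog3 Y \<and>
     (AE t in I. \<forall>s. AE \<omega> in M. Y t s \<omega> = nn_cond_exp M (F t) (\<lambda>\<omega>. h (s, \<omega>)) \<omega>)"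

lemma prog3D: "prog3 Y \<Longrightarrow> t0 \<in> {0..T} \<Longrightarrow>
    (\<lambda>x. Y (fst x) (fst (snd x)) (snd (snd x))) \<in> borel_measurable (restrict_space borel {0..t0} \<Otimes>\<^sub>M (borel \<Otimes>\<^sub>M F t0))"
  by (simp add: prog3_def case_prod_beta')

lemma prog3I: "(\<And>t0. t0 \<in> {0..T} \<Longrightarrow>
    (\<lambda>x. Y (fst x) (fst (snd x)) (snd (snd x))) \<in> borel_measurable (restrict_space borel {0..t0} \<Otimes>\<^sub>M (borel \<Otimes>\<^sub>M F t0))) \<Longrightarrow> prog3 Y"
  by (simp add: prog3_def case_prod_beta')

lemma version_of_prog3: "version_of h Y \<Longrightarrow> prog3 Y"
  unfolding version_of_def by (rule conjunct1)

lemma version_of_AE: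
  assumes "version_of h Y"
  shows "AE t in I. t \<in> {0..T} \<and> (\<forall>s. AE \<omega> in M. Y t s \<omega> = nn_cond_exp M (F t) (\<lambda>\<omega>. h (s, \<omega>)) \<omega>)"
proof -
  have "AE t in I. \<forall>s. AE \<omega> in M. Y t s \<omega> = nn_cond_exp M (F t) (\<lambda>\<omega>. h (s, \<omega>)) \<omega>"
    using assms unfolding version_of_def by (rule conjunct2)
  then show ?thesis using AE_space[of I] by eventually_elim simp
qed

text \<open>On a rectangle the inner time factors out, leaving the martingale of one indicator. This
  is the only input from probability; the rest is a measure-theoretic extension.\<close>

lemma version_of_rectangle:
  assumes a: "a \<in> sets borel" and b: "b \<in> sets M"
  shows "\<exists>Y. version_of (indicator (a \<times> b)) Y"
proof -
  have "sq_int M (indicator b)" using b by (auto simp: sq_int_def power2_eq_square indicator_inter_arith[symmetric] less_top[symmetric])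
  then obtain m where m: "\<And>t0. t0 \<in> {0..T} \<Longrightarrow> (\<lambda>(t, \<omega>). m t \<omega>) \<in> borel_measurable (restrict_space borel {0..t0} \<Otimes>\<^sub>M F t0)"
    and m_eq: "AE t in I. AE \<omega> in M. m t \<omega> = real_cond_exp M (F t) (indicator b) \<omega>"
    using martingale_version by blast
  define Y where "Y t s \<omega> = (indicator a s :: ennreal) * ennreal (m t \<omega>)" for t s \<omega>
  have "prog3 Y"
  proof (rule prog3I)
    fix t0 assume t0: "t0 \<in> {0..T}"
    have [measurable]: "(\<lambda>x. m (fst x) (snd (snd x))) \<in> borel_measurable (restrict_space borel {0..t0} \<Otimes>\<^sub>M (borel \<Otimes>\<^sub>M F t0))"
    proof -
      have "(\<lambda>x. (case (fst x, snd (snd x)) of (t, \<omega>) \<Rightarrow> m t \<omega>)) \<in> borel_measurable (restrict_space borel {0..t0} \<Otimes>\<^sub>M (borel \<Otimes>\<^sub>M F t0))"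
        by (rule measurable_compose[OF _ m[OF t0]]) measurable
      then show ?thesis by simp
    qed
    show "(\<lambda>x. Y (fst x) (fst (snd x)) (snd (snd x))) \<in> borel_measurable (restrict_space borel {0..t0} \<Otimes>\<^sub>M (borel \<Otimes>\<^sub>M F t0))"
      unfolding Y_def using a by measurable
  qed
  moreover have "AE t in I. \<forall>s. AE \<omega> in M. Y t s \<omega> = nn_cond_exp M (F t) (\<lambda>\<omega>. indicator (a \<times> b) (s, \<omega>)) \<omega>"
    using m_eq AE_space
  proof eventually_elim
    case (elim t)
    then interpret E: finite_measure_subalgebra M "F t" by (intro cond) auto
    show ?case
    proof
      fix s
      show "AE \<omega> in M. Y t s \<omega> = nn_cond_exp M (F t) (\<lambda>\<omega>. indicator (a \<times> b) (s, \<omega>)) \<omega>"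
      proof (cases "s \<in> a")
        case True
        then have "(\<lambda>\<omega>. indicator (a \<times> b) (s, \<omega>)) = (indicator b :: 'a \<Rightarrow> ennreal)" by (auto simp: indicator_def)
        then show ?thesis using E.nn_cond_exp_indicator[OF b] elim(1) True by (auto simp: Y_def)
      next
        case False
        then have "(\<lambda>\<omega>. indicator (a \<times> b) (s, \<omega>)) = (\<lambda>_::'a. 0 :: ennreal)" by (auto simp: indicator_def)
        then show ?thesis using E.nn_cond_exp_zero False by (auto simp: Y_def)
      qed
    qed
  qed
  ultimately show ?thesis unfolding version_of_def by blast
qed

lemma version_of_cmult:
  assumes h: "h \<in> borel_measurable (borel \<Otimes>\<^sub>M M)" and Y: "version_of h Y"
  shows "version_of (\<lambda>x. c * h x) (\<lambda>t s \<omega>. c * Y t s \<omega>)"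
  unfolding version_of_def
proof
  show "prog3 (\<lambda>t s \<omega>. c * Y t s \<omega>)"
    by (intro prog3I borel_measurable_times_ennreal prog3D[OF version_of_prog3[OF Y]] measurable_const) simp_all
  show "AE t in I. \<forall>s. AE \<omega> in M. c * Y t s \<omega> = nn_cond_exp M (F t) (\<lambda>\<omega>. c * h (s, \<omega>)) \<omega>"
    using version_of_AE[OF Y]
  proof eventually_elim
    case (elim t)
    then interpret E: finite_measure_subalgebra M "F t" by (intro cond) auto
    have [measurable]: "(\<lambda>\<omega>. h (s, \<omega>)) \<in> borel_measurable M" for s
      by (rule measurable_compose[OF measurable_Pair1' h]) simp
    show ?case
    proof
      fix s
      have "AE \<omega> in M. Y t s \<omega> = nn_cond_exp M (F t) (\<lambda>\<omega>. h (s, \<omega>)) \<omega>" using elim by blast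
      moreover have "AE \<omega> in M. c * nn_cond_exp M (F t) (\<lambda>\<omega>. h (s, \<omega>)) \<omega> = nn_cond_exp M (F t) (\<lambda>\<omega>. c * h (s, \<omega>)) \<omega>"
        by (rule E.nn_cond_exp_prod) measurable
      ultimately show "AE \<omega> in M. c * Y t s \<omega> = nn_cond_exp M (F t) (\<lambda>\<omega>. c * h (s, \<omega>)) \<omega>"
        by eventually_elim simp
    qed
  qed
qed

lemma version_of_add:
  assumes h: "h \<in> borel_measurable (borel \<Otimes>\<^sub>M M)" and Y: "version_of h Y"
    and h': "h' \<in> borel_measurable (borel \<Otimes>\<^sub>M M)" and Y': "version_of h' Y'"
  shows "version_of (\<lambda>x. h x + h' x) (\<lambda>t s \<omega>. Y t s \<omega> + Y' t s \<omega>)"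
  unfolding version_of_def
proof
  show "prog3 (\<lambda>t s \<omega>. Y t s \<omega> + Y' t s \<omega>)"
    by (intro prog3I borel_measurable_add prog3D[OF version_of_prog3[OF Y]] prog3D[OF version_of_prog3[OF Y']])
  show "AE t in I. \<forall>s. AE \<omega> in M. Y t s \<omega> + Y' t s \<omega> = nn_cond_exp M (F t) (\<lambda>\<omega>. h (s, \<omega>) + h' (s, \<omega>)) \<omega>"
    using version_of_AE[OF Y] version_of_AE[OF Y']
  proof eventually_elim
    case (elim t)
    then interpret E: finite_measure_subalgebra M "F t" by (intro cond) auto
    have [measurable]: "(\<lambda>\<omega>. h (s, \<omega>)) \<in> borel_measurable M" "(\<lambda>\<omega>. h' (s, \<omega>)) \<in> borel_measurable M" for s
      by (rule measurable_compose[OF measurable_Pair1' h], simp, rule measurable_compose[OF measurable_Pair1' h'], simp)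
    show ?case
    proof
      fix s
      have "AE \<omega> in M. Y t s \<omega> = nn_cond_exp M (F t) (\<lambda>\<omega>. h (s, \<omega>)) \<omega>"
        and "AE \<omega> in M. Y' t s \<omega> = nn_cond_exp M (F t) (\<lambda>\<omega>. h' (s, \<omega>)) \<omega>" using elim by blast+
      moreover have "AE \<omega> in M. nn_cond_exp M (F t) (\<lambda>\<omega>. h (s, \<omega>)) \<omega> + nn_cond_exp M (F t) (\<lambda>\<omega>. h' (s, \<omega>)) \<omega>
          = nn_cond_exp M (F t) (\<lambda>\<omega>. h (s, \<omega>) + h' (s, \<omega>)) \<omega>"
        by (rule E.nn_cond_exp_sum) measurable
      ultimately show "AE \<omega> in M. Y t s \<omega> + Y' t s \<omega> = nn_cond_exp M (F t) (\<lambda>\<omega>. h (s, \<omega>) + h' (s, \<omega>)) \<omega>"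
        by eventually_elim simp
    qed
  qed
qed

lemma version_of_SUP:
  assumes h: "\<And>n. h n \<in> borel_measurable (borel \<Otimes>\<^sub>M M)" and inc: "incseq h" and Y: "\<And>n. version_of (h n) (Y n)"
  shows "version_of (\<lambda>x. SUP n::nat. h n x) (\<lambda>t s \<omega>. SUP n. Y n t s \<omega>)"
  unfolding version_of_def
proof
  show "prog3 (\<lambda>t s \<omega>. SUP n. Y n t s \<omega>)"
    by (intro prog3I borel_measurable_SUP prog3D[OF version_of_prog3[OF Y]]) simp_all
  have "AE t in I. \<forall>n. t \<in> {0..T} \<and> (\<forall>s. AE \<omega> in M. Y n t s \<omega> = nn_cond_exp M (F t) (\<lambda>\<omega>. h n (s, \<omega>)) \<omega>)"
    unfolding AE_all_countable by (intro allI version_of_AE[OF Y])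
  then show "AE t in I. \<forall>s. AE \<omega> in M. (SUP n. Y n t s \<omega>) = nn_cond_exp M (F t) (\<lambda>\<omega>. SUP n. h n (s, \<omega>)) \<omega>"
  proof eventually_elim
    case (elim t)
    then interpret E: finite_measure_subalgebra M "F t" by (intro cond) auto
    have [measurable]: "(\<lambda>\<omega>. h n (s, \<omega>)) \<in> borel_measurable M" for s n
      by (rule measurable_compose[OF measurable_Pair1' h]) simp
    show ?case
    proof
      fix s
      have "AE \<omega> in M. \<forall>n. Y n t s \<omega> = nn_cond_exp M (F t) (\<lambda>\<omega>. h n (s, \<omega>)) \<omega>"
        unfolding AE_all_countable using elim by simp
      moreover have "AE \<omega> in M. (SUP n. nn_cond_exp M (F t) (\<lambda>\<omega>. h n (s, \<omega>)) \<omega>) = nn_cond_exp M (F t) (\<lambda>\<omega>. SUP n. h n (s, \<omega>)) \<omega>"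
        by (rule E.nn_cond_exp_SUP) (use inc in \<open>auto simp: incseq_def le_fun_def\<close>)
      ultimately show "AE \<omega> in M. (SUP n. Y n t s \<omega>) = nn_cond_exp M (F t) (\<lambda>\<omega>. SUP n. h n (s, \<omega>)) \<omega>"
        by eventually_elim simp
    qed
  qed
qed

lemma version_of_compl:
  assumes A: "A \<in> sets (borel \<Otimes>\<^sub>M M)" and Y: "version_of (indicator A) Y"
  shows "version_of (indicator (UNIV \<times> space M - A)) (\<lambda>t s \<omega>. 1 - Y t s \<omega>)"
  unfolding version_of_def
proof
  show "prog3 (\<lambda>t s \<omega>. 1 - Y t s \<omega>)"
    by (intro prog3I borel_measurable_minus_ennreal prog3D[OF version_of_prog3[OF Y]] measurable_const) simp_all
  show "AE t in I. \<forall>s. AE \<omega> in M. 1 - Y t s \<omega> = nn_cond_exp M (F t) (\<lambda>\<omega>. indicator (UNIV \<times> space M - A) (s, \<omega>)) \<omega>"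
    using version_of_AE[OF Y]
  proof eventually_elim
    case (elim t)
    then interpret E: finite_measure_subalgebra M "F t" by (intro cond) auto
    have Ac: "UNIV \<times> space M - A \<in> sets (borel \<Otimes>\<^sub>M M)"
      using A by (metis sets.compl_sets space_pair_measure space_borel)
    show ?case
    proof
      fix s
      define p q :: "'a \<Rightarrow> ennreal" where "p \<omega> = indicator A (s, \<omega>)" and "q \<omega> = indicator (UNIV \<times> space M - A) (s, \<omega>)" for \<omega>
      have [measurable]: "p \<in> borel_measurable M" "q \<in> borel_measurable M"
        unfolding p_def q_def
        by (rule measurable_compose[OF measurable_Pair1' borel_measurable_indicator[OF A]], simp,
            rule measurable_compose[OF measurable_Pair1' borel_measurable_indicator[OF Ac]], simp)
      have "AE \<omega> in M. nn_cond_exp M (F t) p \<omega> + nn_cond_exp M (F t) q \<omega> = nn_cond_exp M (F t) (\<lambda>\<omega>. p \<omega> + q \<omega>) \<omega>"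
        by (rule E.nn_cond_exp_sum) measurable
      moreover have "AE \<omega> in M. nn_cond_exp M (F t) (\<lambda>\<omega>. p \<omega> + q \<omega>) \<omega> = nn_cond_exp M (F t) (\<lambda>_. 1) \<omega>"
      proof (rule E.nn_cond_exp_cong)
        show "AE \<omega> in M. p \<omega> + q \<omega> = 1" by (rule AE_I2) (simp add: p_def q_def indicator_def)
      qed measurable
      moreover have "AE \<omega> in M. 1 = nn_cond_exp M (F t) (\<lambda>_. 1) \<omega>"
        by (rule E.nn_cond_exp_F_meas) simp
      moreover have "AE \<omega> in M. Y t s \<omega> = nn_cond_exp M (F t) p \<omega>" using elim unfolding p_def by blast
      ultimately have "AE \<omega> in M. 1 - Y t s \<omega> = nn_cond_exp M (F t) q \<omega>"
      proof eventually_elim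
        case (elim \<omega>)
        then have "nn_cond_exp M (F t) p \<omega> + nn_cond_exp M (F t) q \<omega> = 1" by simp
        \<comment> \<open>Cancellation in the extended reals requires the subtracted term to be
          finite.\<close>
        moreover from this have "nn_cond_exp M (F t) p \<omega> \<noteq> top" by (auto simp: top_add)
        ultimately show ?case using elim by (metis ennreal_add_diff_cancel_left)
      qed
      then show "AE \<omega> in M. 1 - Y t s \<omega> = nn_cond_exp M (F t) (\<lambda>\<omega>. indicator (UNIV \<times> space M - A) (s, \<omega>)) \<omega>"
        unfolding q_def[abs_def] .
    qed
  qed
qed

lemma version_of_zero: "version_of (\<lambda>_. 0) (\<lambda>t s \<omega>. 0)"
proof -
  obtain Y where "version_of (indicator ({} \<times> {})) Y" using version_of_rectangle[of "{}" "{}"] by auto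
  from version_of_cmult[OF _ this, of 0] show ?thesis by simp
qed

text \<open>Dynkin's argument from rectangles, with complements handled by subtraction from 1 and
  disjoint unions by monotone limits.\<close>

lemma version_of_indicator:
  assumes "A \<in> sets (borel \<Otimes>\<^sub>M M)"
  shows "\<exists>Y. version_of (indicator A) Y"
proof -
  let ?G = "{a \<times> b |a b. a \<in> sets (borel :: real measure) \<and> b \<in> sets M}"
  have A: "A \<in> sigma_sets (UNIV \<times> space M) ?G" using assms by (simp add: sets_pair_measure)
  have G: "?G \<subseteq> Pow (UNIV \<times> space M)" using sets.sets_into_space by fastforce
  have meas: "B \<in> sets (borel \<Otimes>\<^sub>M M)" if "B \<in> sigma_sets (UNIV \<times> space M) ?G" for B
    using that by (simp add: sets_pair_measure)
  show ?thesis using Int_stable_pair_measure_generator G A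
  proof (induction rule: sigma_sets_induct_disjoint)
    case (basic A)
    then show ?case using version_of_rectangle by blast
  next
    case empty
    then show ?case using version_of_zero by (auto simp: indicator_def[abs_def])
  next
    case (compl A)
    then show ?case using version_of_compl meas by blast
  next
    case (union A)
    then obtain Y where Y: "\<And>i. version_of (indicator (A i)) (Y i)" by metis
    have [measurable]: "A i \<in> sets (borel \<Otimes>\<^sub>M M)" for i using union meas by auto
    have S: "version_of (\<lambda>x. \<Sum>i<n. indicator (A i) x) (\<lambda>t s \<omega>. \<Sum>i<n. Y i t s \<omega>)" for n
    proof (induction n)
      case (Suc n)
      show ?case using version_of_add[OF _ Suc _ Y[of n]] by simp
    qed (simp add: version_of_zero)
    have "version_of (\<lambda>x. SUP n. \<Sum>i<n. indicator (A i) x) (\<lambda>t s \<omega>. SUP n. \<Sum>i<n. Y i t s \<omega>)"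
      by (rule version_of_SUP[OF _ _ S]) (auto simp: incseq_Suc_iff le_fun_def)
    \<comment> \<open>Disjointness makes the partial sums of indicators increase to the indicator of
      the union.\<close>
    moreover have "(\<lambda>x. SUP n. \<Sum>i<n. indicator (A i) x :: ennreal) = indicator (\<Union>i. A i)"
      using suminf_indicator[OF union(1)] by (auto simp: suminf_eq_SUP[symmetric] fun_eq_iff)
    ultimately show ?case by metis
  qed
qed

lemma version_of_cong:
  assumes f: "f \<in> borel_measurable (borel \<Otimes>\<^sub>M M)" and g: "g \<in> borel_measurable (borel \<Otimes>\<^sub>M M)"
    and eq: "\<And>x. x \<in> space (borel \<Otimes>\<^sub>M M) \<Longrightarrow> f x = g x" and Y: "version_of g Y"
  shows "version_of f Y"
  unfolding version_of_def
proof
  show "prog3 Y" by (rule version_of_prog3[OF Y])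
  show "AE t in I. \<forall>s. AE \<omega> in M. Y t s \<omega> = nn_cond_exp M (F t) (\<lambda>\<omega>. f (s, \<omega>)) \<omega>"
    using version_of_AE[OF Y]
  proof eventually_elim
    case (elim t)
    then interpret E: finite_measure_subalgebra M "F t" by (intro cond) auto
    show ?case
    proof
      fix s
      have "AE \<omega> in M. nn_cond_exp M (F t) (\<lambda>\<omega>. f (s, \<omega>)) \<omega> = nn_cond_exp M (F t) (\<lambda>\<omega>. g (s, \<omega>)) \<omega>"
        by (rule E.nn_cond_exp_cong)
           (use eq in \<open>auto intro!: AE_I2 measurable_compose[OF measurable_Pair1' f] measurable_compose[OF measurable_Pair1' g] simp: space_pair_measure\<close>)
      moreover have "AE \<omega> in M. Y t s \<omega> = nn_cond_exp M (F t) (\<lambda>\<omega>. g (s, \<omega>)) \<omega>" using elim by blast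
      ultimately show "AE \<omega> in M. Y t s \<omega> = nn_cond_exp M (F t) (\<lambda>\<omega>. f (s, \<omega>)) \<omega>" by eventually_elim simp
    qed
  qed
qed

lemma version_of_exists:
  assumes "h \<in> borel_measurable (borel \<Otimes>\<^sub>M M)"
  shows "\<exists>Y. version_of h Y"
  using assms
proof (induction rule: borel_measurable_induct)
  case (cong f g)
  then show ?case using version_of_cong by blast
next
  case (set A)
  then show ?case by (rule version_of_indicator)
next
  case (mult u c)
  then show ?case using version_of_cmult by blast
next
  case (add u v)
  then show ?case using version_of_add by blast
next
  case (seq U)
  then obtain Y where Y: "\<And>i. version_of (U i) (Y i)" by metis
  have "version_of (\<lambda>x. SUP n. U n x) (\<lambda>t s \<omega>. SUP n. Y n t s \<omega>)"
    by (rule version_of_SUP) (use seq Y in auto)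
  moreover have "(SUP i. U i) = (\<lambda>x. SUP n. U n x)" by (auto simp: fun_eq_iff image_comp)
  ultimately show ?case by metis
qed

definition clamp :: "real \<Rightarrow> real" where "clamp t = max 0 (min T t)"

lemma clamp_in: "clamp t \<in> {0..T}"
  using T_pos by (auto simp: clamp_def)

lemma clamp_id: "t \<in> {0..T} \<Longrightarrow> clamp t = t"
  by (auto simp: clamp_def)

lemma measurable_clamp: "clamp \<in> borel \<rightarrow>\<^sub>M J"
  by (rule measurable_restrict_space2) (use clamp_in in \<open>auto simp: clamp_def[abs_def]\<close>)

lemma measurable_F_M: "t \<in> {0..T} \<Longrightarrow> (\<lambda>x. x) \<in> M \<rightarrow>\<^sub>M F t"
  using F_subset_M space_F[of t] sets.sets_into_space by (intro measurableI) auto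

text \<open>The positive and negative parts are treated separately and recombined exactly as
  \<open>real_cond_exp\<close> is defined, so no integrability of \<open>f\<close> enters.
  Progressive measurability is kept in addition to Borel measurability, because it makes test
  processes on the diagonal admissible.\<close>

theorem conditional_version_exists:
  assumes f: "(\<lambda>(s, \<omega>). f s \<omega>) \<in> borel_measurable (J \<Otimes>\<^sub>M M)"
  obtains Y :: "real \<Rightarrow> real \<Rightarrow> 'a \<Rightarrow> real" where
    "\<forall>t0\<in>{0..T}. (\<lambda>(t, s, \<omega>). Y t s \<omega>) \<in> borel_measurable (restrict_space borel {0..t0} \<Otimes>\<^sub>M (borel \<Otimes>\<^sub>M F t0))"
    "(\<lambda>(t, s, \<omega>). Y t s \<omega>) \<in> borel_measurable (borel \<Otimes>\<^sub>M (borel \<Otimes>\<^sub>M M))"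
    "AE t in I. \<forall>s\<in>{0..T}. AE \<omega> in M. Y t s \<omega> = real_cond_exp M (F t) (f s) \<omega>"
proof -
  have "(\<lambda>x. (clamp (fst x), snd x)) \<in> (borel \<Otimes>\<^sub>M M) \<rightarrow>\<^sub>M (J \<Otimes>\<^sub>M M)"
    using measurable_clamp by measurable
  from measurable_compose[OF this f] have [measurable]: "(\<lambda>x. f (clamp (fst x)) (snd x)) \<in> borel_measurable (borel \<Otimes>\<^sub>M M)"
    by simp
  obtain P Q where P: "version_of (\<lambda>x. ennreal (f (clamp (fst x)) (snd x))) P"
    and Q: "version_of (\<lambda>x. ennreal (- f (clamp (fst x)) (snd x))) Q"
    using version_of_exists[of "\<lambda>x. ennreal (f (clamp (fst x)) (snd x))"]
      version_of_exists[of "\<lambda>x. ennreal (- f (clamp (fst x)) (snd x))"] by auto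
  define Y where "Y t s \<omega> = enn2real (P (clamp t) s \<omega>) - enn2real (Q (clamp t) s \<omega>)" for t s \<omega>
  define Z where "Z t s \<omega> = enn2real (P t s \<omega>) - enn2real (Q t s \<omega>)" for t s \<omega>
  have Zm: "(\<lambda>(t, s, \<omega>). Z t s \<omega>) \<in> borel_measurable (restrict_space borel {0..t0} \<Otimes>\<^sub>M (borel \<Otimes>\<^sub>M F t0))"
    if "t0 \<in> {0..T}" for t0
  proof -
    have "prog3 P" "prog3 Q" by (rule version_of_prog3[OF P], rule version_of_prog3[OF Q])
    note [measurable] = this[THEN prog3D, OF that]
    show ?thesis unfolding Z_def case_prod_beta' by measurable
  qed
  show thesis
  proof (rule that[of Y], intro ballI)
    fix t0 assume t0: "t0 \<in> {0..T}"
    have "(\<lambda>(t, s, \<omega>). Y t s \<omega>) x = (\<lambda>(t, s, \<omega>). Z t s \<omega>) x"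
      if "x \<in> space (restrict_space borel {0..t0} \<Otimes>\<^sub>M (borel \<Otimes>\<^sub>M F t0))" for x
      using that t0 by (auto simp: Y_def Z_def space_pair_measure space_restrict_space clamp_id)
    then show "(\<lambda>(t, s, \<omega>). Y t s \<omega>) \<in> borel_measurable (restrict_space borel {0..t0} \<Otimes>\<^sub>M (borel \<Otimes>\<^sub>M F t0))"
      using Zm[OF t0] by (subst measurable_cong) auto
  next
    \<comment> \<open>Full joint measurability is progressive measurability at the terminal time,
      composed with the clamping of \<open>t\<close> and the inclusion of sigma-algebras.\<close>
    have T: "T \<in> {0..T}" using T_pos by simp
    have "(\<lambda>x. (clamp (fst x), fst (snd x), snd (snd x))) \<in> (borel \<Otimes>\<^sub>M (borel \<Otimes>\<^sub>M M)) \<rightarrow>\<^sub>M (J \<Otimes>\<^sub>M (borel \<Otimes>\<^sub>M F T))"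
      by (intro measurable_Pair measurable_compose[OF measurable_fst measurable_clamp]
          measurable_compose[OF measurable_snd measurable_fst]
          measurable_compose[OF measurable_compose[OF measurable_snd measurable_snd] measurable_F_M[OF T]])
    from measurable_compose[OF this Zm[OF T]]
    show "(\<lambda>(t, s, \<omega>). Y t s \<omega>) \<in> borel_measurable (borel \<Otimes>\<^sub>M (borel \<Otimes>\<^sub>M M))"
      by (simp add: Y_def Z_def case_prod_beta')
  next
    show "AE t in I. \<forall>s\<in>{0..T}. AE \<omega> in M. Y t s \<omega> = real_cond_exp M (F t) (f s) \<omega>"
      using version_of_AE[OF P] version_of_AE[OF Q]
    proof eventually_elim
      case (elim t)
      show ?case
      proof
        fix s assume s: "s \<in> {0..T}"
        have "AE \<omega> in M. P t s \<omega> = nn_cond_exp M (F t) (\<lambda>\<omega>. ennreal (f s \<omega>)) \<omega>"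
          and "AE \<omega> in M. Q t s \<omega> = nn_cond_exp M (F t) (\<lambda>\<omega>. ennreal (- f s \<omega>)) \<omega>"
          using spec[OF conjunct2[OF elim(1)], of s] spec[OF conjunct2[OF elim(2)], of s] clamp_id[OF s]
          by simp_all
        then show "AE \<omega> in M. Y t s \<omega> = real_cond_exp M (F t) (f s) \<omega>"
          by eventually_elim (use elim in \<open>simp add: Y_def real_cond_exp_def clamp_id\<close>)
      qed
    qed
  qed
qed

end

section \<open>Weak solutions of the conditional equation\<close>

lemma sq_int_iff_nn_integral:
  assumes [measurable]: "f \<in> borel_measurable M"
  shows "sq_int M f \<longleftrightarrow> (\<integral>\<^sup>+x. ennreal ((f x)\<^sup>2) \<partial>M) < \<infinity>"
  unfolding sq_int_def integrable_iff_bounded by auto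

context filtered
begin

abbreviation psq :: "(real \<Rightarrow> 'a \<Rightarrow> real) \<Rightarrow> bool" where "psq u \<equiv> sq_int (I \<Otimes>\<^sub>M M) (case_prod u)"

abbreviation proc :: "(real \<Rightarrow> 'a \<Rightarrow> real) \<Rightarrow> bool" where "proc u \<equiv> case_prod u \<in> borel_measurable (J \<Otimes>\<^sub>M M)"

text \<open>The inner product of L2 over time and scenarios.\<close>

definition E2 :: "(real \<Rightarrow> 'a \<Rightarrow> real) \<Rightarrow> (real \<Rightarrow> 'a \<Rightarrow> real) \<Rightarrow> real" where
  "E2 u v = (\<integral>p. case_prod u p * case_prod v p \<partial>(I \<Otimes>\<^sub>M M))"

lemma measurable_I_J: "(\<lambda>x. x) \<in> I \<rightarrow>\<^sub>M J"
  by (rule measurable_restrict_space2[OF _ measurable_lebesgue_on_borel]) auto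

lemma proc_measurable_I:
  assumes "proc u" shows "case_prod u \<in> borel_measurable (I \<Otimes>\<^sub>M M)"
proof -
  have "(\<lambda>x. (fst x, snd x)) \<in> (I \<Otimes>\<^sub>M M) \<rightarrow>\<^sub>M (J \<Otimes>\<^sub>M M)"
    by (intro measurable_Pair measurable_compose[OF measurable_fst measurable_I_J] measurable_snd)
  from measurable_compose[OF this assms] show ?thesis by simp
qed

lemma slice_I: "case_prod u \<in> borel_measurable (I \<Otimes>\<^sub>M M) \<Longrightarrow> \<omega> \<in> space M \<Longrightarrow> (\<lambda>s. u s \<omega>) \<in> borel_measurable I"
  using measurable_compose[OF measurable_Pair2'[of \<omega> M I], of "case_prod u" borel] by simp

lemma slice_M: "case_prod u \<in> borel_measurable (I \<Otimes>\<^sub>M M) \<Longrightarrow> s \<in> {0..T} \<Longrightarrow> u s \<in> borel_measurable M"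
  using measurable_compose[OF measurable_Pair1'[of s I M], of "case_prod u" borel] by simp

lemma psq_integrable:
  assumes "psq u" "psq v"
  shows "integrable (I \<Otimes>\<^sub>M M) (\<lambda>(s, \<omega>). u s \<omega> * v s \<omega>)"
  using sq_int_mult_integrable[OF assms] by (simp add: case_prod_beta')

lemma E2_eq:
  assumes "psq u" "psq v"
  shows "E2 u v = (\<integral>\<omega>. (\<integral>s. u s \<omega> * v s \<omega> \<partial>I) \<partial>M)"
  using IM.integral_snd[OF psq_integrable[OF assms]] by (simp add: E2_def case_prod_beta')

lemma E2_eq':
  assumes "psq u" "psq v"
  shows "E2 u v = (\<integral>s. (\<integral>\<omega>. u s \<omega> * v s \<omega> \<partial>M) \<partial>I)"
  using IM.integral_fst[OF psq_integrable[OF assms]] by (simp add: E2_def case_prod_beta')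

lemma integrable_path_product:
  assumes "psq u" "psq v"
  shows "integrable M (\<lambda>\<omega>. \<integral>s. u s \<omega> * v s \<omega> \<partial>I)"
  by (rule IM.integrable_snd[OF psq_integrable[OF assms]])

lemma psq_paths:
  assumes u: "psq u"
  shows "AE \<omega> in M. sq_int I (\<lambda>s. u s \<omega>)"
proof -
  have "AE \<omega> in M. integrable I (\<lambda>s. u s \<omega> * u s \<omega>)"
    by (rule IM.AE_integrable_snd[OF psq_integrable[OF u u]])
  then show ?thesis using AE_space
    by eventually_elim (use slice_I[OF sq_int_measurable[OF u]] in \<open>simp add: sq_int_def power2_eq_square\<close>)
qed

lemma psq_sections:
  assumes u: "psq u"
  shows "AE s in I. sq_int M (u s)"
proof -
  have "AE s in I. integrable M (\<lambda>\<omega>. u s \<omega> * u s \<omega>)"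
    by (rule IM.AE_integrable_fst[OF psq_integrable[OF u u]])
  then show ?thesis using AE_space
    by eventually_elim (use slice_M[OF sq_int_measurable[OF u]] in \<open>simp add: sq_int_def power2_eq_square\<close>)
qed

lemma psqI:
  assumes m: "case_prod u \<in> borel_measurable (I \<Otimes>\<^sub>M M)" and g: "integrable M g"
    and le: "AE \<omega> in M. sq_int I (\<lambda>s. u s \<omega>) \<and> (\<integral>s. (u s \<omega>)\<^sup>2 \<partial>I) \<le> g \<omega>"
  shows "psq u"
  unfolding sq_int_iff_nn_integral[OF m]
proof -
  have [measurable]: "case_prod u \<in> borel_measurable (I \<Otimes>\<^sub>M M)" by (rule m)
  have "(\<integral>\<^sup>+p. ennreal ((case_prod u p)\<^sup>2) \<partial>(I \<Otimes>\<^sub>M M)) = (\<integral>\<^sup>+\<omega>. (\<integral>\<^sup>+s. ennreal ((u s \<omega>)\<^sup>2) \<partial>I) \<partial>M)"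
    using IM.nn_integral_snd[of "\<lambda>p. ennreal ((case_prod u p)\<^sup>2)"] by simp
  also have "\<dots> \<le> (\<integral>\<^sup>+\<omega>. ennreal (g \<omega>) \<partial>M)"
  proof (rule nn_integral_mono_AE)
    show "AE \<omega> in M. (\<integral>\<^sup>+s. ennreal ((u s \<omega>)\<^sup>2) \<partial>I) \<le> ennreal (g \<omega>)"
      using le by eventually_elim (auto simp: nn_integral_eq_integral[OF sq_intD] intro: ennreal_leI)
  qed
  also have "\<dots> < \<infinity>"
  proof -
    have "(\<integral>\<^sup>+\<omega>. ennreal (g \<omega>) \<partial>M) \<le> (\<integral>\<^sup>+\<omega>. ennreal (norm (g \<omega>)) \<partial>M)"
      by (intro nn_integral_mono ennreal_leI) simp
    also have "\<dots> < \<infinity>" using g by (simp add: integrable_iff_bounded)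
    finally show ?thesis .
  qed
  finally show "(\<integral>\<^sup>+p. ennreal ((case_prod u p)\<^sup>2) \<partial>(I \<Otimes>\<^sub>M M)) < \<infinity>" .
qed

lemma psq_add_scaled: "psq u \<Longrightarrow> psq v \<Longrightarrow> psq (\<lambda>s \<omega>. u s \<omega> + c * v s \<omega>)"
  using sq_int_add[OF _ sq_int_cmult, of "I \<Otimes>\<^sub>M M" "case_prod u" "case_prod v" c] by (simp add: case_prod_beta')

lemma psq_cmult: "psq u \<Longrightarrow> psq (\<lambda>s \<omega>. c * u s \<omega>)"
  using sq_int_cmult[of "I \<Otimes>\<^sub>M M" "case_prod u" c] by (simp add: case_prod_beta')

lemma psq_diff: "psq u \<Longrightarrow> psq v \<Longrightarrow> psq (\<lambda>s \<omega>. u s \<omega> - v s \<omega>)"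
  using psq_add_scaled[of u v "-1"] by simp

text \<open>The outer time space \<open>S\<close> is left open: the Borel interval serves
  conditional expectations, the Lebesgue interval the integrals.\<close>

lemma measurable_kop_process:
  assumes k: "case_prod k \<in> borel_measurable (S \<Otimes>\<^sub>M I)" and u: "case_prod u \<in> borel_measurable (I \<Otimes>\<^sub>M M)"
  shows "(\<lambda>(s, \<omega>). kop T k (\<lambda>r. u r \<omega>) s) \<in> borel_measurable (S \<Otimes>\<^sub>M M)"
proof -
  have "(\<lambda>x. (fst (fst x), snd x)) \<in> ((S \<Otimes>\<^sub>M M) \<Otimes>\<^sub>M I) \<rightarrow>\<^sub>M (S \<Otimes>\<^sub>M I)" by measurable
  from measurable_compose[OF this k]
  have 1: "(\<lambda>x. k (fst (fst x)) (snd x)) \<in> borel_measurable ((S \<Otimes>\<^sub>M M) \<Otimes>\<^sub>M I)" by simp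
  have "(\<lambda>x. (snd x, snd (fst x))) \<in> ((S \<Otimes>\<^sub>M M) \<Otimes>\<^sub>M I) \<rightarrow>\<^sub>M (I \<Otimes>\<^sub>M M)" by measurable
  from measurable_compose[OF this u]
  have 2: "(\<lambda>x. u (snd x) (snd (fst x))) \<in> borel_measurable ((S \<Otimes>\<^sub>M M) \<Otimes>\<^sub>M I)" by simp
  have "(\<lambda>(x, r). k (fst x) r * u r (snd x)) \<in> borel_measurable ((S \<Otimes>\<^sub>M M) \<Otimes>\<^sub>M I)"
    using borel_measurable_times[OF 1 2] by (simp add: case_prod_beta')
  from I.borel_measurable_lebesgue_integral[OF this] show ?thesis
    by (simp add: kop_def case_prod_beta')
qed

lemma psq_kop:
  assumes k: "rowbd k C" and u: "psq u"
  shows "psq (\<lambda>s \<omega>. kop T k (\<lambda>r. u r \<omega>) s)"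
proof (rule psqI)
  show "(\<lambda>(s, \<omega>). kop T k (\<lambda>r. u r \<omega>) s) \<in> borel_measurable (I \<Otimes>\<^sub>M M)"
    by (rule measurable_kop_process) (use k sq_int_measurable[OF u] in \<open>auto simp: rowbd_def\<close>)
  show "integrable M (\<lambda>\<omega>. C * T * (\<integral>s. u s \<omega> * u s \<omega> \<partial>I))"
    using integrable_path_product[OF u u] by simp
  show "AE \<omega> in M. sq_int I (\<lambda>s. kop T k (\<lambda>r. u r \<omega>) s) \<and> (\<integral>s. (kop T k (\<lambda>r. u r \<omega>) s)\<^sup>2 \<partial>I) \<le> C * T * (\<integral>s. u s \<omega> * u s \<omega> \<partial>I)"
    using psq_paths[OF u]
  proof eventually_elim
    case (elim \<omega>)
    then show ?case using sq_int_kop[OF k elim] integral_kop_square_le[OF k elim] by (simp add: power2_eq_square)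
  qed
qed

lemma psq_symD:
  assumes k: "rowbd k C" and u: "psq u"
  shows "psq (\<lambda>s \<omega>. symD l k (\<lambda>r. u r \<omega>) s)"
  unfolding symD_def using psq_add_scaled[OF psq_cmult[OF u] psq_kop[OF k u], of "2 * l" 1] by simp

lemma progressive_measurable:
  assumes "progressive M F T u" "t \<in> {0..T}"
  shows "case_prod u \<in> borel_measurable (restrict_space borel {0..t} \<Otimes>\<^sub>M F t)"
  using assms by (simp add: progressive_def)

lemma T_in: "T \<in> {0..T}" using T_pos by simp

lemma progressive_proc: "progressive M F T u \<Longrightarrow> proc u"
proof -
  assume u: "progressive M F T u"
  have "(\<lambda>x. (fst x, snd x)) \<in> (J \<Otimes>\<^sub>M M) \<rightarrow>\<^sub>M (J \<Otimes>\<^sub>M F T)"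
    by (intro measurable_Pair measurable_fst measurable_compose[OF measurable_snd measurable_F_M[OF T_in]])
  from measurable_compose[OF this progressive_measurable[OF u T_in]] show ?thesis by simp
qed

lemma progressive_adapted:
  assumes u: "progressive M F T u" and t: "t \<in> {0..T}"
  shows "u t \<in> borel_measurable (F t)"
  using measurable_compose[OF measurable_Pair1'[of t] progressive_measurable[OF u t]] t
  by (simp add: space_restrict_space)

lemma admissible_iff: "admissible M F T u \<longleftrightarrow> progressive M F T u \<and> psq u"
proof (cases "progressive M F T u")
  case True
  have m: "case_prod u \<in> borel_measurable (I \<Otimes>\<^sub>M M)" by (rule proc_measurable_I[OF progressive_proc[OF True]])
  then have [measurable]: "case_prod u \<in> borel_measurable (I \<Otimes>\<^sub>M M)" .
  have "(\<integral>\<^sup>+ s. (\<integral>\<^sup>+ \<omega>. ennreal ((u s \<omega>)\<^sup>2) \<partial>M) \<partial>I) = (\<integral>\<^sup>+p. ennreal ((case_prod u p)\<^sup>2) \<partial>(I \<Otimes>\<^sub>M M))"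
    using nn_integral_fst[of "\<lambda>p. ennreal ((case_prod u p)\<^sup>2)" I] by simp
  then show ?thesis using True sq_int_iff_nn_integral[OF m] by (simp add: admissible_def)
qed (simp add: admissible_def)

lemma admissible_psq: "admissible M F T u \<Longrightarrow> psq u"
  and admissible_progressive: "admissible M F T u \<Longrightarrow> progressive M F T u"
  by (simp_all add: admissible_iff)

lemma progressive_add_scaled:
  assumes "progressive M F T u" "progressive M F T v"
  shows "progressive M F T (\<lambda>s \<omega>. u s \<omega> + c * v s \<omega>)"
  unfolding progressive_def
proof
  fix t assume t: "t \<in> {0..T}"
  note [measurable] = assms[THEN progressive_measurable, OF t]
  have "(\<lambda>p. case_prod u p + c * case_prod v p) \<in> borel_measurable (restrict_space borel {0..t} \<Otimes>\<^sub>M F t)" by measurable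
  then show "(\<lambda>(s, \<omega>). u s \<omega> + c * v s \<omega>) \<in> borel_measurable (restrict_space borel {0..t} \<Otimes>\<^sub>M F t)"
    by (simp add: case_prod_beta')
qed

lemma admissible_add_scaled:
  "admissible M F T u \<Longrightarrow> admissible M F T v \<Longrightarrow> admissible M F T (\<lambda>s \<omega>. u s \<omega> + c * v s \<omega>)"
  by (simp add: admissible_iff progressive_add_scaled psq_add_scaled)

lemma admissible_zero: "admissible M F T (\<lambda>s \<omega>. 0)"
  by (simp add: admissible_iff progressive_def case_prod_beta')

lemma admissible_cmult: "admissible M F T u \<Longrightarrow> admissible M F T (\<lambda>s \<omega>. c * u s \<omega>)"
  using admissible_add_scaled[OF admissible_zero, of u c] by simp

lemma admissible_sum:
  assumes "\<And>i. i \<in> A \<Longrightarrow> admissible M F T (u i)"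
  shows "admissible M F T (\<lambda>s \<omega>. \<Sum>i\<in>A. u i s \<omega>)"
  using assms
proof (induction A rule: infinite_finite_induct)
  case (insert x A)
  then show ?case using admissible_add_scaled[of "u x" "\<lambda>s \<omega>. \<Sum>i\<in>A. u i s \<omega>" 1] by simp
qed (simp_all add: admissible_zero)

end

section \<open>The conditional equation in weak form and its solvability\<close>

locale volterra_filtered = volterra T K C lam + filtered T M F
  for T :: real and K :: "real \<Rightarrow> real \<Rightarrow> real" and C lam :: real and M :: "'a measure" and F :: "real \<Rightarrow> 'a measure" +
  assumes K_borel: "case_prod K \<in> borel_measurable (lborel \<Otimes>\<^sub>M lborel)"
begin

abbreviation Ks :: "real \<Rightarrow> real \<Rightarrow> real" where "Ks \<equiv> (\<lambda>s r. K s r + adj K s r)"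

lemma rowbd_Ks: "rowbd Ks (4 * C)"
  using rowbd_add[OF K K'] by simp

lemma Ks_sym: "Ks s r = Ks r s"
  by (simp add: adj_def)

lemma kop_Ks_symk: "s \<in> {0..T} \<Longrightarrow> kop T Ks f s = kop T (symk K 0) f s"
  unfolding kop_def by (rule Bochner_Integration.integral_cong) (auto simp: symk_def)

lemma Ks_pos:
  assumes "sq_int I f" shows "0 \<le> (\<integral>s. f s * kop T Ks f s \<partial>I)"
proof -
  have "(\<integral>s. f s * kop T Ks f s \<partial>I) = (\<integral>s. f s * kop T (symk K 0) f s \<partial>I)"
    by (rule Bochner_Integration.integral_cong) (auto simp: kop_Ks_symk)
  then show ?thesis using symk_pos[OF assms, of 0] by simp
qed

definition Lop :: "(real \<Rightarrow> 'a \<Rightarrow> real) \<Rightarrow> real \<Rightarrow> 'a \<Rightarrow> real" where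
  "Lop u s \<omega> = symD lam Ks (\<lambda>r. u r \<omega>) s"

lemma psq_Lop: "psq u \<Longrightarrow> psq (Lop u)"
  using psq_symD[OF rowbd_Ks] by (simp add: Lop_def[abs_def])

text \<open>Testing against admissible processes encodes that the conditional expectation of the
  residual vanishes, without mentioning conditional expectations. In this form the equation is
  linear, is an Euler equation of the energy, and can be averaged over players.\<close>

definition weak :: "(real \<Rightarrow> 'a \<Rightarrow> real) \<Rightarrow> (real \<Rightarrow> 'a \<Rightarrow> real) \<Rightarrow> bool" where
  "weak u f \<longleftrightarrow> (\<forall>v. admissible M F T v \<longrightarrow> E2 v (Lop u) = E2 v f)"

lemma Lop_linear:
  assumes "psq u" "psq v"
  shows "AE p in I \<Otimes>\<^sub>M M. case_prod (Lop (\<lambda>s \<omega>. u s \<omega> + c * v s \<omega>)) p = case_prod (Lop u) p + c * case_prod (Lop v) p"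
proof -
  have [measurable]: "case_prod (Lop (\<lambda>s \<omega>. u s \<omega> + c * v s \<omega>)) \<in> borel_measurable (I \<Otimes>\<^sub>M M)"
    "case_prod (Lop u) \<in> borel_measurable (I \<Otimes>\<^sub>M M)" "case_prod (Lop v) \<in> borel_measurable (I \<Otimes>\<^sub>M M)"
    using assms psq_Lop psq_add_scaled by (auto intro!: sq_int_measurable)
  have "AE \<omega> in M. \<forall>s\<in>{0..T}. Lop (\<lambda>s \<omega>. u s \<omega> + c * v s \<omega>) s \<omega> = Lop u s \<omega> + c * Lop v s \<omega>"
    using psq_paths[OF assms(1)] psq_paths[OF assms(2)]
    by eventually_elim (auto simp: Lop_def symD_def kop_add_scaled[OF rowbd_Ks] algebra_simps)
  then have "AE \<omega> in M. AE s in I. Lop (\<lambda>s \<omega>. u s \<omega> + c * v s \<omega>) s \<omega> = Lop u s \<omega> + c * Lop v s \<omega>"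
    by eventually_elim (auto intro!: AE_I2)
  then have "AE s in I. AE \<omega> in M. Lop (\<lambda>s \<omega>. u s \<omega> + c * v s \<omega>) s \<omega> = Lop u s \<omega> + c * Lop v s \<omega>"
    by (subst IM.AE_commute) (simp_all only: case_prod_beta'[symmetric] prod.collapse, measurable)
  then show ?thesis
    by (intro IM.AE_pair_measure) (simp_all only: prod.case, measurable)
qed

text \<open>Minimisation over the admissible processes. Symmetry and coercivity with constant
  \<open>2 * lam\<close> hold path by path and are integrated over the scenarios.\<close>

lemma weak_solution_exists:
  assumes f: "psq f"
  obtains u where "admissible M F T u" "weak u f"
proof -
  define V where "V = {w. admissible M F T (\<lambda>s \<omega>. w (s, \<omega>))}"
  define L where "L w = case_prod (Lop (\<lambda>s \<omega>. w (s, \<omega>)))" for w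
  have psq: "psq (\<lambda>s \<omega>. w (s, \<omega>))" if "sq_int (I \<Otimes>\<^sub>M M) w" for w using that by simp
  have inner: "(\<integral>p. v p * L u p \<partial>(I \<Otimes>\<^sub>M M)) = (\<integral>\<omega>. (\<integral>s. v (s, \<omega>) * symD lam Ks (\<lambda>r. u (r, \<omega>)) s \<partial>I) \<partial>M)"
    if u: "sq_int (I \<Otimes>\<^sub>M M) u" and v: "sq_int (I \<Otimes>\<^sub>M M) v" for u v
    using E2_eq[OF psq[OF v] psq_Lop[OF psq[OF u]]] by (simp add: E2_def L_def Lop_def)
  obtain U where U: "U \<in> V" and eq: "\<And>v. v \<in> V \<Longrightarrow> (\<integral>p. v p * L U p \<partial>(I \<Otimes>\<^sub>M M)) = (\<integral>p. v p * case_prod f p \<partial>(I \<Otimes>\<^sub>M M))"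
  proof (rule symmetric_coercive_weak_solution[of V "I \<Otimes>\<^sub>M M" L "2 * lam" "case_prod f"])
    show "(\<lambda>_. 0) \<in> V" by (simp add: V_def admissible_zero)
    show "(\<lambda>x. u x + s * v x) \<in> V" if "u \<in> V" "v \<in> V" for u v s
      using that admissible_add_scaled by (simp add: V_def)
    show "sq_int (I \<Otimes>\<^sub>M M) u" if "u \<in> V" for u
      using that admissible_psq[of "\<lambda>s \<omega>. u (s, \<omega>)"] by (simp add: V_def)
    \<comment> \<open>Progressive measurability passes to a pointwise \<open>lim\<close> at each
      time horizon; membership in L2 is supplied by the premise.\<close>
    show "(\<lambda>x. lim (\<lambda>n. u n x)) \<in> V" if u: "\<And>n. u n \<in> V" and sq: "sq_int (I \<Otimes>\<^sub>M M) (\<lambda>x. lim (\<lambda>n. u n x))" for u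
    proof -
      have "progressive M F T (\<lambda>s \<omega>. lim (\<lambda>n. u n (s, \<omega>)))"
        unfolding progressive_def
      proof
        fix t assume t: "t \<in> {0..T}"
        have "u n \<in> borel_measurable (restrict_space borel {0..t} \<Otimes>\<^sub>M F t)" for n
          using progressive_measurable[OF admissible_progressive t, of "\<lambda>s \<omega>. u n (s, \<omega>)"] u[of n] by (simp add: V_def)
        then have "(\<lambda>x. lim (\<lambda>n. u n x)) \<in> borel_measurable (restrict_space borel {0..t} \<Otimes>\<^sub>M F t)"
          by (rule borel_measurable_lim_metric)
        then show "(\<lambda>(s, \<omega>). lim (\<lambda>n. u n (s, \<omega>))) \<in> borel_measurable (restrict_space borel {0..t} \<Otimes>\<^sub>M F t)"
          by (simp add: case_prod_beta')
      qed
      then show ?thesis unfolding V_def admissible_iff using psq[OF sq] by blast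
    qed
    show "sq_int (I \<Otimes>\<^sub>M M) (L u)" if "sq_int (I \<Otimes>\<^sub>M M) u" for u
      unfolding L_def by (rule psq_Lop[OF psq[OF that]])
    show "AE x in I \<Otimes>\<^sub>M M. L (\<lambda>x. u x + s * v x) x = L u x + s * L v x"
      if "sq_int (I \<Otimes>\<^sub>M M) u" "sq_int (I \<Otimes>\<^sub>M M) v" for u v s
      unfolding L_def by (rule Lop_linear[OF psq[OF that(1)] psq[OF that(2)]])
    show "(\<integral>x. u x * L v x \<partial>(I \<Otimes>\<^sub>M M)) = (\<integral>x. v x * L u x \<partial>(I \<Otimes>\<^sub>M M))"
      if u: "sq_int (I \<Otimes>\<^sub>M M) u" and v: "sq_int (I \<Otimes>\<^sub>M M) v" for u v
      unfolding inner[OF u v] inner[OF v u]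
    proof (rule integral_cong_AE)
      show "AE \<omega> in M. (\<integral>s. u (s, \<omega>) * symD lam Ks (\<lambda>r. v (r, \<omega>)) s \<partial>I) = (\<integral>s. v (s, \<omega>) * symD lam Ks (\<lambda>r. u (r, \<omega>)) s \<partial>I)"
        using psq_paths[OF psq[OF u]] psq_paths[OF psq[OF v]]
      proof eventually_elim
        case (elim \<omega>)
        show ?case using symD_symmetric[OF rowbd_Ks Ks_sym elim] by (simp add: mult.commute)
      qed
    qed (use integrable_path_product[OF psq[OF u] psq_Lop[OF psq[OF v]]] integrable_path_product[OF psq[OF v] psq_Lop[OF psq[OF u]]]
         in \<open>auto simp: Lop_def\<close>)
    show "2 * lam > 0" using lam by simp
    show "2 * lam * (\<integral>x. (u x)\<^sup>2 \<partial>(I \<Otimes>\<^sub>M M)) \<le> (\<integral>x. u x * L u x \<partial>(I \<Otimes>\<^sub>M M))"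
      if u: "sq_int (I \<Otimes>\<^sub>M M) u" for u
    proof -
      have "2 * lam * (\<integral>x. (u x)\<^sup>2 \<partial>(I \<Otimes>\<^sub>M M)) = (\<integral>\<omega>. 2 * lam * (\<integral>s. u (s, \<omega>) * u (s, \<omega>) \<partial>I) \<partial>M)"
        using E2_eq[OF psq[OF u] psq[OF u]] by (simp add: E2_def power2_eq_square)
      also have "\<dots> \<le> (\<integral>\<omega>. (\<integral>s. u (s, \<omega>) * symD lam Ks (\<lambda>r. u (r, \<omega>)) s \<partial>I) \<partial>M)"
      proof (rule integral_mono_AE)
        show "integrable M (\<lambda>\<omega>. 2 * lam * (\<integral>s. u (s, \<omega>) * u (s, \<omega>) \<partial>I))"
          using integrable_path_product[OF psq[OF u] psq[OF u]] by simp
        show "integrable M (\<lambda>\<omega>. \<integral>s. u (s, \<omega>) * symD lam Ks (\<lambda>r. u (r, \<omega>)) s \<partial>I)"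
          using integrable_path_product[OF psq[OF u] psq_Lop[OF psq[OF u]]] by (simp add: Lop_def)
        show "AE \<omega> in M. 2 * lam * (\<integral>s. u (s, \<omega>) * u (s, \<omega>) \<partial>I) \<le> (\<integral>s. u (s, \<omega>) * symD lam Ks (\<lambda>r. u (r, \<omega>)) s \<partial>I)"
          using psq_paths[OF psq[OF u]]
        proof eventually_elim
          case (elim \<omega>)
          show ?case using symD_coercive[OF rowbd_Ks Ks_pos[OF elim] elim, of lam] by (simp add: power2_eq_square)
        qed
      qed
      also have "\<dots> = (\<integral>x. u x * L u x \<partial>(I \<Otimes>\<^sub>M M))" by (simp add: inner[OF u u])
      finally show ?thesis .
    qed
  qed (use f in auto)
  show thesis
  proof (rule that[of "\<lambda>s \<omega>. U (s, \<omega>)"])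
    show "admissible M F T (\<lambda>s \<omega>. U (s, \<omega>))" using U by (simp add: V_def)
    show "weak (\<lambda>s \<omega>. U (s, \<omega>)) f"
      unfolding weak_def
    proof (intro allI impI)
      fix v assume "admissible M F T v"
      then have "case_prod v \<in> V" by (simp add: V_def)
      from eq[OF this] show "E2 v (Lop (\<lambda>s \<omega>. U (s, \<omega>))) = E2 v f"
        by (simp add: E2_def L_def)
    qed
  qed
qed

end

section \<open>Null sets, conditional Fubini and orthogonality\<close>

context filtered
begin

text \<open>Produces one null set of scenarios outside which a relation holds for almost all pairs
  of times. Only then can the argument be carried out along a single path.\<close>

lemma AE_swap3:
  fixes \<delta> :: "real \<Rightarrow> real \<Rightarrow> 'a \<Rightarrow> real"
  assumes m: "(\<lambda>(t, s, \<omega>). \<delta> t s \<omega>) \<in> borel_measurable (I \<Otimes>\<^sub>M (I \<Otimes>\<^sub>M M))"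
    and ae: "AE t in I. AE s in I. AE \<omega> in M. \<delta> t s \<omega> = 0"
  shows "AE \<omega> in M. AE t in I. AE s in I. \<delta> t s \<omega> = 0"
proof -
  \<comment> \<open>Integrating over \<open>s\<close> reduces three variables to two:
    \<open>g\<close> vanishes exactly when the path in \<open>s\<close> is zero almost
    everywhere.\<close>
  define g where "g x = (\<integral>\<^sup>+s. ennreal \<bar>\<delta> (fst x) s (snd x)\<bar> \<partial>I)" for x
  have m1: "(\<lambda>x. \<delta> (fst (fst x)) (snd x) (snd (fst x))) \<in> borel_measurable ((I \<Otimes>\<^sub>M M) \<Otimes>\<^sub>M I)"
  proof -
    have "(\<lambda>x. (fst (fst x), snd x, snd (fst x))) \<in> ((I \<Otimes>\<^sub>M M) \<Otimes>\<^sub>M I) \<rightarrow>\<^sub>M (I \<Otimes>\<^sub>M (I \<Otimes>\<^sub>M M))" by measurable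
    from measurable_compose[OF this m] show ?thesis by simp
  qed
  have gm [measurable]: "g \<in> borel_measurable (I \<Otimes>\<^sub>M M)"
    unfolding g_def
    by (rule I.borel_measurable_nn_integral_fst[of "\<lambda>y. ennreal \<bar>\<delta> (fst (fst y)) (snd y) (snd (fst y))\<bar>", simplified])
       (use m1 in measurable)
  have mt: "case_prod (\<delta> t) \<in> borel_measurable (I \<Otimes>\<^sub>M M)" if "t \<in> {0..T}" for t
    using measurable_compose[OF measurable_Pair1'[of t I "I \<Otimes>\<^sub>M M"] m] that by simp
  have "AE t in I. AE \<omega> in M. g (t, \<omega>) = 0"
    using ae AE_space
  proof eventually_elim
    case (elim t)
    then have t: "t \<in> {0..T}" by simp
    note mt[OF t, measurable]
    have "AE \<omega> in M. AE s in I. case_prod (\<delta> t) (s, \<omega>) = 0"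
      using elim(1) by (subst IM.AE_commute[symmetric]) (simp_all only: prod.collapse prod.case, measurable)
    then show ?case using AE_space
    proof eventually_elim
      case (elim \<omega>)
      note slice_I[OF mt[OF t] elim(2), measurable]
      have "g (t, \<omega>) = (\<integral>\<^sup>+s. 0 \<partial>I)"
        unfolding g_def by (rule nn_integral_cong_AE) (use elim(1) in auto)
      then show ?case by simp
    qed
  qed
  then have "AE \<omega> in M. AE t in I. g (t, \<omega>) = 0"
    by (subst IM.AE_commute[symmetric]) (simp_all only: prod.collapse, measurable)
  then show ?thesis using AE_space
  proof eventually_elim
    case (elim \<omega>)
    note \<omega> = elim(2)
    show ?case using elim(1) AE_space
    proof eventually_elim
      case (elim t)
      then have t: "t \<in> {0..T}" by simp
      note slice_I[OF mt[OF t] \<omega>, measurable]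
      have "AE s in I. ennreal \<bar>\<delta> t s \<omega>\<bar> = 0"
        using elim(1) by (subst (asm) g_def) (simp add: nn_integral_0_iff_AE)
      then show ?case by eventually_elim simp
    qed
  qed
qed

lemma psq_conditional:
  assumes t: "t \<in> {0..T}" and u: "psq u" and m: "case_prod m \<in> borel_measurable (I \<Otimes>\<^sub>M M)"
    and eq: "\<And>r. r \<in> {0..T} \<Longrightarrow> AE \<omega> in M. m r \<omega> = real_cond_exp M (F t) (u r) \<omega>"
  shows "psq m"
  unfolding sq_int_iff_nn_integral[OF m]
proof -
  interpret E: finite_measure_subalgebra M "F t" by (rule cond[OF t])
  have [measurable]: "case_prod m \<in> borel_measurable (I \<Otimes>\<^sub>M M)" "case_prod u \<in> borel_measurable (I \<Otimes>\<^sub>M M)"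
    using m u by auto
  have "(\<integral>\<^sup>+p. ennreal ((case_prod m p)\<^sup>2) \<partial>(I \<Otimes>\<^sub>M M)) = (\<integral>\<^sup>+r. (\<integral>\<^sup>+\<omega>. ennreal ((m r \<omega>)\<^sup>2) \<partial>M) \<partial>I)"
    using nn_integral_fst[of "\<lambda>p. ennreal ((case_prod m p)\<^sup>2)" I] by simp
  also have "\<dots> \<le> (\<integral>\<^sup>+r. (\<integral>\<^sup>+\<omega>. ennreal ((u r \<omega>)\<^sup>2) \<partial>M) \<partial>I)"
  proof (rule nn_integral_mono_AE)
    show "AE r in I. (\<integral>\<^sup>+\<omega>. ennreal ((m r \<omega>)\<^sup>2) \<partial>M) \<le> (\<integral>\<^sup>+\<omega>. ennreal ((u r \<omega>)\<^sup>2) \<partial>M)"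
      using psq_sections[OF u] AE_space
    proof eventually_elim
      case (elim r)
      then have r: "r \<in> {0..T}" by simp
      have "(\<integral>\<^sup>+\<omega>. ennreal ((m r \<omega>)\<^sup>2) \<partial>M) = (\<integral>\<^sup>+\<omega>. ennreal ((real_cond_exp M (F t) (u r) \<omega>)\<^sup>2) \<partial>M)"
        by (rule nn_integral_cong_AE) (use eq[OF r] in \<open>auto elim: eventually_mono\<close>)
      also have "\<dots> = ennreal (\<integral>\<omega>. (real_cond_exp M (F t) (u r) \<omega>)\<^sup>2 \<partial>M)"
        by (rule nn_integral_eq_integral[OF sq_intD[OF E.sq_int_real_cond_exp(1)[OF elim(1)]]]) simp
      also have "\<dots> \<le> ennreal (\<integral>\<omega>. (u r \<omega>)\<^sup>2 \<partial>M)"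
        by (rule ennreal_leI[OF E.sq_int_real_cond_exp(2)[OF elim(1)]])
      also have "\<dots> = (\<integral>\<^sup>+\<omega>. ennreal ((u r \<omega>)\<^sup>2) \<partial>M)"
        by (rule nn_integral_eq_integral[OF sq_intD[OF elim(1)], symmetric]) simp
      finally show ?case .
    qed
  qed
  also have "\<dots> = (\<integral>\<^sup>+p. ennreal ((case_prod u p)\<^sup>2) \<partial>(I \<Otimes>\<^sub>M M))"
    using nn_integral_fst[of "\<lambda>p. ennreal ((case_prod u p)\<^sup>2)" I] by simp
  also have "\<dots> < \<infinity>" using u sq_int_iff_nn_integral[of "case_prod u" "I \<Otimes>\<^sub>M M"] by simp
  finally show "(\<integral>\<^sup>+p. ennreal ((case_prod m p)\<^sup>2) \<partial>(I \<Otimes>\<^sub>M M)) < \<infinity>" .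
qed

lemma psq_deterministic: "sq_int I k \<Longrightarrow> psq (\<lambda>r \<omega>. k r)"
proof -
  assume k: "sq_int I k"
  have "(\<lambda>p. k (fst p)) \<in> borel_measurable (I \<Otimes>\<^sub>M M)"
    using k by (intro measurable_compose[OF measurable_fst]) auto
  then show ?thesis
    by (intro psqI[where g="\<lambda>_. \<integral>r. (k r)\<^sup>2 \<partial>I"]) (auto simp: case_prod_beta' k)
qed

text \<open>Conditional Fubini: the conditional expectation passes under the time integral, provided
  a jointly measurable version is used there. Checked on sets of \<open>F t\<close>, which are fixed
  while the order of integration is exchanged.\<close>

lemma cond_exp_integral:
  assumes t: "t \<in> {0..T}" and u: "psq u" and m: "case_prod m \<in> borel_measurable (I \<Otimes>\<^sub>M F t)"
    and eq: "\<And>r. r \<in> {0..T} \<Longrightarrow> AE \<omega> in M. m r \<omega> = real_cond_exp M (F t) (u r) \<omega>"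
    and k: "sq_int I k"
  shows "AE \<omega> in M. real_cond_exp M (F t) (\<lambda>\<omega>. \<integral>r. k r * u r \<omega> \<partial>I) \<omega> = (\<integral>r. k r * m r \<omega> \<partial>I)"
proof -
  interpret E: finite_measure_subalgebra M "F t" by (rule cond[OF t])
  have m': "case_prod m \<in> borel_measurable (I \<Otimes>\<^sub>M M)"
  proof -
    have "(\<lambda>x. (fst x, snd x)) \<in> (I \<Otimes>\<^sub>M M) \<rightarrow>\<^sub>M (I \<Otimes>\<^sub>M F t)"
      by (intro measurable_Pair measurable_fst measurable_compose[OF measurable_snd measurable_F_M[OF t]])
    from measurable_compose[OF this m] show ?thesis by simp
  qed
  have mq: "psq m" by (rule psq_conditional[OF t u m' eq])
  note kq = psq_deterministic[OF k]
  have set_int: "(\<integral>\<omega>. indicator A \<omega> * (\<integral>r. k r * v r \<omega> \<partial>I) \<partial>M) = (\<integral>r. k r * (\<integral>\<omega>. indicator A \<omega> * v r \<omega> \<partial>M) \<partial>I)"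
    if v: "psq v" and A: "A \<in> sets M" for v A
  proof -
    have Av: "psq (\<lambda>r \<omega>. indicator A \<omega> * v r \<omega>)"
    proof -
      have [measurable]: "case_prod v \<in> borel_measurable (I \<Otimes>\<^sub>M M)" using v by auto
      have "(\<lambda>p. indicator A (snd p) * case_prod v p) \<in> borel_measurable (I \<Otimes>\<^sub>M M)" using A by measurable
      then have Avm: "(\<lambda>(r, \<omega>). indicator A \<omega> * v r \<omega>) \<in> borel_measurable (I \<Otimes>\<^sub>M M)" by (simp add: case_prod_beta')
      show ?thesis
        by (rule sq_int_bound[OF sq_intD[OF v] Avm]) (auto simp: indicator_def)
    qed
    have "(\<integral>\<omega>. indicator A \<omega> * (\<integral>r. k r * v r \<omega> \<partial>I) \<partial>M) = (\<integral>\<omega>. (\<integral>r. k r * (indicator A \<omega> * v r \<omega>) \<partial>I) \<partial>M)"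
    proof (rule Bochner_Integration.integral_cong[OF refl])
      fix \<omega>
      show "indicator A \<omega> * (\<integral>r. k r * v r \<omega> \<partial>I) = (\<integral>r. k r * (indicator A \<omega> * v r \<omega>) \<partial>I)"
        by (cases "\<omega> \<in> A") simp_all
    qed
    also have "\<dots> = E2 (\<lambda>r \<omega>. k r) (\<lambda>r \<omega>. indicator A \<omega> * v r \<omega>)" by (rule E2_eq[OF kq Av, symmetric])
    also have "\<dots> = (\<integral>r. (\<integral>\<omega>. k r * (indicator A \<omega> * v r \<omega>) \<partial>M) \<partial>I)" by (rule E2_eq'[OF kq Av])
    also have "\<dots> = (\<integral>r. k r * (\<integral>\<omega>. indicator A \<omega> * v r \<omega> \<partial>M) \<partial>I)" by simp
    finally show ?thesis .
  qed
  show ?thesis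
  proof (rule E.real_cond_exp_charact)
    fix A assume A: "A \<in> sets (F t)"
    then have AM: "A \<in> sets M" using F_subset_M[OF t] by auto
    have [measurable]: "case_prod u \<in> borel_measurable (I \<Otimes>\<^sub>M M)" "case_prod m \<in> borel_measurable (I \<Otimes>\<^sub>M M)" "k \<in> borel_measurable I"
      using u m' k by auto
    have mm: "(\<lambda>r. k r * (\<integral>\<omega>. indicator A \<omega> * v r \<omega> \<partial>M)) \<in> borel_measurable I"
      if [measurable]: "case_prod v \<in> borel_measurable (I \<Otimes>\<^sub>M M)" for v
    proof -
      have "(\<lambda>(r, \<omega>). indicator A \<omega> * v r \<omega>) \<in> borel_measurable (I \<Otimes>\<^sub>M M)"
      proof -
        have "(\<lambda>p. indicator A (snd p) * case_prod v p) \<in> borel_measurable (I \<Otimes>\<^sub>M M)" using AM by measurable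
        then show ?thesis by (simp add: case_prod_beta')
      qed
      from borel_measurable_lebesgue_integral[OF this] show ?thesis by measurable
    qed
    have "(\<integral>r. k r * (\<integral>\<omega>. indicator A \<omega> * u r \<omega> \<partial>M) \<partial>I) = (\<integral>r. k r * (\<integral>\<omega>. indicator A \<omega> * m r \<omega> \<partial>M) \<partial>I)"
    proof (rule integral_cong_AE)
      show "AE r in I. k r * (\<integral>\<omega>. indicator A \<omega> * u r \<omega> \<partial>M) = k r * (\<integral>\<omega>. indicator A \<omega> * m r \<omega> \<partial>M)"
        using psq_sections[OF u] AE_space
      proof eventually_elim
        case (elim r)
        then have r: "r \<in> {0..T}" by simp
        have [measurable]: "m r \<in> borel_measurable M" by (rule slice_M[OF m' r])
        have "(\<integral>\<omega>. indicator A \<omega> * u r \<omega> \<partial>M) = (\<integral>\<omega>. indicator A \<omega> * real_cond_exp M (F t) (u r) \<omega> \<partial>M)"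
          using E.real_cond_exp_intA[OF E.integrable_of_sq_int[OF elim(1)] A] by (simp add: set_lebesgue_integral_def)
        also have "\<dots> = (\<integral>\<omega>. indicator A \<omega> * m r \<omega> \<partial>M)"
          by (rule integral_cong_AE) (use eq[OF r] AM in \<open>auto elim: eventually_mono\<close>)
        finally show ?case by simp
      qed
    qed (use mm[of u] mm[of m] in auto)
    then show "(\<integral>\<omega>\<in>A. (\<integral>r. k r * u r \<omega> \<partial>I) \<partial>M) = (\<integral>\<omega>\<in>A. (\<integral>r. k r * m r \<omega> \<partial>I) \<partial>M)"
      using set_int[OF u AM] set_int[OF mq AM] by (simp add: set_lebesgue_integral_def)
  next
    show "integrable M (\<lambda>\<omega>. \<integral>r. k r * u r \<omega> \<partial>I)" by (rule integrable_path_product[OF kq u])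
    show "integrable M (\<lambda>\<omega>. \<integral>r. k r * m r \<omega> \<partial>I)" by (rule integrable_path_product[OF kq mq])
    have "(\<lambda>x. (snd x, fst x)) \<in> (F t \<Otimes>\<^sub>M I) \<rightarrow>\<^sub>M (I \<Otimes>\<^sub>M F t)" by measurable
    from measurable_compose[OF this m]
    have 1: "(\<lambda>x. m (snd x) (fst x)) \<in> borel_measurable (F t \<Otimes>\<^sub>M I)" by simp
    have 2: "(\<lambda>x. k (snd x)) \<in> borel_measurable (F t \<Otimes>\<^sub>M I)"
      using k by (intro measurable_compose[OF measurable_snd]) auto
    have "(\<lambda>(\<omega>, r). k r * m r \<omega>) \<in> borel_measurable (F t \<Otimes>\<^sub>M I)"
      using borel_measurable_times[OF 2 1] by (simp add: case_prod_beta')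
    from I.borel_measurable_lebesgue_integral[OF this]
    show "(\<lambda>\<omega>. \<integral>r. k r * m r \<omega> \<partial>I) \<in> borel_measurable (F t)" .
  qed
qed

text \<open>Testing with the sign of the conditional expectation itself turns the pairing into the
  integral of its absolute value.\<close>

lemma orthogonal_cond_exp_zero:
  assumes h: "proc h" "psq h" and orth: "\<And>v. admissible M F T v \<Longrightarrow> E2 v h = 0"
  shows "AE s in I. AE \<omega> in M. real_cond_exp M (F s) (h s) \<omega> = 0"
proof -
  obtain Y where Yp: "\<forall>t0\<in>{0..T}. (\<lambda>(t, s, \<omega>). Y t s \<omega>) \<in> borel_measurable (restrict_space borel {0..t0} \<Otimes>\<^sub>M (borel \<Otimes>\<^sub>M F t0))"
    and "(\<lambda>(t, s, \<omega>). Y t s \<omega>) \<in> borel_measurable (borel \<Otimes>\<^sub>M (borel \<Otimes>\<^sub>M M))"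
    and Y: "AE t in I. \<forall>s\<in>{0..T}. AE \<omega> in M. Y t s \<omega> = real_cond_exp M (F t) (h s) \<omega>"
    by (rule conditional_version_exists[OF h(1)])
  \<comment> \<open>The diagonal of a progressive version is progressive, and the sign is bounded;
    hence \<open>v\<close> is admissible although the conditional expectations are only given one
    time at a time.\<close>
  define v where "v s \<omega> = sgn (Y s s \<omega> :: real)" for s \<omega>
  have vp: "progressive M F T v"
    unfolding progressive_def
  proof
    fix t assume t: "t \<in> {0..T}"
    have "(\<lambda>x. (fst x, fst x, snd x)) \<in> (restrict_space borel {0..t} \<Otimes>\<^sub>M F t) \<rightarrow>\<^sub>M (restrict_space borel {0..t} \<Otimes>\<^sub>M (borel \<Otimes>\<^sub>M F t))"
      by (intro measurable_Pair measurable_fst measurable_snd measurable_compose[OF measurable_fst]) (simp add: measurable_restrict_space1)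
    from measurable_compose[OF this bspec[OF Yp t]]
    have [measurable]: "(\<lambda>x. Y (fst x) (fst x) (snd x)) \<in> borel_measurable (restrict_space borel {0..t} \<Otimes>\<^sub>M F t)" by (simp add: case_prod_beta')
    show "(\<lambda>(s, \<omega>). v s \<omega>) \<in> borel_measurable (restrict_space borel {0..t} \<Otimes>\<^sub>M F t)"
      unfolding v_def case_prod_beta' by measurable
  qed
  have vm: "case_prod v \<in> borel_measurable (I \<Otimes>\<^sub>M M)" by (rule proc_measurable_I[OF progressive_proc[OF vp]])
  have v1: "(v s \<omega>)\<^sup>2 \<le> 1" for s \<omega> by (simp add: v_def sgn_if)
  have vq: "psq v"
  proof (rule psqI[OF vm, where g="\<lambda>_. T"])
    show "AE \<omega> in M. sq_int I (\<lambda>s. v s \<omega>) \<and> (\<integral>s. (v s \<omega>)\<^sup>2 \<partial>I) \<le> T"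
    proof (rule AE_I2)
      fix \<omega> assume \<omega>: "\<omega> \<in> space M"
      have sq: "sq_int I (\<lambda>s. v s \<omega>)"
        by (rule sq_int_bound[of _ "\<lambda>_. 1"]) (use slice_I[OF vm \<omega>] v1 in auto)
      have "(\<integral>s. (v s \<omega>)\<^sup>2 \<partial>I) \<le> (\<integral>s. 1 \<partial>I)"
        by (rule integral_mono[OF sq_intD[OF sq]]) (use v1 in auto)
      also have "\<dots> = T" using integral_const_I[of 1] by simp
      finally show "sq_int I (\<lambda>s. v s \<omega>) \<and> (\<integral>s. (v s \<omega>)\<^sup>2 \<partial>I) \<le> T" using sq by simp
    qed
  qed simp
  have key: "AE s in I. integrable M (real_cond_exp M (F s) (h s)) \<and> (\<integral>\<omega>. v s \<omega> * h s \<omega> \<partial>M) = (\<integral>\<omega>. \<bar>real_cond_exp M (F s) (h s) \<omega>\<bar> \<partial>M)"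
    using Y psq_sections[OF h(2)] psq_sections[OF vq] AE_space
  proof eventually_elim
    case (elim s)
    then have s: "s \<in> {0..T}" by simp
    interpret E: finite_measure_subalgebra M "F s" by (rule cond[OF s])
    let ?z = "real_cond_exp M (F s) (h s)"
    have [measurable]: "v s \<in> borel_measurable M" using elim by auto
    have "(\<integral>\<omega>. v s \<omega> * h s \<omega> \<partial>M) = (\<integral>\<omega>. v s \<omega> * ?z \<omega> \<partial>M)"
      by (rule E.real_cond_exp_intg(2)[OF sq_int_mult_integrable[OF elim(3,2)] progressive_adapted[OF vp s], symmetric])
         (use elim in auto)
    also have "\<dots> = (\<integral>\<omega>. \<bar>?z \<omega>\<bar> \<partial>M)"
    proof (rule integral_cong_AE)
      have "AE \<omega> in M. Y s s \<omega> = ?z \<omega>" using elim(1) s by blast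
      then show "AE \<omega> in M. v s \<omega> * ?z \<omega> = \<bar>?z \<omega>\<bar>" by eventually_elim (auto simp: v_def sgn_if)
    qed measurable
    finally show ?case using E.real_cond_exp_int(1)[OF E.integrable_of_sq_int[OF elim(2)]] by simp
  qed
  have "(\<integral>s. (\<integral>\<omega>. v s \<omega> * h s \<omega> \<partial>M) \<partial>I) = 0"
    using orth[of v] E2_eq'[OF vq h(2)] vp vq by (simp add: admissible_iff)
  moreover have "integrable I (\<lambda>s. \<integral>\<omega>. v s \<omega> * h s \<omega> \<partial>M)"
    by (rule IM.integrable_fst[OF psq_integrable[OF vq h(2)]])
  moreover have "AE s in I. 0 \<le> (\<integral>\<omega>. v s \<omega> * h s \<omega> \<partial>M)" using key by eventually_elim simp
  ultimately have "AE s in I. (\<integral>\<omega>. v s \<omega> * h s \<omega> \<partial>M) = 0"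
    using integral_nonneg_eq_0_iff_AE by blast
  then show ?thesis using key
  proof eventually_elim
    case (elim s)
    then have "(\<integral>\<omega>. \<bar>real_cond_exp M (F s) (h s) \<omega>\<bar> \<partial>M) = 0" "integrable M (\<lambda>\<omega>. \<bar>real_cond_exp M (F s) (h s) \<omega>\<bar>)" by auto
    then have "AE \<omega> in M. \<bar>real_cond_exp M (F s) (h s) \<omega>\<bar> = 0"
      by (subst (asm) integral_nonneg_eq_0_iff_AE) auto
    then show ?case by eventually_elim simp
  qed
qed

lemma measurable_I_borel_triple:
  assumes "(\<lambda>(t, s, \<omega>). Y t s \<omega>) \<in> borel_measurable (borel \<Otimes>\<^sub>M (borel \<Otimes>\<^sub>M M))"
  shows "(\<lambda>x. Y (fst x) (fst (snd x)) (snd (snd x))) \<in> borel_measurable (I \<Otimes>\<^sub>M (I \<Otimes>\<^sub>M M))"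
proof -
  have "(\<lambda>x. (fst x, fst (snd x), snd (snd x))) \<in> (I \<Otimes>\<^sub>M (I \<Otimes>\<^sub>M M)) \<rightarrow>\<^sub>M (borel \<Otimes>\<^sub>M (borel \<Otimes>\<^sub>M M))"
    by (intro measurable_Pair measurable_compose[OF measurable_fst measurable_lebesgue_on_borel]
        measurable_compose[OF measurable_snd measurable_compose[OF measurable_fst measurable_lebesgue_on_borel]]
        measurable_compose[OF measurable_snd measurable_snd])
  from measurable_compose[OF this assms] show ?thesis by (simp add: case_prod_beta')
qed

lemma measurable_sym_kernel:
  assumes K: "case_prod K \<in> borel_measurable (lborel \<Otimes>\<^sub>M lborel)"
  shows "(\<lambda>(s, r). K s r + adj K s r) \<in> borel_measurable (J \<Otimes>\<^sub>M I)"
proof -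
  have 1: "fst \<in> (J \<Otimes>\<^sub>M I) \<rightarrow>\<^sub>M lborel" "snd \<in> (J \<Otimes>\<^sub>M I) \<rightarrow>\<^sub>M lborel"
    using measurable_compose[OF measurable_fst, of "\<lambda>x. x" J borel I]
      measurable_compose[OF measurable_snd measurable_lebesgue_on_borel, of J]
    by (simp_all add: measurable_lborel1 measurable_restrict_space1)
  have "(\<lambda>p. case_prod K (fst p, snd p)) \<in> borel_measurable (J \<Otimes>\<^sub>M I)"
    by (rule measurable_compose[OF measurable_Pair[OF 1] K])
  moreover have "(\<lambda>p. case_prod K (snd p, fst p)) \<in> borel_measurable (J \<Otimes>\<^sub>M I)"
    by (rule measurable_compose[OF measurable_Pair[OF 1(2,1)] K])
  ultimately have "(\<lambda>p. case_prod K (fst p, snd p) + case_prod K (snd p, fst p)) \<in> borel_measurable (J \<Otimes>\<^sub>M I)"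
    by (rule borel_measurable_add)
  then show ?thesis by (simp add: adj_def case_prod_beta')
qed

lemma AE_lebesgue_on_tail:
  assumes "t \<in> {0..T}" "AE s in lebesgue_on {t..T}. P s"
  shows "AE s in I. t \<le> s \<longrightarrow> P s"
proof -
  have "AE s in lebesgue. s \<in> {t..T} \<longrightarrow> P s"
    using assms(2) by (subst (asm) AE_restrict_space_iff) auto
  then show ?thesis
    by (subst AE_restrict_space_iff) (auto elim!: eventually_mono)
qed

end

section \<open>From the weak equation to the explicit formula\<close>

context volterra_filtered
begin

lemmas Ks_measurable_J = measurable_sym_kernel[OF K_borel]

lemma Lop_proc:
  assumes u: "proc u" shows "proc (Lop u)"
proof -
  note k = measurable_kop_process[OF Ks_measurable_J proc_measurable_I[OF u]]
  have "(\<lambda>p. 2 * lam * case_prod u p + (case p of (s, \<omega>) \<Rightarrow> kop T Ks (\<lambda>r. u r \<omega>) s)) \<in> borel_measurable (J \<Otimes>\<^sub>M M)"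
    by (intro borel_measurable_add borel_measurable_times borel_measurable_const u k)
  then show ?thesis by (simp add: Lop_def symD_def case_prod_beta')
qed

lemma weak_cond_exp_zero:
  assumes u: "admissible M F T u" and w: "weak u f" and f: "proc f" "psq f"
  shows "AE s in I. AE \<omega> in M. real_cond_exp M (F s) (\<lambda>\<omega>. Lop u s \<omega> - f s \<omega>) \<omega> = 0"
proof -
  note uq = admissible_psq[OF u] and up = progressive_proc[OF admissible_progressive[OF u]]
  have "(\<lambda>p. case_prod (Lop u) p - case_prod f p) \<in> borel_measurable (J \<Otimes>\<^sub>M M)"
    by (intro borel_measurable_diff Lop_proc up f)
  then have hp: "proc (\<lambda>s \<omega>. Lop u s \<omega> - f s \<omega>)" by (simp add: case_prod_beta')
  have hq: "psq (\<lambda>s \<omega>. Lop u s \<omega> - f s \<omega>)" by (rule psq_diff[OF psq_Lop[OF uq] f(2)])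
  have "E2 v (\<lambda>s \<omega>. Lop u s \<omega> - f s \<omega>) = 0" if v: "admissible M F T v" for v
  proof -
    note vq = admissible_psq[OF v]
    have "E2 v (\<lambda>s \<omega>. Lop u s \<omega> - f s \<omega>) = (\<integral>p. case_prod v p * case_prod (Lop u) p - case_prod v p * case_prod f p \<partial>(I \<Otimes>\<^sub>M M))"
      unfolding E2_def by (simp add: case_prod_beta' right_diff_distrib)
    also have "\<dots> = E2 v (Lop u) - E2 v f"
      unfolding E2_def using sq_int_mult_integrable[OF vq psq_Lop[OF uq]] sq_int_mult_integrable[OF vq f(2)] by simp
    finally show ?thesis using w v by (simp add: weak_def)
  qed
  from orthogonal_cond_exp_zero[OF hp hq this] show ?thesis .
qed

text \<open>The residual equation at time s is projected down to F_t for t <= s; this gives the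
  equation for the path of E_t[u], to which the pathwise elimination applies. \<open>X\<close>
  stands apart from \<open>Y\<close> so that the source itself can be used when it is adapted, and
  the diagonal of the version otherwise. Square-integrability of the chosen inverse is part of the
  conclusion because nothing else guarantees measurable paths.\<close>

theorem weak_representation:
  assumes u: "admissible M F T u" and w: "weak u f" and f: "proc f" "psq f"
    and Y: "cond_version M F T f Y"
    and Xm: "case_prod X \<in> borel_measurable (I \<Otimes>\<^sub>M M)"
    and X: "AE t in I. AE \<omega> in M. X t \<omega> = real_cond_exp M (F t) (f t) \<omega>"
  shows "AE \<omega> in M. sq_int I (op_inv T (IminusB T B) (\<lambda>t. acoef T lam D K X Y t \<omega>)) \<and>
      aeq T (\<lambda>t. u t \<omega>) (op_inv T (IminusB T B) (\<lambda>t. acoef T lam D K X Y t \<omega>))"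
proof -
  note uq = admissible_psq[OF u] and uprog = admissible_progressive[OF u]
  note up = progressive_proc[OF uprog]
  note um = proc_measurable_I[OF up]
  obtain m where mprog: "\<forall>t0\<in>{0..T}. (\<lambda>(t, s, \<omega>). m t s \<omega>) \<in> borel_measurable (restrict_space borel {0..t0} \<Otimes>\<^sub>M (borel \<Otimes>\<^sub>M F t0))"
    and mm: "(\<lambda>(t, s, \<omega>). m t s \<omega>) \<in> borel_measurable (borel \<Otimes>\<^sub>M (borel \<Otimes>\<^sub>M M))"
    and m: "AE t in I. \<forall>s\<in>{0..T}. AE \<omega> in M. m t s \<omega> = real_cond_exp M (F t) (u s) \<omega>"
    by (rule conditional_version_exists[OF up])
  have Ym: "(\<lambda>(t, s, \<omega>). Y t s \<omega>) \<in> borel_measurable (borel \<Otimes>\<^sub>M (borel \<Otimes>\<^sub>M M))"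
    using Y unfolding cond_version_def by (rule conjunct1)
  have Yae: "AE t in I. (AE \<omega> in M. Y t t \<omega> = real_cond_exp M (F t) (f t) \<omega>) \<and>
        (AE s in lebesgue_on {t..T}. AE \<omega> in M. Y t s \<omega> = real_cond_exp M (F t) (f s) \<omega>)"
    using Y unfolding cond_version_def by (rule conjunct2)
  note mI = measurable_I_borel_triple[OF mm] and YI = measurable_I_borel_triple[OF Ym]
  have mt: "case_prod (m t) \<in> borel_measurable (I \<Otimes>\<^sub>M M)" if "t \<in> {0..T}" for t
    using measurable_compose[OF measurable_Pair1'[of t I "I \<Otimes>\<^sub>M M"] mI] that by (simp add: case_prod_beta')
  have mtF: "case_prod (m t) \<in> borel_measurable (I \<Otimes>\<^sub>M F t)" if t: "t \<in> {0..T}" for t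
  proof -
    have "(\<lambda>x. (t, fst x, snd x)) \<in> (I \<Otimes>\<^sub>M F t) \<rightarrow>\<^sub>M (restrict_space borel {0..t} \<Otimes>\<^sub>M (borel \<Otimes>\<^sub>M F t))"
      using t by (intro measurable_Pair measurable_const measurable_snd measurable_compose[OF measurable_fst measurable_lebesgue_on_borel])
         (simp add: space_restrict_space)
    from measurable_compose[OF this bspec[OF mprog t]] show ?thesis by (simp add: case_prod_beta')
  qed
  have good: "AE s in I. s \<in> {0..T} \<and> sq_int M (u s) \<and> sq_int M (f s) \<and> sq_int M (Lop u s) \<and>
      (AE \<omega> in M. real_cond_exp M (F s) (\<lambda>\<omega>. Lop u s \<omega> - f s \<omega>) \<omega> = 0)"
    using weak_cond_exp_zero[OF u w f] psq_sections[OF uq] psq_sections[OF f(2)] psq_sections[OF psq_Lop[OF uq]] AE_space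
    by eventually_elim simp
  \<comment> \<open>Tower property: the residual has zero conditional expectation at
    \<open>s\<close>, hence also at the earlier \<open>t\<close>. The operator is then exchanged
    with conditioning by conditional Fubini.\<close>
  have eq_at: "AE \<omega> in M. real_cond_exp M (F t) (f s) \<omega> = 2 * lam * m t s \<omega> + kop T Ks (\<lambda>r. m t r \<omega>) s"
    if t: "t \<in> {0..T}" and ts: "t \<le> s" and mt_eq: "\<forall>s\<in>{0..T}. AE \<omega> in M. m t s \<omega> = real_cond_exp M (F t) (u s) \<omega>"
      and s: "s \<in> {0..T} \<and> sq_int M (u s) \<and> sq_int M (f s) \<and> sq_int M (Lop u s) \<and>
      (AE \<omega> in M. real_cond_exp M (F s) (\<lambda>\<omega>. Lop u s \<omega> - f s \<omega>) \<omega> = 0)" for t s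
  proof -
    interpret E: finite_measure_subalgebra M "F t" by (rule cond[OF t])
    have s': "s \<in> {0..T}" using s by simp
    interpret S: finite_measure_subalgebra M "F s" by (rule cond[OF s'])
    define h where "h \<omega> = Lop u s \<omega> - f s \<omega>" for \<omega>
    define k where "k \<omega> = kop T Ks (\<lambda>r. u r \<omega>) s" for \<omega>
    have ui: "integrable M (u s)" and fi: "integrable M (f s)" and Li: "integrable M (Lop u s)"
      using s by (auto intro: E.integrable_of_sq_int)
    have hi: "integrable M h" unfolding h_def using Li fi by simp
    have Lk: "Lop u s = (\<lambda>\<omega>. 2 * lam * u s \<omega> + k \<omega>)" by (simp add: Lop_def symD_def k_def fun_eq_iff)
    have "integrable M (\<lambda>\<omega>. Lop u s \<omega> - 2 * lam * u s \<omega>)" using Li ui by simp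
    then have ki: "integrable M k" by (simp add: Lk)
    have 1: "AE \<omega> in M. real_cond_exp M (F t) (real_cond_exp M (F s) h) \<omega> = real_cond_exp M (F t) h \<omega>"
      using t s' ts by (intro E.real_cond_exp_nested_subalg subalg subalgebra_F hi) auto
    have 2: "AE \<omega> in M. real_cond_exp M (F t) (real_cond_exp M (F s) h) \<omega> = real_cond_exp M (F t) (\<lambda>_. 0) \<omega>"
      by (rule E.real_cond_exp_cong) (use s in \<open>auto simp: h_def[abs_def]\<close>)
    have 3: "AE \<omega> in M. real_cond_exp M (F t) (\<lambda>_. 0) \<omega> = 0"
      by (rule E.real_cond_exp_F_meas) auto
    have 4: "AE \<omega> in M. real_cond_exp M (F t) (\<lambda>\<omega>. Lop u s \<omega> - h \<omega>) \<omega> = real_cond_exp M (F t) (Lop u s) \<omega> - real_cond_exp M (F t) h \<omega>"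
      by (rule E.real_cond_exp_diff[OF Li hi])
    have "(\<lambda>\<omega>. Lop u s \<omega> - h \<omega>) = f s" by (simp add: h_def fun_eq_iff)
    note 4 = 4[unfolded this]
    have 5: "AE \<omega> in M. real_cond_exp M (F t) (Lop u s) \<omega> = real_cond_exp M (F t) (\<lambda>\<omega>. 2 * lam * u s \<omega>) \<omega> + real_cond_exp M (F t) k \<omega>"
      unfolding Lk by (rule E.real_cond_exp_add) (use ui ki in auto)
    have 6: "AE \<omega> in M. real_cond_exp M (F t) (\<lambda>\<omega>. 2 * lam * u s \<omega>) \<omega> = 2 * lam * real_cond_exp M (F t) (u s) \<omega>"
      by (rule E.real_cond_exp_cmult[OF ui])
    have 7: "AE \<omega> in M. real_cond_exp M (F t) k \<omega> = kop T Ks (\<lambda>r. m t r \<omega>) s"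
      unfolding k_def kop_def
      by (rule cond_exp_integral[OF t uq mtF[OF t] _ rowbd_sq[OF rowbd_Ks s']]) (use mt_eq in blast)
    have 8: "AE \<omega> in M. m t s \<omega> = real_cond_exp M (F t) (u s) \<omega>" using mt_eq s' by blast
    show ?thesis using 1 2 3 4 5 6 7 8 by eventually_elim simp
  qed
  \<comment> \<open>Residuals of the two pathwise hypotheses, future equation and known past. They
    are set to zero outside their time ranges so that the exchange of null sets applies on the full
    square.\<close>
  define Q1 where "Q1 t s \<omega> = (if t \<le> s then Y t s \<omega> - (2 * lam * m t s \<omega> + kop T Ks (\<lambda>r. m t r \<omega>) s) else 0)" for t s \<omega>
  define Q2 where "Q2 t r \<omega> = (if r \<le> t then m t r \<omega> - u r \<omega> else 0)" for t r \<omega>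
  have [measurable]: "fst \<in> borel_measurable (I \<Otimes>\<^sub>M (I \<Otimes>\<^sub>M M))" "(\<lambda>x. fst (snd x)) \<in> borel_measurable (I \<Otimes>\<^sub>M (I \<Otimes>\<^sub>M M))"
    by (intro measurable_into_lebesgue_on_real; measurable)+
  have kopm: "(\<lambda>x. kop T Ks (\<lambda>r. m (fst x) r (snd (snd x))) (fst (snd x))) \<in> borel_measurable (I \<Otimes>\<^sub>M (I \<Otimes>\<^sub>M M))"
  proof -
    have "(\<lambda>y. (fst (fst y), snd y, snd (snd (fst y)))) \<in> ((I \<Otimes>\<^sub>M (I \<Otimes>\<^sub>M M)) \<Otimes>\<^sub>M I) \<rightarrow>\<^sub>M (I \<Otimes>\<^sub>M (I \<Otimes>\<^sub>M M))" by measurable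
    from measurable_compose[OF this mI]
    have 1: "(\<lambda>y. m (fst (fst y)) (snd y) (snd (snd (fst y)))) \<in> borel_measurable ((I \<Otimes>\<^sub>M (I \<Otimes>\<^sub>M M)) \<Otimes>\<^sub>M I)" by simp
    have 2: "(\<lambda>y. Ks (fst (snd (fst y))) (snd y)) \<in> borel_measurable ((I \<Otimes>\<^sub>M (I \<Otimes>\<^sub>M M)) \<Otimes>\<^sub>M I)"
      by (rule rowbd_measurable[OF rowbd_Ks]) measurable
    have "(\<lambda>(x, r). Ks (fst (snd x)) r * m (fst x) r (snd (snd x))) \<in> borel_measurable ((I \<Otimes>\<^sub>M (I \<Otimes>\<^sub>M M)) \<Otimes>\<^sub>M I)"
      using borel_measurable_times[OF 2 1] by (simp add: case_prod_beta')
    from I.borel_measurable_lebesgue_integral[OF this] show ?thesis by (simp add: kop_def)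
  qed
  note [measurable] = mI YI kopm
  have Q1m: "(\<lambda>(t, s, \<omega>). Q1 t s \<omega>) \<in> borel_measurable (I \<Otimes>\<^sub>M (I \<Otimes>\<^sub>M M))"
    unfolding Q1_def case_prod_beta' by measurable
  have um' [measurable]: "(\<lambda>x. u (fst (snd x)) (snd (snd x))) \<in> borel_measurable (I \<Otimes>\<^sub>M (I \<Otimes>\<^sub>M M))"
    using measurable_compose[OF measurable_snd um, of I] by (simp add: case_prod_beta')
  have Q2m: "(\<lambda>(t, s, \<omega>). Q2 t s \<omega>) \<in> borel_measurable (I \<Otimes>\<^sub>M (I \<Otimes>\<^sub>M M))"
    unfolding Q2_def case_prod_beta' by measurable
  have "AE t in I. AE s in I. AE \<omega> in M. Q1 t s \<omega> = 0"
    using Yae m AE_space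
  proof eventually_elim
    case (elim t)
    then have t: "t \<in> {0..T}" by simp
    have "AE s in I. t \<le> s \<longrightarrow> (AE \<omega> in M. Y t s \<omega> = real_cond_exp M (F t) (f s) \<omega>)"
      by (rule AE_lebesgue_on_tail[OF t conjunct2[OF elim(1)]])
    then show ?case using good
    proof eventually_elim
      case (elim s)
      note el = elim
      show ?case
      proof (cases "t \<le> s")
        case True
        have "AE \<omega> in M. Y t s \<omega> = real_cond_exp M (F t) (f s) \<omega>" using el(1) True by blast
        then show ?thesis
          using eq_at[OF t True \<open>\<forall>s\<in>{0..T}. AE \<omega> in M. m t s \<omega> = real_cond_exp M (F t) (u s) \<omega>\<close> el(2)]
          by eventually_elim (simp add: Q1_def)
      qed (simp add: Q1_def)
    qed
  qed
  note A1 = AE_swap3[OF Q1m this]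
  have "AE t in I. AE s in I. AE \<omega> in M. Q2 t s \<omega> = 0"
    using m AE_space
  proof eventually_elim
    case (elim t)
    then have t: "t \<in> {0..T}" by simp
    interpret E: finite_measure_subalgebra M "F t" by (rule cond[OF t])
    show ?case using good
    proof eventually_elim
      case (elim s)
      note el = elim
      then have s: "s \<in> {0..T}" by simp
      show ?case
      proof (cases "s \<le> t")
        case True
        have "u s \<in> borel_measurable (F t)"
          by (rule measurable_from_subalg[OF subalgebra_F progressive_adapted[OF uprog s]]) (use s t True in auto)
        then have "AE \<omega> in M. real_cond_exp M (F t) (u s) \<omega> = u s \<omega>"
          by (intro E.real_cond_exp_F_meas E.integrable_of_sq_int) (use el in simp)
        moreover have "AE \<omega> in M. m t s \<omega> = real_cond_exp M (F t) (u s) \<omega>"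
          using \<open>\<forall>s\<in>{0..T}. AE \<omega> in M. m t s \<omega> = real_cond_exp M (F t) (u s) \<omega>\<close> s by blast
        ultimately show ?thesis by eventually_elim (simp add: Q2_def)
      qed (simp add: Q2_def)
    qed
  qed
  note A2 = AE_swap3[OF Q2m this]
  have diagm: "(\<lambda>x. (fst x, fst x, snd x)) \<in> (I \<Otimes>\<^sub>M M) \<rightarrow>\<^sub>M (I \<Otimes>\<^sub>M (I \<Otimes>\<^sub>M M))" by measurable
  have [measurable]: "(\<lambda>x. kop T Ks (\<lambda>r. m (fst x) r (snd x)) (fst x)) \<in> borel_measurable (I \<Otimes>\<^sub>M M)"
    using measurable_compose[OF diagm kopm] by simp
  have [measurable]: "(\<lambda>x. u (fst x) (snd x)) \<in> borel_measurable (I \<Otimes>\<^sub>M M)" "(\<lambda>x. X (fst x) (snd x)) \<in> borel_measurable (I \<Otimes>\<^sub>M M)"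
    using um Xm by (simp_all add: case_prod_beta')
  \<comment> \<open>The equation at \<open>s = t\<close> is treated separately: the diagonal is a
    null set of the square and is invisible to \<open>Q1\<close>.\<close>
  have "AE t in I. AE \<omega> in M. X t \<omega> = 2 * lam * u t \<omega> + kop T Ks (\<lambda>r. m t r \<omega>) t"
    using X m good
  proof eventually_elim
    case (elim t)
    note el = elim
    then have t: "t \<in> {0..T}" by simp
    interpret E: finite_measure_subalgebra M "F t" by (rule cond[OF t])
    have 1: "AE \<omega> in M. real_cond_exp M (F t) (f t) \<omega> = 2 * lam * m t t \<omega> + kop T Ks (\<lambda>r. m t r \<omega>) t"
      by (rule eq_at[OF t order_refl el(2,3)])
    have 2: "AE \<omega> in M. real_cond_exp M (F t) (u t) \<omega> = u t \<omega>"
      by (rule E.real_cond_exp_F_meas[OF E.integrable_of_sq_int progressive_adapted[OF uprog t]]) (use el in simp)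
    have 3: "AE \<omega> in M. m t t \<omega> = real_cond_exp M (F t) (u t) \<omega>" using el(2) t by blast
    show ?case using 1 2 3 el(1) by eventually_elim simp
  qed
  then have A3: "AE \<omega> in M. AE t in I. X t \<omega> = 2 * lam * u t \<omega> + kop T Ks (\<lambda>r. m t r \<omega>) t"
    by (subst IM.AE_commute[symmetric]) measurable
  \<comment> \<open>Records that for almost every scenario and time the path of conditional
    expectations is square-integrable.\<close>
  define g where "g x = (\<integral>\<^sup>+r. ennreal ((m (fst x) r (snd x))\<^sup>2) \<partial>I)" for x
  have "AE t in I. AE \<omega> in M. g (t, \<omega>) < \<infinity>"
    using m AE_space
  proof eventually_elim
    case (elim t)
    then have t: "t \<in> {0..T}" by simp
    have "psq (m t)" by (rule psq_conditional[OF t uq mt[OF t]]) (use elim(1) in blast)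
    from psq_paths[OF this] show ?case
    proof eventually_elim
      case (elim \<omega>)
      then show ?case using sq_int_iff_nn_integral[OF sq_int_measurable[OF elim]] by (simp add: g_def)
    qed
  qed
  moreover have [measurable]: "g \<in> borel_measurable (I \<Otimes>\<^sub>M M)"
  proof -
    have "(\<lambda>y. (fst (fst y), snd y, snd (fst y))) \<in> ((I \<Otimes>\<^sub>M M) \<Otimes>\<^sub>M I) \<rightarrow>\<^sub>M (I \<Otimes>\<^sub>M (I \<Otimes>\<^sub>M M))" by measurable
    from measurable_compose[OF this mI]
    have [measurable]: "(\<lambda>y. m (fst (fst y)) (snd y) (snd (fst y))) \<in> borel_measurable ((I \<Otimes>\<^sub>M M) \<Otimes>\<^sub>M I)" by simp
    have "(\<lambda>y. ennreal ((m (fst (fst y)) (snd y) (snd (fst y)))\<^sup>2)) \<in> borel_measurable ((I \<Otimes>\<^sub>M M) \<Otimes>\<^sub>M I)" by measurable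
    from I.borel_measurable_nn_integral_fst[OF this] show ?thesis by (simp add: g_def[abs_def])
  qed
  ultimately have A4: "AE \<omega> in M. AE t in I. g (t, \<omega>) < \<infinity>"
    by (subst IM.AE_commute[symmetric]) (simp_all only: prod.collapse, measurable)
  show ?thesis
    using psq_paths[OF uq] A1 A2 A3 A4 AE_space
  proof eventually_elim
    case (elim \<omega>)
    note us = elim(1) and \<omega> = elim(6)
    have "aeq T (IminusB T B (\<lambda>t. u t \<omega>)) (\<lambda>t. acoef T lam D K X Y t \<omega>)"
      unfolding aeq_def using elim(2-5) AE_space
    proof eventually_elim
      case (elim t)
      then have t: "t \<in> {0..T}" by simp
      have mtm: "(\<lambda>r. m t r \<omega>) \<in> borel_measurable I" by (rule slice_I[OF mt[OF t] \<omega>])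
      have ms: "sq_int I (\<lambda>r. m t r \<omega>)" using elim(4) sq_int_iff_nn_integral[OF mtm] by (simp add: g_def)
      have ym: "(\<lambda>s. Y t s \<omega>) \<in> borel_measurable I"
        using measurable_compose[OF measurable_Pair1'[of t I "I \<Otimes>\<^sub>M M"] YI] t
        by (intro slice_I[of "Y t", OF _ \<omega>]) (simp add: case_prod_beta')
      show ?case
        unfolding acoef_def
      proof (rule pathwise_representation[OF t us ms ym])
        show "AE s in I. t \<le> s \<longrightarrow> Y t s \<omega> = 2 * lam * m t s \<omega> + kop T Ks (\<lambda>r. m t r \<omega>) s"
          using elim(1) by eventually_elim (auto simp: Q1_def)
        show "AE r in I. r \<le> t \<longrightarrow> m t r \<omega> = u r \<omega>"
          using elim(2) by eventually_elim (auto simp: Q2_def)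
        show "X t \<omega> = 2 * lam * u t \<omega> + kop T Ks (\<lambda>r. m t r \<omega>) t" by (rule elim(3))
      qed
    qed
    then show ?case using op_inv_aeq[OF IminusB_invertible us] by simp
  qed
qed

end

context horizon
begin

lemma invertible_op_cong:
  assumes eq: "\<And>f s. sq_int I f \<Longrightarrow> s \<in> {0..T} \<Longrightarrow> D f s = D' f s" and D: "invertible_op T D"
  shows "invertible_op T D'"
proof -
  have ae: "aeq T (D f) (D' f)" if "sq_int I f" for f
    unfolding aeq_def by (rule AE_I2) (use eq[OF that] in simp)
  have sq: "sq_int I (D' f)" if f: "sq_int I f" and Df: "sq_int I (D f)" for f
  proof -
    have "sq_int I (D' f) = sq_int I (D f)"
      unfolding sq_int_def
      by (intro arg_cong2[where f="(\<and>)"] measurable_cong Bochner_Integration.integrable_cong refl) (use eq[OF f] in auto)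
    then show ?thesis using Df by simp
  qed
  note D = D[unfolded invertible_op_def L2fun_iff_sq_int]
  show ?thesis
    unfolding invertible_op_def L2fun_iff_sq_int
  proof (intro conjI allI impI)
    fix f assume f: "sq_int I f"
    then show "sq_int I (D' f)" using sq[OF f] conjunct1[OF D] by simp
  next
    fix f g assume f: "sq_int I f" and g: "sq_int I g" and fg: "aeq T f g"
    have "aeq T (D f) (D g)" using conjunct1[OF conjunct2[OF D]] f g fg by simp
    then show "aeq T (D' f) (D' g)" by (rule aeq_trans[OF aeq_sym[OF ae[OF f]] aeq_trans[OF _ ae[OF g]]])
  next
    fix f g assume f: "sq_int I f" and g: "sq_int I g" and fg: "aeq T (D' f) (D' g)"
    have "aeq T (D f) (D g)" by (rule aeq_trans[OF ae[OF f] aeq_trans[OF fg aeq_sym[OF ae[OF g]]]])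
    then show "aeq T f g" using conjunct1[OF conjunct2[OF conjunct2[OF D]]] f g by simp
  next
    fix g assume g: "sq_int I g"
    then obtain f where f: "sq_int I f" "aeq T (D f) g" using conjunct2[OF conjunct2[OF conjunct2[OF D]]] by metis
    then show "\<exists>f. sq_int I f \<and> aeq T (D' f) g" using aeq_trans[OF aeq_sym[OF ae[OF f(1)]] f(2)] by metis
  qed
qed

end

section \<open>Processes up to null sets\<close>

context filtered
begin

text \<open>Scenario first, then time: the processes given by a formula are chosen path by path and
  are not known to be jointly measurable, so a product null set would be out of reach.\<close>

definition eqv :: "(real \<Rightarrow> 'a \<Rightarrow> real) \<Rightarrow> (real \<Rightarrow> 'a \<Rightarrow> real) \<Rightarrow> bool" where
  "eqv u v \<longleftrightarrow> (AE \<omega> in M. aeq T (\<lambda>t. u t \<omega>) (\<lambda>t. v t \<omega>))"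

lemma eqv_sym: "eqv u v \<Longrightarrow> eqv v u"
  unfolding eqv_def by (rule eventually_mono) (auto intro: aeq_sym)

lemma eqv_trans: "eqv u v \<Longrightarrow> eqv v w \<Longrightarrow> eqv u w"
  unfolding eqv_def by (rule eventually_elim2) (auto intro: aeq_trans)

lemma E2_cong:
  assumes v: "psq v" and f: "psq f" and g: "psq g" and eq: "eqv f g"
  shows "E2 v f = E2 v g"
  unfolding E2_eq[OF v f] E2_eq[OF v g]
proof (rule integral_cong_AE)
  show "AE \<omega> in M. (\<integral>s. v s \<omega> * f s \<omega> \<partial>I) = (\<integral>s. v s \<omega> * g s \<omega> \<partial>I)"
    using eq[unfolded eqv_def] psq_paths[OF v] psq_paths[OF f] psq_paths[OF g]
  proof eventually_elim
    case (elim \<omega>)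
    note [measurable] = elim(2-4)[THEN sq_int_measurable]
    show ?case by (rule integral_cong_AE) (use elim(1) in \<open>auto simp: aeq_def\<close>)
  qed
qed (use integrable_path_product[OF v f] integrable_path_product[OF v g] in auto)

lemma eqv_kop_pointwise:
  assumes k: "rowbd k C" and u: "AE \<omega> in M. (\<lambda>s. u s \<omega>) \<in> borel_measurable I" and v: "AE \<omega> in M. (\<lambda>s. v s \<omega>) \<in> borel_measurable I"
    and eq: "eqv u v"
  shows "AE \<omega> in M. \<forall>s\<in>{0..T}. kop T k (\<lambda>r. u r \<omega>) s = kop T k (\<lambda>r. v r \<omega>) s"
  using eq[unfolded eqv_def] u v by eventually_elim (auto intro: kop_cong_AE[OF k])

lemma psq_paths_measurable: "psq u \<Longrightarrow> AE \<omega> in M. (\<lambda>s. u s \<omega>) \<in> borel_measurable I"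
  by (drule psq_paths) (auto elim: eventually_mono)

lemma eqv_kop:
  assumes k: "rowbd k C" and u: "psq u" and v: "psq v" and eq: "eqv u v"
  shows "eqv (\<lambda>s \<omega>. kop T k (\<lambda>r. u r \<omega>) s) (\<lambda>s \<omega>. kop T k (\<lambda>r. v r \<omega>) s)"
  unfolding eqv_def aeq_def
  using eqv_kop_pointwise[OF k psq_paths_measurable[OF u] psq_paths_measurable[OF v] eq]
  by eventually_elim (auto intro!: AE_I2)

lemma eqv_add_scaled: "eqv u v \<Longrightarrow> eqv u' v' \<Longrightarrow> eqv (\<lambda>s \<omega>. u s \<omega> + c * u' s \<omega>) (\<lambda>s \<omega>. v s \<omega> + c * v' s \<omega>)"
  unfolding eqv_def
proof (erule (1) eventually_elim2)
  fix \<omega> assume "aeq T (\<lambda>t. u t \<omega>) (\<lambda>t. v t \<omega>)" "aeq T (\<lambda>t. u' t \<omega>) (\<lambda>t. v' t \<omega>)"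
  then show "aeq T (\<lambda>s. u s \<omega> + c * u' s \<omega>) (\<lambda>s. v s \<omega> + c * v' s \<omega>)"
    unfolding aeq_def by (rule eventually_elim2) simp
qed

lemma eqv_refl: "eqv u u" by (simp add: eqv_def aeq_def)

lemma eqv_sum:
  assumes "\<And>i. i \<in> A \<Longrightarrow> eqv (u i) (v i)"
  shows "eqv (\<lambda>s \<omega>. \<Sum>i\<in>A. u i s \<omega>) (\<lambda>s \<omega>. \<Sum>i\<in>A. v i s \<omega>)"
  using assms
proof (induction A rule: infinite_finite_induct)
  case (insert x A)
  then show ?case using eqv_add_scaled[of "u x" "v x" "\<lambda>s \<omega>. \<Sum>i\<in>A. u i s \<omega>" "\<lambda>s \<omega>. \<Sum>i\<in>A. v i s \<omega>" 1] by simp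
qed (simp_all add: eqv_refl)

lemma psq_sum: "(\<And>i. i \<in> A \<Longrightarrow> psq (u i)) \<Longrightarrow> psq (\<lambda>s \<omega>. \<Sum>i\<in>A. u i s \<omega>)"
  using sq_int_sum[of A "I \<Otimes>\<^sub>M M" "\<lambda>i. case_prod (u i)"] by (simp add: case_prod_beta')

lemma E2_add_scaled:
  assumes v: "psq v" and f: "psq f" and g: "psq g"
  shows "E2 v (\<lambda>s \<omega>. f s \<omega> + c * g s \<omega>) = E2 v f + c * E2 v g"
proof -
  have "E2 v (\<lambda>s \<omega>. f s \<omega> + c * g s \<omega>) = (\<integral>p. case_prod v p * case_prod f p + c * (case_prod v p * case_prod g p) \<partial>(I \<Otimes>\<^sub>M M))"
    unfolding E2_def by (rule Bochner_Integration.integral_cong) (auto simp: algebra_simps)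
  also have "\<dots> = E2 v f + c * E2 v g"
    unfolding E2_def using sq_int_mult_integrable[OF v f] sq_int_mult_integrable[OF v g] by simp
  finally show ?thesis .
qed

lemma E2_zero: "E2 v (\<lambda>s \<omega>. 0) = 0"
  by (simp add: E2_def case_prod_beta')

text \<open>Subsets of null sets belong to \<open>F 0\<close> by the usual conditions, so
  \<open>M\<close> is complete. This makes random variables built from pathwise choices
  measurable.\<close>

lemma measurable_AE_eq:
  fixes f g :: "'a \<Rightarrow> real"
  assumes g: "g \<in> borel_measurable M" and eq: "AE \<omega> in M. f \<omega> = g \<omega>"
  shows "f \<in> borel_measurable M"
proof -
  obtain N where N: "{\<omega> \<in> space M. f \<omega> \<noteq> g \<omega>} \<subseteq> N" "N \<in> null_sets M"
    using eq by (auto elim!: AE_E intro: null_setsI)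
  have sub: "A \<in> sets M" if "A \<subseteq> N" for A
  proof -
    have "A \<in> sets (F 0)" using usual N(2) that unfolding usual_filtration_def by blast
    then show ?thesis using F_subset_M[of 0] T_pos by auto
  qed
  show ?thesis
  proof (rule measurableI)
    fix A :: "real set" assume A: "A \<in> sets borel"
    have "f -` A \<inter> space M = ((g -` A \<inter> space M) - N) \<union> (f -` A \<inter> space M \<inter> N)"
      using N(1) by auto
    moreover have "(g -` A \<inter> space M) - N \<in> sets M"
      using measurable_sets[OF g A] sub[of N] by auto
    moreover have "f -` A \<inter> space M \<inter> N \<in> sets M" by (rule sub) auto
    ultimately show "f -` A \<inter> space M \<in> sets M" by (metis sets.Un)
  qed simp
qed

lemma cond_version_exists:
  assumes "proc f" obtains Y where "cond_version M F T f Y"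
proof -
  obtain Y where 1: "\<forall>t0\<in>{0..T}. (\<lambda>(t, s, \<omega>). Y t s \<omega>) \<in> borel_measurable (restrict_space borel {0..t0} \<Otimes>\<^sub>M (borel \<Otimes>\<^sub>M F t0))"
    and 2: "(\<lambda>(t, s, \<omega>). Y t s \<omega>) \<in> borel_measurable (borel \<Otimes>\<^sub>M (borel \<Otimes>\<^sub>M M))"
    and Y: "AE t in I. \<forall>s\<in>{0..T}. AE \<omega> in M. Y t s \<omega> = real_cond_exp M (F t) (f s) \<omega>"
    by (rule conditional_version_exists[OF assms])
  have "AE t in I. (AE \<omega> in M. Y t t \<omega> = real_cond_exp M (F t) (f t) \<omega>) \<and>
        (AE s in lebesgue_on {t..T}. AE \<omega> in M. Y t s \<omega> = real_cond_exp M (F t) (f s) \<omega>)"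
    using Y AE_space
  proof eventually_elim
    case (elim t)
    then have t: "t \<in> {0..T}" by simp
    show ?case
    proof
      show "AE \<omega> in M. Y t t \<omega> = real_cond_exp M (F t) (f t) \<omega>" using elim(1) t by blast
      show "AE s in lebesgue_on {t..T}. AE \<omega> in M. Y t s \<omega> = real_cond_exp M (F t) (f s) \<omega>"
      proof (rule AE_I2)
        fix s assume "s \<in> space (lebesgue_on {t..T})"
        then have "s \<in> {0..T}" using t by simp
        then show "AE \<omega> in M. Y t s \<omega> = real_cond_exp M (F t) (f s) \<omega>" using elim(1) by blast
      qed
    qed
  qed
  then have "cond_version M F T f Y" unfolding cond_version_def using 2 by (rule conjI[rotated])
  then show thesis by (rule that)
qed

text \<open>Lets conditional expectations of a process known only through its paths be replaced by
  those of a measurable one. Equality is required at every \<open>s\<close>, since the diagonal is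
  part of \<open>cond_version\<close>.\<close>

lemma cond_version_cong:
  assumes g: "proc g" and eq: "\<And>s. s \<in> {0..T} \<Longrightarrow> AE \<omega> in M. f s \<omega> = g s \<omega>"
  shows "cond_version M F T f Y \<longleftrightarrow> cond_version M F T g Y"
proof -
  have gm: "g s \<in> borel_measurable M" if "s \<in> {0..T}" for s
    by (rule slice_M[OF proc_measurable_I[OF g] that])
  have ce: "AE \<omega> in M. real_cond_exp M (F t) (f s) \<omega> = real_cond_exp M (F t) (g s) \<omega>" if t: "t \<in> {0..T}" and s: "s \<in> {0..T}" for t s
  proof -
    interpret E: finite_measure_subalgebra M "F t" by (rule cond[OF t])
    show ?thesis by (rule E.real_cond_exp_cong[OF eq[OF s] measurable_AE_eq[OF gm[OF s] eq[OF s]] gm[OF s]])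
  qed
  have iff: "(AE \<omega> in M. Z \<omega> = real_cond_exp M (F t) (f s) \<omega>) \<longleftrightarrow> (AE \<omega> in M. Z \<omega> = real_cond_exp M (F t) (g s) \<omega>)"
    if t: "t \<in> {0..T}" and s: "s \<in> {0..T}" for t s Z
    using ce[OF t s] by (intro iffI) (erule (1) eventually_elim2, simp)+
  have "(AE t in I. (AE \<omega> in M. Y t t \<omega> = real_cond_exp M (F t) (f t) \<omega>) \<and>
        (AE s in lebesgue_on {t..T}. AE \<omega> in M. Y t s \<omega> = real_cond_exp M (F t) (f s) \<omega>))
    \<longleftrightarrow> (AE t in I. (AE \<omega> in M. Y t t \<omega> = real_cond_exp M (F t) (g t) \<omega>) \<and>
        (AE s in lebesgue_on {t..T}. AE \<omega> in M. Y t s \<omega> = real_cond_exp M (F t) (g s) \<omega>))"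
  proof (rule AE_cong)
    fix t assume "t \<in> space I"
    then have t: "t \<in> {0..T}" by simp
    have "(AE s in lebesgue_on {t..T}. AE \<omega> in M. Y t s \<omega> = real_cond_exp M (F t) (f s) \<omega>)
      \<longleftrightarrow> (AE s in lebesgue_on {t..T}. AE \<omega> in M. Y t s \<omega> = real_cond_exp M (F t) (g s) \<omega>)"
      by (rule AE_cong, rule iff[OF t]) (use t in simp)
    then show "((AE \<omega> in M. Y t t \<omega> = real_cond_exp M (F t) (f t) \<omega>) \<and>
        (AE s in lebesgue_on {t..T}. AE \<omega> in M. Y t s \<omega> = real_cond_exp M (F t) (f s) \<omega>))
      \<longleftrightarrow> ((AE \<omega> in M. Y t t \<omega> = real_cond_exp M (F t) (g t) \<omega>) \<and>
        (AE s in lebesgue_on {t..T}. AE \<omega> in M. Y t s \<omega> = real_cond_exp M (F t) (g s) \<omega>))"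
      using iff[OF t t] by simp
  qed
  then show ?thesis unfolding cond_version_def by simp
qed

lemma cond_version_diagonal:
  assumes "cond_version M F T f Y"
  shows "(\<lambda>(t, \<omega>). Y t t \<omega>) \<in> borel_measurable (I \<Otimes>\<^sub>M M)"
    and "AE t in I. AE \<omega> in M. Y t t \<omega> = real_cond_exp M (F t) (f t) \<omega>"
proof -
  have Ym: "(\<lambda>(t, s, \<omega>). Y t s \<omega>) \<in> borel_measurable (borel \<Otimes>\<^sub>M (borel \<Otimes>\<^sub>M M))"
    using assms unfolding cond_version_def by (rule conjunct1)
  have "(\<lambda>x. (fst x, fst x, snd x)) \<in> (I \<Otimes>\<^sub>M M) \<rightarrow>\<^sub>M (I \<Otimes>\<^sub>M (I \<Otimes>\<^sub>M M))" by measurable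
  from measurable_compose[OF this measurable_I_borel_triple[OF Ym]]
  show "(\<lambda>(t, \<omega>). Y t t \<omega>) \<in> borel_measurable (I \<Otimes>\<^sub>M M)" by (simp add: case_prod_beta')
  have "AE t in I. (AE \<omega> in M. Y t t \<omega> = real_cond_exp M (F t) (f t) \<omega>) \<and>
        (AE s in lebesgue_on {t..T}. AE \<omega> in M. Y t s \<omega> = real_cond_exp M (F t) (f s) \<omega>)"
    using assms unfolding cond_version_def by (rule conjunct2)
  then show "AE t in I. AE \<omega> in M. Y t t \<omega> = real_cond_exp M (F t) (f t) \<omega>"
    by (rule eventually_mono) (rule conjunct1)
qed

lemma adapted_cond_exp:
  assumes "admissible M F T f"
  shows "AE t in I. AE \<omega> in M. f t \<omega> = real_cond_exp M (F t) (f t) \<omega>"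
  using psq_sections[OF admissible_psq[OF assms]] AE_space
proof eventually_elim
  case (elim t)
  then have t: "t \<in> {0..T}" by simp
  interpret E: finite_measure_subalgebra M "F t" by (rule cond[OF t])
  have "AE \<omega> in M. real_cond_exp M (F t) (f t) \<omega> = f t \<omega>"
    by (rule E.real_cond_exp_F_meas[OF E.integrable_of_sq_int[OF elim(1)] progressive_adapted[OF admissible_progressive[OF assms] t]])
  then show ?case by eventually_elim simp
qed

end

context volterra_filtered
begin

lemma eqv_Lop:
  assumes u: "psq u" and v: "psq v" and eq: "eqv u v"
  shows "eqv (Lop u) (Lop v)"
proof -
  have "eqv (\<lambda>s \<omega>. kop T Ks (\<lambda>r. u r \<omega>) s + 2 * lam * u s \<omega>) (\<lambda>s \<omega>. kop T Ks (\<lambda>r. v r \<omega>) s + 2 * lam * v s \<omega>)"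
    by (rule eqv_add_scaled[OF eqv_kop[OF rowbd_Ks u v eq] eq])
  then show ?thesis by (simp add: Lop_def[abs_def] symD_def add.commute)
qed

lemma weak_cong:
  assumes "psq u" "psq v" "eqv u v" "psq f" "psq g" "eqv f g" "weak u f"
  shows "weak v g"
  unfolding weak_def
proof (intro allI impI)
  fix w assume w: "admissible M F T w"
  note wq = admissible_psq[OF w]
  have "E2 w (Lop v) = E2 w (Lop u)"
    by (rule E2_cong[OF wq psq_Lop[OF assms(2)] psq_Lop[OF assms(1)] eqv_Lop[OF assms(2,1) eqv_sym[OF assms(3)]]])
  also have "\<dots> = E2 w f" using assms(7) w by (simp add: weak_def)
  also have "\<dots> = E2 w g" by (rule E2_cong[OF wq assms(4-6)])
  finally show "E2 w (Lop v) = E2 w g" .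
qed

text \<open>Both solutions are represented by the same formula, computed from one common
  version.\<close>

lemma weak_unique:
  assumes "admissible M F T u" "admissible M F T v" "weak u f" "weak v f" "proc f" "psq f"
  shows "eqv u v"
proof -
  obtain Y where Y: "cond_version M F T f Y" by (rule cond_version_exists[OF assms(5)])
  note d = cond_version_diagonal[OF Y]
  show ?thesis unfolding eqv_def
    using weak_representation[OF assms(1,3,5,6) Y d] weak_representation[OF assms(2,4,5,6) Y d]
    by eventually_elim (blast intro: aeq_trans aeq_sym)
qed

end

section \<open>The game\<close>

context horizon
begin

lemma form_add_right:
  assumes "rowbd K C" "sq_int I f" "sq_int I g" "sq_int I w"
  shows "(\<integral>s. f s * kop T K (\<lambda>s. g s + e * w s) s \<partial>I) = (\<integral>s. f s * kop T K g s \<partial>I) + e * (\<integral>s. f s * kop T K w s \<partial>I)"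
proof -
  have "(\<integral>s. f s * kop T K (\<lambda>s. g s + e * w s) s \<partial>I) = (\<integral>s. f s * kop T K g s + e * (f s * kop T K w s) \<partial>I)"
    by (rule Bochner_Integration.integral_cong) (auto simp: kop_add_scaled[OF assms(1,3,4)] algebra_simps)
  then show ?thesis
    using sq_int_mult_integrable[OF assms(2) sq_int_kop[OF assms(1,3)]] sq_int_mult_integrable[OF assms(2) sq_int_kop[OF assms(1,4)]]
    by simp
qed

lemma inner_add_left:
  assumes "sq_int I f" "sq_int I w" "sq_int I h"
  shows "(\<integral>s. (f s + e * w s) * h s \<partial>I) = (\<integral>s. f s * h s \<partial>I) + e * (\<integral>s. w s * h s \<partial>I)"
proof -
  have "(\<integral>s. (f s + e * w s) * h s \<partial>I) = (\<integral>s. f s * h s + e * (w s * h s) \<partial>I)"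
    by (rule Bochner_Integration.integral_cong) (auto simp: algebra_simps)
  then show ?thesis
    using sq_int_mult_integrable[OF assms(1,3)] sq_int_mult_integrable[OF assms(2,3)] by simp
qed

lemma form_add_both:
  assumes K: "rowbd K C" and "sq_int I f" "sq_int I w" "sq_int I g" "sq_int I z"
  shows "(\<integral>s. (f s + e * w s) * kop T K (\<lambda>s. g s + d * z s) s \<partial>I)
    = (\<integral>s. f s * kop T K g s \<partial>I) + d * (\<integral>s. f s * kop T K z s \<partial>I)
      + e * ((\<integral>s. w s * kop T K g s \<partial>I) + d * (\<integral>s. w s * kop T K z s \<partial>I))"
  using inner_add_left[OF assms(2,3) sq_int_kop[OF K sq_int_add[OF assms(4) sq_int_cmult[OF assms(5)]]], of e d]
    form_add_right[OF K assms(2,4,5)] form_add_right[OF K assms(3,4,5)] by simp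

lemma form_adj:
  assumes "rowbd K C" "rowbd (adj K) C" "sq_int I f" "sq_int I g"
  shows "(\<integral>s. f s * kop T (adj K) g s \<partial>I) = (\<integral>s. g s * kop T K f s \<partial>I)"
  using kop_adjoint[OF assms(1,4,3)] by (simp add: mult.commute)

lemma form_sym_kernel:
  assumes "rowbd K C" "rowbd (adj K) C" "sq_int I f" "sq_int I g"
  shows "(\<integral>s. f s * kop T (\<lambda>s r. K s r + adj K s r) g s \<partial>I) = (\<integral>s. f s * kop T K g s \<partial>I) + (\<integral>s. g s * kop T K f s \<partial>I)"
proof -
  have "(\<integral>s. f s * kop T (\<lambda>s r. K s r + adj K s r) g s \<partial>I) = (\<integral>s. f s * kop T K g s + f s * kop T (adj K) g s \<partial>I)"
    by (rule Bochner_Integration.integral_cong) (auto simp: kop_add_kernel[OF assms(1,2,4)] distrib_left)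
  then show ?thesis
    using sq_int_mult_integrable[OF assms(3) sq_int_kop[OF assms(1,4)]] sq_int_mult_integrable[OF assms(3) sq_int_kop[OF assms(2,4)]]
      form_adj[OF assms] by simp
qed

text \<open>The payoff along one scenario without the constant: \<open>f\<close> is the player's own
  path, \<open>g\<close> the average, \<open>\<beta>\<close> and \<open>\<gamma>\<close> the
  individual and common sources.\<close>

definition Jpath :: "real \<Rightarrow> (real \<Rightarrow> real \<Rightarrow> real) \<Rightarrow> (real \<Rightarrow> real \<Rightarrow> real) \<Rightarrow> (real \<Rightarrow> real \<Rightarrow> real) \<Rightarrow>
    (real \<Rightarrow> real) \<Rightarrow> (real \<Rightarrow> real) \<Rightarrow> (real \<Rightarrow> real) \<Rightarrow> (real \<Rightarrow> real) \<Rightarrow> real" where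
  "Jpath lam A1 A2h A3 \<beta> \<gamma> f g = - ip T g (kop T A1 g) - (lam * ip T f f + ip T f (kop T A2h f))
     - ip T f (kop T (\<lambda>s r. A3 s r + adj A3 s r) g) + ip T \<beta> f + ip T \<gamma> g"

text \<open>The second-order coefficient when the own path moves by \<open>w\<close> and the average
  by \<open>w / n\<close>.\<close>

definition Qpath :: "real \<Rightarrow> real \<Rightarrow> (real \<Rightarrow> real \<Rightarrow> real) \<Rightarrow> (real \<Rightarrow> real \<Rightarrow> real) \<Rightarrow> (real \<Rightarrow> real \<Rightarrow> real) \<Rightarrow> (real \<Rightarrow> real) \<Rightarrow> real" where
  "Qpath n lam A1 A2h A3 w = ip T w (kop T A1 w) / n\<^sup>2 + (lam * ip T w w + ip T w (kop T A2h w))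
     + ip T w (kop T (\<lambda>s r. A3 s r + adj A3 s r) w) / n"

text \<open>An exact expansion, the payoff being quadratic. The slope separates into
  \<open>H\<close> acting on the average, from \<open>A1\<close> and the own movement in the
  \<open>A3\<close> term, and \<open>Kh\<close> acting on the own path, from \<open>A2h\<close> and
  the movement of the average in the \<open>A3\<close> term. This is where both kernels
  originate.\<close>

lemma Jpath_perturb:
  fixes n :: real
  assumes A1: "good A1 C1" and A2: "good A2h C2" and A3: "good A3 C3" and n: "n > 0"
    and f: "sq_int I f" and g: "sq_int I g" and w: "sq_int I w" and \<beta>: "sq_int I \<beta>" and \<gamma>: "sq_int I \<gamma>"
  defines "H \<equiv> (\<lambda>s r. A1 s r / n + A3 s r)" and "Kh \<equiv> (\<lambda>s r. A3 s r / n + A2h s r)"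
  shows "Jpath lam A1 A2h A3 \<beta> \<gamma> (\<lambda>s. f s + e * w s) (\<lambda>s. g s + (e / n) * w s)
    = Jpath lam A1 A2h A3 \<beta> \<gamma> f g
      + e * (\<integral>s. w s * (\<beta> s + \<gamma> s / n - kop T (\<lambda>s r. H s r + adj H s r) g s - symD lam (\<lambda>s r. Kh s r + adj Kh s r) f s) \<partial>I)
      - e\<^sup>2 * Qpath n lam A1 A2h A3 w"
proof -
  have r: "rowbd A1 C1" "rowbd (adj A1) C1" "rowbd A2h C2" "rowbd (adj A2h) C2" "rowbd A3 C3" "rowbd (adj A3) C3"
    using A1 A2 A3 by (auto simp: good_def)
  note s1 = rowbd_add[OF r(1,2)] and s2 = rowbd_add[OF r(3,4)] and s3 = rowbd_add[OF r(5,6)]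
  define a where "a x y = (\<integral>s. x s * kop T A1 y s \<partial>I)" for x y
  define b where "b x y = (\<integral>s. x s * kop T A2h y s \<partial>I)" for x y
  define c where "c x y = (\<integral>s. x s * kop T (\<lambda>s r. A3 s r + adj A3 s r) y s \<partial>I)" for x y
  define i where "i x y = (\<integral>s. x s * y s \<partial>I)" for x y :: "real \<Rightarrow> real"
  have isym: "i x y = i y x" for x y by (simp add: i_def mult.commute)
  have aa: "a (\<lambda>s. g s + (e / n) * w s) (\<lambda>s. g s + (e / n) * w s) = a g g + (e / n) * a g w + (e / n) * (a w g + (e / n) * a w w)"
    unfolding a_def by (rule form_add_both[OF r(1) g w g w])
  have bb: "b (\<lambda>s. f s + e * w s) (\<lambda>s. f s + e * w s) = b f f + e * b f w + e * (b w f + e * b w w)"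
    unfolding b_def by (rule form_add_both[OF r(3) f w f w])
  have cc: "c (\<lambda>s. f s + e * w s) (\<lambda>s. g s + (e / n) * w s) = c f g + (e / n) * c f w + e * (c w g + (e / n) * c w w)"
    unfolding c_def by (rule form_add_both[OF s3 f w g w])
  have il: "i (\<lambda>s. x s + d * y s) z = i x z + d * i y z" if "sq_int I x" "sq_int I y" "sq_int I z" for x y z d
    unfolding i_def by (rule inner_add_left[OF that])
  have ii: "i (\<lambda>s. f s + e * w s) (\<lambda>s. f s + e * w s) = i f f + 2 * e * i f w + e\<^sup>2 * i w w"
  proof -
    have "i f (\<lambda>s. f s + e * w s) = i f f + e * i w f"
      using il[OF f w f, of e] isym[of f "\<lambda>s. f s + e * w s"] by simp
    moreover have "i w (\<lambda>s. f s + e * w s) = i f w + e * i w w"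
      using il[OF f w w, of e] isym[of w "\<lambda>s. f s + e * w s"] by simp
    ultimately show ?thesis
      using il[OF f w sq_int_add[OF f sq_int_cmult[OF w]], of e e] isym[of w f] by (simp add: algebra_simps power2_eq_square)
  qed
  have ib: "i \<beta> (\<lambda>s. f s + e * w s) = i \<beta> f + e * i \<beta> w"
    unfolding isym[of \<beta>] by (rule il[OF f w \<beta>])
  have ig: "i \<gamma> (\<lambda>s. g s + (e / n) * w s) = i \<gamma> g + (e / n) * i \<gamma> w"
    unfolding isym[of \<gamma>] by (rule il[OF g w \<gamma>])
  \<comment> \<open>Symmetry turns the cross term caused by the moving average into an operator
    acting on the own path.\<close>
  have csym: "c w f = c f w"
  proof -
    have "c w f = (\<integral>s. kop T (\<lambda>s r. A3 s r + adj A3 s r) w s * f s \<partial>I)"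
      unfolding c_def by (rule kop_symmetric[OF s3 _ w f]) (simp add: adj_def)
    then show ?thesis by (simp add: c_def mult.commute)
  qed
  have Hk: "kop T (\<lambda>s r. H s r + adj H s r) g s
      = (1 / n) * kop T (\<lambda>s r. A1 s r + adj A1 s r) g s + kop T (\<lambda>s r. A3 s r + adj A3 s r) g s"
    if s: "s \<in> {0..T}" for s
  proof -
    have "(\<lambda>s r. H s r + adj H s r) = (\<lambda>s r. (1 / n) * (A1 s r + adj A1 s r) + (A3 s r + adj A3 s r))"
      by (auto simp: H_def adj_def add_divide_distrib fun_eq_iff)
    then show ?thesis by (simp only: kop_add_kernel[OF rowbd_cmult[OF s1] s3 g s] kop_cmult_kernel)
  qed
  have Kk: "kop T (\<lambda>s r. Kh s r + adj Kh s r) f s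
      = (1 / n) * kop T (\<lambda>s r. A3 s r + adj A3 s r) f s + kop T (\<lambda>s r. A2h s r + adj A2h s r) f s"
    if s: "s \<in> {0..T}" for s
  proof -
    have "(\<lambda>s r. Kh s r + adj Kh s r) = (\<lambda>s r. (1 / n) * (A3 s r + adj A3 s r) + (A2h s r + adj A2h s r))"
      by (auto simp: Kh_def adj_def add_divide_distrib fun_eq_iff)
    then show ?thesis by (simp only: kop_add_kernel[OF rowbd_cmult[OF s3] s2 f s] kop_cmult_kernel)
  qed
  have lin: "(\<integral>s. w s * (\<beta> s + \<gamma> s / n - kop T (\<lambda>s r. H s r + adj H s r) g s - symD lam (\<lambda>s r. Kh s r + adj Kh s r) f s) \<partial>I)
     = i \<beta> w + i \<gamma> w / n - (a w g + a g w) / n - c w g - 2 * lam * i f w - c w f / n - (b w f + b f w)"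
  proof -
    note ints = sq_int_mult_integrable[OF w \<beta>] sq_int_mult_integrable[OF w \<gamma>] sq_int_mult_integrable[OF w f]
      sq_int_mult_integrable[OF w sq_int_kop[OF s1 g]] sq_int_mult_integrable[OF w sq_int_kop[OF s3 g]]
      sq_int_mult_integrable[OF w sq_int_kop[OF s3 f]] sq_int_mult_integrable[OF w sq_int_kop[OF s2 f]]
    have "(\<integral>s. w s * (\<beta> s + \<gamma> s / n - kop T (\<lambda>s r. H s r + adj H s r) g s - symD lam (\<lambda>s r. Kh s r + adj Kh s r) f s) \<partial>I)
      = (\<integral>s. w s * \<beta> s + (1 / n) * (w s * \<gamma> s) - (1 / n) * (w s * kop T (\<lambda>s r. A1 s r + adj A1 s r) g s)
          - w s * kop T (\<lambda>s r. A3 s r + adj A3 s r) g s - 2 * lam * (w s * f s)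
          - (1 / n) * (w s * kop T (\<lambda>s r. A3 s r + adj A3 s r) f s) - w s * kop T (\<lambda>s r. A2h s r + adj A2h s r) f s \<partial>I)"
      by (rule Bochner_Integration.integral_cong) (auto simp: Hk Kk symD_def algebra_simps)
    also have "\<dots> = i w \<beta> + (1 / n) * i w \<gamma> - (1 / n) * (\<integral>s. w s * kop T (\<lambda>s r. A1 s r + adj A1 s r) g s \<partial>I)
          - c w g - 2 * lam * i w f - (1 / n) * c w f - (\<integral>s. w s * kop T (\<lambda>s r. A2h s r + adj A2h s r) f s \<partial>I)"
      unfolding i_def c_def using ints by simp
    also have "(\<integral>s. w s * kop T (\<lambda>s r. A1 s r + adj A1 s r) g s \<partial>I) = a w g + a g w"
      unfolding a_def by (rule form_sym_kernel[OF r(1,2) w g])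
    also have "(\<integral>s. w s * kop T (\<lambda>s r. A2h s r + adj A2h s r) f s \<partial>I) = b w f + b f w"
      unfolding b_def by (rule form_sym_kernel[OF r(3,4) w f])
    finally show ?thesis by (simp add: isym[of w])
  qed
  show ?thesis
    unfolding lin Jpath_def Qpath_def ip_def a_def[symmetric] b_def[symmetric] c_def[symmetric] i_def[symmetric] aa bb cc ii ib ig csym
    using n by (simp add: field_simps power2_eq_square)
qed

lemma Qpath_nonneg:
  assumes A1: "good A1 C1" and A2: "good A2h C2" and A3: "good A3 C3" and n: "n > 0" and lam: "lam \<ge> 0" and w: "sq_int I w"
  shows "0 \<le> Qpath n lam A1 A2h A3 w"
proof -
  have "0 \<le> ip T w w" by (simp add: ip_def)
  moreover have "0 \<le> ip T w (kop T A1 w)" "0 \<le> ip T w (kop T A2h w)" "0 \<le> ip T w (kop T A3 w)"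
    using A1 A2 A3 w by (simp_all add: good_def ip_def)
  moreover have "ip T w (kop T (\<lambda>s r. A3 s r + adj A3 s r) w) = 2 * ip T w (kop T A3 w)"
    using form_sym_kernel[of A3 C3 w w] A3 w by (simp add: good_def ip_def)
  ultimately show ?thesis using n lam by (simp add: Qpath_def)
qed

text \<open>Fixes a constant by choice, so that the locale instances depend on the kernels
  alone.\<close>

definition good_const :: "(real \<Rightarrow> real \<Rightarrow> real) \<Rightarrow> real" where "good_const K = (SOME C. good K C)"

lemma good_good_const: "good K C \<Longrightarrow> good K (good_const K)"
  unfolding good_const_def by (rule someI)

end

section \<open>The game and its two kernels\<close>

locale game = filtered T M F for T :: real and M :: "'a measure" and F :: "real \<Rightarrow> 'a measure" +
  fixes lam :: real and N :: nat and A1 A2h A3 :: "real \<Rightarrow> real \<Rightarrow> real"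
    and b :: "nat \<Rightarrow> real \<Rightarrow> 'a \<Rightarrow> real" and c :: "nat \<Rightarrow> 'a \<Rightarrow> real"
  assumes N2: "N \<ge> 2" and b_adm: "\<And>i. i \<in> {0..N} \<Longrightarrow> admissible M F T (b i)"
    and c_int: "\<And>i. i \<in> {1..N} \<Longrightarrow> integrable M (c i)" and lam_pos: "lam > 0"
    and A1: "kernel_class T A1" and A2: "kernel_class T A2h" and A3: "kernel_class T A3"
begin

abbreviation H :: "real \<Rightarrow> real \<Rightarrow> real" where "H \<equiv> Hker N A1 A3"
abbreviation G :: "real \<Rightarrow> real \<Rightarrow> real" where "G \<equiv> Gker N A1 A2h A3"
abbreviation Kh :: "real \<Rightarrow> real \<Rightarrow> real" where "Kh \<equiv> Khat N A1 A2h A3"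
abbreviation Kb :: "real \<Rightarrow> real \<Rightarrow> real" where "Kb \<equiv> Kbar N A1 A2h A3"

lemma N_pos: "real N > 0" using N2 by simp

text \<open>The \<open>A1\<close> parts of \<open>G\<close> and \<open>H / N\<close> cancel and half
  of the \<open>A3\<close> part remains; what is left is visibly nonnegative definite.\<close>

lemma Khat_eq: "Kh = (\<lambda>t s. A3 t s / real N + A2h t s)"
  using N_pos by (auto simp: Khat_def Gker_def Hker_def fun_eq_iff field_simps power2_eq_square)

text \<open>Moving the \<open>H\<close> term from the source to the left-hand side turns the
  player's kernel into the kernel of the average.\<close>

lemma Kbar_eq: "Kb = (\<lambda>t s. H t s + Kh t s)"
  using N_pos by (auto simp: Kbar_def Khat_def fun_eq_iff field_simps)

lemma good_A: "good A1 (good_const A1)" "good A2h (good_const A2h)" "good A3 (good_const A3)"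
  by (rule kernel_class_good[OF A1], erule good_good_const, rule kernel_class_good[OF A2], erule good_good_const,
      rule kernel_class_good[OF A3], erule good_good_const)

lemma good_HGK: "good H (good_const H)" "good G (good_const G)" "good Kh (good_const Kh)" "good Kb (good_const Kb)"
proof -
  note a = good_A
  have H: "H = (\<lambda>t s. (1 / real N) * A1 t s + A3 t s)" by (simp add: Hker_def fun_eq_iff)
  have G: "G = (\<lambda>t s. (1 / (real N)\<^sup>2) * A1 t s + (2 / real N) * A3 t s + A2h t s)" by (simp add: Gker_def fun_eq_iff)
  have K: "Kh = (\<lambda>t s. (1 / real N) * A3 t s + A2h t s)" by (simp add: Khat_eq fun_eq_iff)
  have p: "0 \<le> 1 / real N" "0 \<le> 1 / (real N)\<^sup>2" "0 \<le> 2 / real N" by simp_all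
  note C = good_add[OF good_cmult[OF a(1) p(1)] a(3), folded H]
  note C' = good_add[OF good_cmult[OF a(3) p(1)] a(2), folded K]
  note C'' = good_add[OF good_add[OF good_cmult[OF a(1) p(2)] good_cmult[OF a(3) p(3)]] a(2), folded G]
  show "good H (good_const H)" by (rule good_good_const[OF C])
  show "good G (good_const G)" by (rule good_good_const[OF C''])
  show "good Kh (good_const Kh)" by (rule good_good_const[OF C'])
  show "good Kb (good_const Kb)" using good_good_const[OF good_add[OF C C']] unfolding Kbar_eq .
qed

lemma borel_kernels:
  "case_prod H \<in> borel_measurable (lborel \<Otimes>\<^sub>M lborel)" "case_prod Kh \<in> borel_measurable (lborel \<Otimes>\<^sub>M lborel)"
  "case_prod Kb \<in> borel_measurable (lborel \<Otimes>\<^sub>M lborel)"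
proof -
  have [measurable]: "case_prod A1 \<in> borel_measurable (lborel \<Otimes>\<^sub>M lborel)" "case_prod A2h \<in> borel_measurable (lborel \<Otimes>\<^sub>M lborel)"
    "case_prod A3 \<in> borel_measurable (lborel \<Otimes>\<^sub>M lborel)"
    using A1 A2 A3 by (auto simp: kernel_class_def)
  have "(\<lambda>p. case_prod A1 p / real N + case_prod A3 p) \<in> borel_measurable (lborel \<Otimes>\<^sub>M lborel)" by measurable
  then show H[measurable]: "case_prod H \<in> borel_measurable (lborel \<Otimes>\<^sub>M lborel)" by (simp add: Hker_def case_prod_beta')
  have "(\<lambda>p. case_prod A3 p / real N + case_prod A2h p) \<in> borel_measurable (lborel \<Otimes>\<^sub>M lborel)" by measurable
  then show K[measurable]: "case_prod Kh \<in> borel_measurable (lborel \<Otimes>\<^sub>M lborel)" by (simp add: Khat_eq case_prod_beta')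
  have "(\<lambda>p. case_prod H p + case_prod Kh p) \<in> borel_measurable (lborel \<Otimes>\<^sub>M lborel)" by measurable
  then show "case_prod Kb \<in> borel_measurable (lborel \<Otimes>\<^sub>M lborel)" by (simp add: Kbar_eq case_prod_beta')
qed

sublocale VH: volterra_filtered T Kh "good_const Kh" lam M F
  using good_HGK lam_pos borel_kernels by unfold_locales

sublocale VB: volterra_filtered T Kb "good_const Kb" lam M F
  using good_HGK lam_pos borel_kernels by unfold_locales

abbreviation Hs :: "real \<Rightarrow> real \<Rightarrow> real" where "Hs \<equiv> (\<lambda>s r. H s r + adj H s r)"

lemma rowbd_H: "rowbd H (good_const H)" "rowbd (adj H) (good_const H)"
  and rowbd_G: "rowbd G (good_const G)" "rowbd (adj G) (good_const G)"
  using good_HGK by (auto simp: good_def)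

lemma rowbd_Hs: "rowbd Hs (4 * good_const H)"
  using rowbd_add[OF rowbd_H] by simp

lemma Dtil_eq: "sq_int I f \<Longrightarrow> s \<in> {0..T} \<Longrightarrow> Dtil T N lam A1 A2h A3 t f s = VH.D t f s"
proof -
  have "(\<lambda>s r. - 1 / real N * H s r + G s r) = Kh" by (simp add: Khat_def fun_eq_iff)
  then show "sq_int I f \<Longrightarrow> s \<in> {0..T} \<Longrightarrow> Dtil T N lam A1 A2h A3 t f s = VH.D t f s"
    unfolding Dtil_def using Dop_eq_symD[OF rowbd_H rowbd_G, of f s lam "- 1 / real N" t] by simp
qed

lemma Dbar_eq: "sq_int I f \<Longrightarrow> s \<in> {0..T} \<Longrightarrow> Dbar T N lam A1 A2h A3 t f s = VB.D t f s"
proof -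
  have "(\<lambda>s r. (real N - 1) / real N * H s r + G s r) = Kb" by (simp add: Kbar_def fun_eq_iff)
  then show "sq_int I f \<Longrightarrow> s \<in> {0..T} \<Longrightarrow> Dbar T N lam A1 A2h A3 t f s = VB.D t f s"
    unfolding Dbar_def using Dop_eq_symD[OF rowbd_H rowbd_G, of f s lam "(real N - 1) / real N" t] by simp
qed

lemma op_inv_Dtil: "op_inv T (Dtil T N lam A1 A2h A3 t) = op_inv T (VH.D t)"
  by (rule op_inv_cong[OF Dtil_eq])

lemma op_inv_Dbar: "op_inv T (Dbar T N lam A1 A2h A3 t) = op_inv T (VB.D t)"
  by (rule op_inv_cong[OF Dbar_eq])

lemma invertible_Dtil: "invertible_op T (Dtil T N lam A1 A2h A3 t)"
  by (rule invertible_op_cong[OF Dtil_eq[symmetric] VH.D_invertible])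

lemma invertible_Dbar: "invertible_op T (Dbar T N lam A1 A2h A3 t)"
  by (rule invertible_op_cong[OF Dbar_eq[symmetric] VB.D_invertible])

lemma Bker_Dtil: "Bker T lam (Dtil T N lam A1 A2h A3) Kh = VH.B"
  by (auto simp: Bker_def op_inv_Dtil fun_eq_iff)

lemma Bker_Dbar: "Bker T lam (Dbar T N lam A1 A2h A3) Kb = VB.B"
  by (auto simp: Bker_def op_inv_Dbar fun_eq_iff)

lemma acoef_Dtil: "acoef T lam (Dtil T N lam A1 A2h A3) K X Y t \<omega> = acoef T lam VH.D K X Y t \<omega>"
  by (simp add: acoef_def op_inv_Dtil)

lemma acoef_Dbar: "acoef T lam (Dbar T N lam A1 A2h A3) K X Y t \<omega> = acoef T lam VB.D K X Y t \<omega>"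
  by (simp add: acoef_def op_inv_Dbar)

definition ubar :: "(nat \<Rightarrow> real \<Rightarrow> 'a \<Rightarrow> real) \<Rightarrow> real \<Rightarrow> 'a \<Rightarrow> real" where
  "ubar u s \<omega> = (\<Sum>j\<in>{1..N}. u j s \<omega>) / real N"

lemma ubar_psq: "\<forall>j\<in>{1..N}. psq (u j) \<Longrightarrow> psq (ubar u)"
  using psq_cmult[OF psq_sum, of "{1..N}" u "1 / real N"] by (simp add: ubar_def[abs_def])

lemma ubar_admissible: "\<forall>j\<in>{1..N}. admissible M F T (u j) \<Longrightarrow> admissible M F T (ubar u)"
  using admissible_cmult[OF admissible_sum, of "{1..N}" u "1 / real N"] by (simp add: ubar_def[abs_def])

lemma ubar_eqv: "\<forall>j\<in>{1..N}. eqv (u j) (v j) \<Longrightarrow> eqv (ubar u) (ubar v)"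
  using eqv_add_scaled[OF eqv_refl[of "\<lambda>_ _. 0"] eqv_sum, of "{1..N}" u v "1 / real N"] by (simp add: ubar_def[abs_def])

lemma b_psq: "i \<in> {0..N} \<Longrightarrow> psq (b i)"
  by (rule admissible_psq[OF b_adm])

abbreviation f_of :: "(real \<Rightarrow> 'a \<Rightarrow> real) \<Rightarrow> nat \<Rightarrow> real \<Rightarrow> 'a \<Rightarrow> real" where
  "f_of ub i \<equiv> fi T N A1 A3 b ub i"

abbreviation Hproc :: "(real \<Rightarrow> 'a \<Rightarrow> real) \<Rightarrow> real \<Rightarrow> 'a \<Rightarrow> real" where
  "Hproc ub \<equiv> (\<lambda>s \<omega>. kop T Hs (\<lambda>r. ub r \<omega>) s)"

lemma f_of_psq: "i \<in> {1..N} \<Longrightarrow> psq ub \<Longrightarrow> psq (f_of ub i)"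
  using psq_diff[OF psq_add_scaled[OF b_psq[of i] b_psq[of 0], of "1 / real N"] psq_kop[OF rowbd_Hs, of ub]]
  by (simp add: fi_def)

lemma f_of_proc:
  assumes i: "i \<in> {1..N}" and ub: "case_prod ub \<in> borel_measurable (I \<Otimes>\<^sub>M M)"
  shows "proc (f_of ub i)"
proof -
  have 1: "proc (b i)" "proc (b 0)" using i by (auto intro!: progressive_proc admissible_progressive b_adm)
  note 2 = measurable_kop_process[OF measurable_sym_kernel[OF borel_kernels(1)] ub]
  have "(\<lambda>p. case_prod (b i) p + case_prod (b 0) p / real N - (case p of (s, \<omega>) \<Rightarrow> Hproc ub s \<omega>)) \<in> borel_measurable (J \<Otimes>\<^sub>M M)"
    by (intro borel_measurable_diff borel_measurable_add borel_measurable_divide borel_measurable_const 1 2)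
  then show ?thesis by (simp add: fi_def case_prod_beta')
qed

lemma f_of_eqv:
  assumes "psq u" "psq v" "eqv u v"
  shows "eqv (f_of u i) (f_of v i)"
  using eqv_add_scaled[OF eqv_refl[of "\<lambda>s \<omega>. b i s \<omega> + b 0 s \<omega> / real N"] eqv_kop[OF rowbd_Hs assms], of "-1"]
  by (simp add: fi_def)

lemma fbar_adm: "admissible M F T (fbar N b)"
proof -
  have "admissible M F T (\<lambda>s \<omega>. ubar b s \<omega> + (1 / real N) * b 0 s \<omega>)"
    by (intro admissible_add_scaled ubar_admissible ballI b_adm) auto
  then show ?thesis by (simp add: fbar_def[abs_def] ubar_def)
qed

lemma payoff_eq:
  "payoff M T N lam A1 A2h A3 b c u i
   = (\<integral>\<omega>. Jpath lam A1 A2h A3 (\<lambda>t. b i t \<omega>) (\<lambda>t. b 0 t \<omega>) (\<lambda>t. u i t \<omega>) (\<lambda>t. ubar u t \<omega>) + c i \<omega> \<partial>M)"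
  by (simp add: payoff_def Jpath_def ubar_def Let_def)

lemma integrable_form: "rowbd K C \<Longrightarrow> psq u \<Longrightarrow> psq v \<Longrightarrow> integrable M (\<lambda>\<omega>. ip T (\<lambda>t. u t \<omega>) (kop T K (\<lambda>t. v t \<omega>)))"
  unfolding ip_def by (rule integrable_path_product[OF _ psq_kop])

lemma integrable_inner: "psq u \<Longrightarrow> psq v \<Longrightarrow> integrable M (\<lambda>\<omega>. ip T (\<lambda>t. u t \<omega>) (\<lambda>t. v t \<omega>))"
  unfolding ip_def by (rule integrable_path_product)

lemma rowbd_A: "rowbd A1 (good_const A1)" "rowbd A2h (good_const A2h)" "rowbd (\<lambda>s r. A3 s r + adj A3 s r) (4 * good_const A3)"
proof -
  show "rowbd A1 (good_const A1)" "rowbd A2h (good_const A2h)" using good_A by (auto simp: good_def)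
  show "rowbd (\<lambda>s r. A3 s r + adj A3 s r) (4 * good_const A3)"
    using rowbd_add[of A3 "good_const A3" "adj A3" "good_const A3"] good_A(3) by (simp add: good_def)
qed

lemma integrable_Jpath:
  assumes "psq \<beta>" "psq \<gamma>" "psq f" "psq g"
  shows "integrable M (\<lambda>\<omega>. Jpath lam A1 A2h A3 (\<lambda>t. \<beta> t \<omega>) (\<lambda>t. \<gamma> t \<omega>) (\<lambda>t. f t \<omega>) (\<lambda>t. g t \<omega>))"
  unfolding Jpath_def
  by (intro Bochner_Integration.integrable_add Bochner_Integration.integrable_diff Bochner_Integration.integrable_minus
      integrable_mult_right integrable_form[OF rowbd_A(1)] integrable_form[OF rowbd_A(2)] integrable_form[OF rowbd_A(3)] integrable_inner assms)

definition EQ :: "(real \<Rightarrow> 'a \<Rightarrow> real) \<Rightarrow> real" where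
  "EQ w = (\<integral>\<omega>. Qpath (real N) lam A1 A2h A3 (\<lambda>t. w t \<omega>) \<partial>M)"

lemma integrable_Qpath:
  assumes "psq w" shows "integrable M (\<lambda>\<omega>. Qpath (real N) lam A1 A2h A3 (\<lambda>t. w t \<omega>))"
  unfolding Qpath_def
  by (intro Bochner_Integration.integrable_add integrable_divide
      integrable_mult_right integrable_form[OF rowbd_A(1)] integrable_form[OF rowbd_A(2)] integrable_form[OF rowbd_A(3)] integrable_inner assms)

lemma EQ_nonneg:
  assumes "psq w" shows "0 \<le> EQ w"
  unfolding EQ_def
proof (rule integral_nonneg_AE)
  show "AE \<omega> in M. 0 \<le> Qpath (real N) lam A1 A2h A3 (\<lambda>t. w t \<omega>)"
    using psq_paths[OF assms] by eventually_elim (rule Qpath_nonneg[OF good_A N_pos], use lam_pos in auto)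
qed

text \<open>A unilateral deviation by \<open>e * w\<close> moves the average by
  \<open>(e / N) * w\<close>, which is the perturbation expanded above with \<open>n = N\<close>.
  The external terms have finite expectation, so the pathwise identity can be integrated.\<close>

lemma payoff_perturb:
  assumes u: "\<forall>j\<in>{1..N}. psq (u j)" and w: "psq w" and i: "i \<in> {1..N}"
  shows "payoff M T N lam A1 A2h A3 b c (u(i := (\<lambda>s \<omega>. u i s \<omega> + e * w s \<omega>))) i
    = payoff M T N lam A1 A2h A3 b c u i + e * (E2 w (f_of (ubar u) i) - E2 w (VH.Lop (u i))) - e\<^sup>2 * EQ w"
proof -
  let ?u' = "u(i := (\<lambda>s \<omega>. u i s \<omega> + e * w s \<omega>))"
  note g = ubar_psq[OF u] and f = bspec[OF u i]
  have i0: "i \<in> {0..N}" "0 \<in> {0..N}" using i by auto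
  have ub': "ubar ?u' s \<omega> = ubar u s \<omega> + (e / real N) * w s \<omega>" for s \<omega>
  proof -
    have "(\<Sum>j\<in>{1..N}. ?u' j s \<omega>) = (\<Sum>j\<in>{1..N}. u j s \<omega>) + e * w s \<omega>"
    proof -
      have "(\<Sum>j\<in>{1..N}. ?u' j s \<omega>) = ?u' i s \<omega> + (\<Sum>j\<in>{1..N} - {i}. ?u' j s \<omega>)"
        by (rule sum.remove[OF _ i]) simp
      also have "(\<Sum>j\<in>{1..N} - {i}. ?u' j s \<omega>) = (\<Sum>j\<in>{1..N} - {i}. u j s \<omega>)"
        by (rule sum.cong) auto
      finally show ?thesis using sum.remove[OF _ i, of "\<lambda>j. u j s \<omega>"] by simp
    qed
    then show ?thesis by (simp add: ubar_def add_divide_distrib)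
  qed
  have fq: "psq (f_of (ubar u) i)" by (rule f_of_psq[OF i g])
  note Lq = VH.psq_Lop[OF f]
  define \<xi> where "\<xi> s \<omega> = f_of (ubar u) i s \<omega> - VH.Lop (u i) s \<omega>" for s \<omega>
  have \<xi>q: "psq \<xi>" using psq_diff[OF fq Lq] by (simp add: \<xi>_def[abs_def])
  have E\<xi>: "E2 w \<xi> = E2 w (f_of (ubar u) i) - E2 w (VH.Lop (u i))"
    using E2_add_scaled[OF w fq Lq, of "-1"] by (simp add: \<xi>_def[abs_def])
  define j where "j \<omega> = Jpath lam A1 A2h A3 (\<lambda>t. b i t \<omega>) (\<lambda>t. b 0 t \<omega>) (\<lambda>t. u i t \<omega>) (\<lambda>t. ubar u t \<omega>) + c i \<omega>" for \<omega>
  define j' where "j' \<omega> = Jpath lam A1 A2h A3 (\<lambda>t. b i t \<omega>) (\<lambda>t. b 0 t \<omega>) (\<lambda>t. ?u' i t \<omega>) (\<lambda>t. ubar ?u' t \<omega>) + c i \<omega>" for \<omega>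
  have ui': "?u' i = (\<lambda>s \<omega>. u i s \<omega> + e * w s \<omega>)" by simp
  have ji: "integrable M j" unfolding j_def[abs_def]
    by (intro Bochner_Integration.integrable_add integrable_Jpath b_psq i0 f g c_int i)
  have ji': "integrable M j'" unfolding j'_def[abs_def] ub' ui'
    by (intro Bochner_Integration.integrable_add integrable_Jpath b_psq i0 f g w c_int i psq_add_scaled)
  note wi = integrable_path_product[OF w \<xi>q] and qi = integrable_Qpath[OF w]
  have "AE \<omega> in M. j' \<omega> = j \<omega> + e * (\<integral>s. w s \<omega> * \<xi> s \<omega> \<partial>I) - e\<^sup>2 * Qpath (real N) lam A1 A2h A3 (\<lambda>t. w t \<omega>)"
    using psq_paths[OF f] psq_paths[OF g] psq_paths[OF w] psq_paths[OF b_psq[OF i0(1)]] psq_paths[OF b_psq[OF i0(2)]]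
  proof eventually_elim
    case (elim \<omega>)
    show ?case
      unfolding j_def j'_def ub' ui'
        Jpath_perturb[OF good_A N_pos elim(1-5), of lam e] \<xi>_def fi_def VH.Lop_def
      by (simp add: Hker_def Khat_eq)
  qed
  then have "(\<integral>\<omega>. j' \<omega> \<partial>M) = (\<integral>\<omega>. j \<omega> + e * (\<integral>s. w s \<omega> * \<xi> s \<omega> \<partial>I) - e\<^sup>2 * Qpath (real N) lam A1 A2h A3 (\<lambda>t. w t \<omega>) \<partial>M)"
    by (intro integral_cong_AE) (use ji ji' wi qi in auto)
  also have "\<dots> = (\<integral>\<omega>. j \<omega> \<partial>M) + e * E2 w \<xi> - e\<^sup>2 * EQ w"
    using ji wi qi by (simp add: EQ_def E2_eq[OF w \<xi>q])
  finally show ?thesis by (simp add: payoff_eq j_def j'_def E\<xi>)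
qed

text \<open>The payoff is concave in the own strategy because \<open>EQ\<close> is nonnegative, so
  stationarity is equivalent to optimality. For sufficiency the deviation \<open>v - u i\<close> is
  inserted with \<open>e = 1\<close>.\<close>

lemma Nash_iff_weak:
  assumes u: "\<forall>j\<in>{1..N}. admissible M F T (u j)"
  shows "is_Nash M F T N lam A1 A2h A3 b c u \<longleftrightarrow> (\<forall>i\<in>{1..N}. VH.weak (u i) (f_of (ubar u) i))"
proof
  have uq: "\<forall>j\<in>{1..N}. psq (u j)" using u admissible_psq by blast
  assume nash: "is_Nash M F T N lam A1 A2h A3 b c u"
  show "\<forall>i\<in>{1..N}. VH.weak (u i) (f_of (ubar u) i)"
    unfolding VH.weak_def
  proof (intro ballI allI impI)
    fix i w assume i: "i \<in> {1..N}" and w: "admissible M F T w"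
    define L where "L = E2 w (f_of (ubar u) i) - E2 w (VH.Lop (u i))"
    \<comment> \<open>With vanishing constant term the discriminant inequality forces the slope
      \<open>L\<close> to be zero.\<close>
    have "0 \<le> 0 + 2 * e * (- L / 2) + e\<^sup>2 * EQ w" for e
    proof -
      have "payoff M T N lam A1 A2h A3 b c (u(i := (\<lambda>s \<omega>. u i s \<omega> + e * w s \<omega>))) i \<le> payoff M T N lam A1 A2h A3 b c u i"
        using nash i admissible_add_scaled[OF bspec[OF u i] w, of e] by (simp add: is_Nash_def)
      moreover have "payoff M T N lam A1 A2h A3 b c (u(i := (\<lambda>s \<omega>. u i s \<omega> + e * w s \<omega>))) i
          = payoff M T N lam A1 A2h A3 b c u i + e * L - e\<^sup>2 * EQ w"
        unfolding L_def by (rule payoff_perturb[OF uq admissible_psq[OF w] i])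
      ultimately show ?thesis by simp
    qed
    from quadratic_nonneg_discriminant[OF this] have "L = 0" by simp
    then show "E2 w (VH.Lop (u i)) = E2 w (f_of (ubar u) i)" by (simp add: L_def)
  qed
next
  have uq: "\<forall>j\<in>{1..N}. psq (u j)" using u admissible_psq by blast
  assume wk: "\<forall>i\<in>{1..N}. VH.weak (u i) (f_of (ubar u) i)"
  show "is_Nash M F T N lam A1 A2h A3 b c u"
    unfolding is_Nash_def
  proof (intro conjI ballI allI impI)
    fix i v assume i: "i \<in> {1..N}" and v: "admissible M F T v"
    define w where "w s \<omega> = v s \<omega> + (-1) * u i s \<omega>" for s \<omega>
    have w: "admissible M F T w" unfolding w_def[abs_def] by (rule admissible_add_scaled[OF v bspec[OF u i]])
    have "(\<lambda>s \<omega>. u i s \<omega> + 1 * w s \<omega>) = v" by (simp add: w_def fun_eq_iff)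
    then have "payoff M T N lam A1 A2h A3 b c (u(i := v)) i
      = payoff M T N lam A1 A2h A3 b c u i + (E2 w (f_of (ubar u) i) - E2 w (VH.Lop (u i))) - EQ w"
      using payoff_perturb[OF uq admissible_psq[OF w] i, where e=1] by simp
    then show "payoff M T N lam A1 A2h A3 b c (u(i := v)) i \<le> payoff M T N lam A1 A2h A3 b c u i"
      using wk i w EQ_nonneg[OF admissible_psq[OF w]] by (simp add: VH.weak_def)
  qed (rule bspec[OF u])
qed

section \<open>The equation of the average\<close>

lemma VB_Lop: "psq u \<Longrightarrow> eqv (VB.Lop u) (\<lambda>s \<omega>. VH.Lop u s \<omega> + 1 * Hproc u s \<omega>)"
  unfolding eqv_def
proof (drule psq_paths, erule eventually_mono)
  fix \<omega> assume u: "sq_int I (\<lambda>s. u s \<omega>)"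
  have "VB.Ks = (\<lambda>s r. Hs s r + VH.Ks s r)" by (auto simp: Kbar_eq adj_def fun_eq_iff)
  then have "kop T VB.Ks (\<lambda>r. u r \<omega>) s = kop T Hs (\<lambda>r. u r \<omega>) s + kop T VH.Ks (\<lambda>r. u r \<omega>) s" if "s \<in> {0..T}" for s
    by (simp only: kop_add_kernel[OF rowbd_Hs VH.rowbd_Ks u that])
  then show "aeq T (\<lambda>s. VB.Lop u s \<omega>) (\<lambda>s. VH.Lop u s \<omega> + 1 * Hproc u s \<omega>)"
    unfolding aeq_def VB.Lop_def VH.Lop_def symD_def by (intro AE_I2) simp
qed

text \<open>A process solves the averaged equation exactly when it solves the players' equation with
  its own \<open>H\<close> term placed in the source.\<close>

lemma VB_weak_iff:
  assumes u: "psq u"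
  shows "VB.weak u (fbar N b) \<longleftrightarrow> VH.weak u (\<lambda>s \<omega>. fbar N b s \<omega> - Hproc u s \<omega>)"
proof -
  note fq = admissible_psq[OF fbar_adm] and hq = psq_kop[OF rowbd_Hs u] and Lq = VH.psq_Lop[OF u]
  have "E2 v (VB.Lop u) = E2 v (VH.Lop u) + E2 v (Hproc u)"
    and "E2 v (\<lambda>s \<omega>. fbar N b s \<omega> - Hproc u s \<omega>) = E2 v (fbar N b) - E2 v (Hproc u)" if "psq v" for v
    using E2_cong[OF that VB.psq_Lop[OF u] psq_add_scaled[OF Lq hq] VB_Lop[OF u]] E2_add_scaled[OF that Lq hq, of 1]
      E2_add_scaled[OF that fq hq, of "-1"] by simp_all
  note eqs = this[OF admissible_psq]
  have "(E2 v (VB.Lop u) = E2 v (fbar N b)) = (E2 v (VH.Lop u) = E2 v (\<lambda>s \<omega>. fbar N b s \<omega> - Hproc u s \<omega>))"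
    if v: "admissible M F T v" for v
    using eqs[OF v] by linarith
  then show ?thesis unfolding VB.weak_def VH.weak_def by simp
qed

lemma VH_weak_average:
  assumes u: "\<forall>i\<in>{1..N}. psq (u i)" and f: "\<forall>i\<in>{1..N}. psq (f i)"
    and wk: "\<forall>i\<in>{1..N}. VH.weak (u i) (f i)"
  shows "VH.weak (ubar u) (ubar f)"
proof -
  have lin: "VH.weak (\<lambda>s \<omega>. x s \<omega> + d * y s \<omega>) (\<lambda>s \<omega>. g s \<omega> + d * h s \<omega>)"
    if xy: "psq x" "psq y" and gh: "psq g" "psq h" and "VH.weak x g" "VH.weak y h" for x y g h d
    unfolding VH.weak_def
  proof (intro allI impI)
    fix v assume v: "admissible M F T v"
    note vq = admissible_psq[OF v]
    have m: "case_prod (VH.Lop (\<lambda>s \<omega>. x s \<omega> + d * y s \<omega>)) \<in> borel_measurable (I \<Otimes>\<^sub>M M)"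
      by (rule sq_int_measurable[OF VH.psq_Lop[OF psq_add_scaled[OF xy]]])
    note [measurable] = m vq[THEN sq_int_measurable] VH.psq_Lop[OF xy(1), THEN sq_int_measurable] VH.psq_Lop[OF xy(2), THEN sq_int_measurable]
    have "E2 v (VH.Lop (\<lambda>s \<omega>. x s \<omega> + d * y s \<omega>)) = (\<integral>p. case_prod v p * case_prod (VH.Lop x) p + d * (case_prod v p * case_prod (VH.Lop y) p) \<partial>(I \<Otimes>\<^sub>M M))"
      unfolding E2_def
    proof (rule integral_cong_AE)
      show "AE p in I \<Otimes>\<^sub>M M. case_prod v p * case_prod (VH.Lop (\<lambda>s \<omega>. x s \<omega> + d * y s \<omega>)) p
         = case_prod v p * case_prod (VH.Lop x) p + d * (case_prod v p * case_prod (VH.Lop y) p)"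
        using VH.Lop_linear[OF xy, of d] by eventually_elim (simp only: distrib_left mult.left_commute)
    qed measurable
    also have "\<dots> = E2 v (VH.Lop x) + d * E2 v (VH.Lop y)"
      unfolding E2_def
      using sq_int_mult_integrable[OF vq VH.psq_Lop[OF xy(1)]] sq_int_mult_integrable[OF vq VH.psq_Lop[OF xy(2)]] by simp
    also have "\<dots> = E2 v (\<lambda>s \<omega>. g s \<omega> + d * h s \<omega>)"
      unfolding E2_add_scaled[OF vq gh] using that(5,6) v by (simp add: VH.weak_def)
    finally show "E2 v (VH.Lop (\<lambda>s \<omega>. x s \<omega> + d * y s \<omega>)) = E2 v (\<lambda>s \<omega>. g s \<omega> + d * h s \<omega>)" .
  qed
  have zero: "VH.weak (\<lambda>s \<omega>. 0) (\<lambda>s \<omega>. 0)"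
    by (simp add: VH.weak_def VH.Lop_def[abs_def] symD_def kop_def E2_zero)
  have pz: "psq (\<lambda>s \<omega>. 0)" by (rule admissible_psq[OF admissible_zero])
  have "VH.weak (\<lambda>s \<omega>. \<Sum>i\<in>A. u i s \<omega>) (\<lambda>s \<omega>. \<Sum>i\<in>A. f i s \<omega>)" if "finite A" "A \<subseteq> {1..N}" for A
    using that
  proof (induction A rule: finite_induct)
    case (insert x A)
    have "VH.weak (\<lambda>s \<omega>. u x s \<omega> + 1 * (\<Sum>i\<in>A. u i s \<omega>)) (\<lambda>s \<omega>. f x s \<omega> + 1 * (\<Sum>i\<in>A. f i s \<omega>))"
      by (rule lin) (use insert u f wk in \<open>auto intro!: psq_sum\<close>)
    then show ?case using insert by simp
  qed (simp add: zero)
  then have sum: "VH.weak (\<lambda>s \<omega>. \<Sum>i\<in>{1..N}. u i s \<omega>) (\<lambda>s \<omega>. \<Sum>i\<in>{1..N}. f i s \<omega>)" by blast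
  have "VH.weak (\<lambda>s \<omega>. 0 + (1 / real N) * (\<Sum>i\<in>{1..N}. u i s \<omega>)) (\<lambda>s \<omega>. 0 + (1 / real N) * (\<Sum>i\<in>{1..N}. f i s \<omega>))"
    by (rule lin[OF pz _ pz _ zero sum]) (use u f in \<open>auto intro!: psq_sum\<close>)
  then show ?thesis by (simp add: ubar_def[abs_def])
qed

lemma ubar_f_of: "ubar (f_of ub) = (\<lambda>s \<omega>. fbar N b s \<omega> - Hproc ub s \<omega>)"
proof (intro ext)
  fix s \<omega>
  have "ubar (f_of ub) s \<omega> = ((\<Sum>j\<in>{1..N}. b j s \<omega>) + real N * (b 0 s \<omega> / real N) - real N * Hproc ub s \<omega>) / real N"
    by (simp add: ubar_def fi_def sum.distrib sum_subtractf)
  then show "ubar (f_of ub) s \<omega> = fbar N b s \<omega> - Hproc ub s \<omega>"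
    using N_pos by (simp add: fbar_def add_divide_distrib diff_divide_distrib)
qed

text \<open>The process \<open>w\<close> in the source is arbitrary: with the true average it yields
  the necessary condition, with a candidate it closes the loop in the existence proof.\<close>

lemma VH_weak_solutions_average:
  assumes u: "\<forall>i\<in>{1..N}. admissible M F T (u i)" and w: "admissible M F T w"
    and wk: "\<forall>i\<in>{1..N}. VH.weak (u i) (f_of w i)"
  shows "VH.weak (ubar u) (\<lambda>s \<omega>. fbar N b s \<omega> - Hproc w s \<omega>)"
proof -
  have "\<forall>i\<in>{1..N}. psq (u i)" using u admissible_psq by blast
  moreover have "\<forall>i\<in>{1..N}. psq (f_of w i)" using f_of_psq admissible_psq[OF w] by blast
  ultimately have "VH.weak (ubar u) (ubar (f_of w))" using wk by (rule VH_weak_average)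
  then show ?thesis unfolding ubar_f_of .
qed

section \<open>Identification of the equilibrium\<close>

lemma ubar_proc_representation:
  assumes w: "admissible M F T w" "VB.weak w (fbar N b)" and Ybar: "cond_version M F T (fbar N b) Ybar"
  shows "AE \<omega> in M. (\<lambda>s. ubar_proc T N lam A1 A2h A3 b Ybar s \<omega>) \<in> borel_measurable I"
    and "eqv w (ubar_proc T N lam A1 A2h A3 b Ybar)"
proof -
  have rep: "AE \<omega> in M. sq_int I (\<lambda>s. ubar_proc T N lam A1 A2h A3 b Ybar s \<omega>) \<and> aeq T (\<lambda>t. w t \<omega>) (\<lambda>s. ubar_proc T N lam A1 A2h A3 b Ybar s \<omega>)"
    unfolding ubar_proc_def Bker_Dbar acoef_Dbar
    by (rule VB.weak_representation[OF w progressive_proc[OF admissible_progressive[OF fbar_adm]] admissible_psq[OF fbar_adm] Ybar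
          sq_int_measurable[OF admissible_psq[OF fbar_adm]] adapted_cond_exp[OF fbar_adm]])
  then show "AE \<omega> in M. (\<lambda>s. ubar_proc T N lam A1 A2h A3 b Ybar s \<omega>) \<in> borel_measurable I"
    by (rule eventually_mono) (auto intro: sq_int_measurable)
  show "eqv w (ubar_proc T N lam A1 A2h A3 b Ybar)"
    unfolding eqv_def using rep by (rule eventually_mono) (rule conjunct2)
qed

text \<open>At each time \<open>s\<close> the integral operator depends only on the class of the
  path, so replacing the chosen inverse by the progressive solution changes the source by a null set
  of scenarios for every \<open>s\<close>.\<close>

lemma cond_version_f_of_ubar_proc:
  assumes w: "admissible M F T w" "VB.weak w (fbar N b)" and Ybar: "cond_version M F T (fbar N b) Ybar" and i: "i \<in> {1..N}"
  shows "cond_version M F T (f_of (ubar_proc T N lam A1 A2h A3 b Ybar) i) Y \<longleftrightarrow> cond_version M F T (f_of w i) Y"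
proof (rule cond_version_cong)
  note rep = ubar_proc_representation[OF w Ybar] and wq = admissible_psq[OF w(1)]
  show "proc (f_of w i)" by (rule f_of_proc[OF i sq_int_measurable[OF wq]])
  fix s assume s: "s \<in> {0..T}"
  show "AE \<omega> in M. f_of (ubar_proc T N lam A1 A2h A3 b Ybar) i s \<omega> = f_of w i s \<omega>"
    using eqv_kop_pointwise[OF rowbd_Hs psq_paths_measurable[OF wq] rep]
    by eventually_elim (use s in \<open>simp add: fi_def\<close>)
qed

theorem equilibrium:
  assumes Ybar: "cond_version M F T (fbar N b) Ybar"
  shows "\<exists>Y. \<forall>i\<in>{1..N}. cond_version M F T (f_of (ubar_proc T N lam A1 A2h A3 b Ybar) i) (Y i)"
    and "\<forall>i\<in>{1..N}. cond_version M F T (f_of (ubar_proc T N lam A1 A2h A3 b Ybar) i) (Y i) \<Longrightarrow>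
      (\<exists>u. is_Nash M F T N lam A1 A2h A3 b c u)
      \<and> (\<forall>u. (\<forall>i\<in>{1..N}. admissible M F T (u i)) \<longrightarrow>
           (is_Nash M F T N lam A1 A2h A3 b c u \<longleftrightarrow>
            (\<forall>i\<in>{1..N}. eqv (u i) (\<lambda>t \<omega>. op_inv T (IminusB T (Bker T lam (Dtil T N lam A1 A2h A3) Kh))
                (\<lambda>s. ai_proc T N lam A1 A2h A3 (Y i) s \<omega>) t))))"
proof -
  \<comment> \<open>The candidate for the average, obtained before any strategy is known.\<close>
  obtain w where w: "admissible M F T w" "VB.weak w (fbar N b)"
    by (rule VB.weak_solution_exists[OF admissible_psq[OF fbar_adm]])
  note wq = admissible_psq[OF w(1)]
  note fw = f_of_psq[OF _ wq] and fp = f_of_proc[OF _ sq_int_measurable[OF wq]]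
  note trans = cond_version_f_of_ubar_proc[OF w Ybar]
  have "\<forall>i\<in>{1..N}. \<exists>Y. cond_version M F T (f_of w i) Y"
    using cond_version_exists[OF fp] by metis
  then show "\<exists>Y. \<forall>i\<in>{1..N}. cond_version M F T (f_of (ubar_proc T N lam A1 A2h A3 b Ybar) i) (Y i)"
    using trans by metis
  assume "\<forall>i\<in>{1..N}. cond_version M F T (f_of (ubar_proc T N lam A1 A2h A3 b Ybar) i) (Y i)"
  then have Y: "cond_version M F T (f_of w i) (Y i)" if "i \<in> {1..N}" for i
    using trans[OF that, of "Y i"] that by blast
  define a where "a i = (\<lambda>t \<omega>. op_inv T (IminusB T (Bker T lam (Dtil T N lam A1 A2h A3) Kh))
                (\<lambda>s. ai_proc T N lam A1 A2h A3 (Y i) s \<omega>) t)" for i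
  have rep: "eqv v (a i)" if i: "i \<in> {1..N}" and v: "admissible M F T v" "VH.weak v (f_of w i)" for v i
  proof -
    have "AE \<omega> in M. sq_int I (\<lambda>t. a i t \<omega>) \<and> aeq T (\<lambda>t. v t \<omega>) (\<lambda>t. a i t \<omega>)"
      unfolding a_def ai_proc_def Bker_Dtil acoef_Dtil
      by (rule VH.weak_representation[OF v fp[OF i] fw[OF i] Y[OF i] cond_version_diagonal[OF Y[OF i]]])
    then show ?thesis unfolding eqv_def by (rule eventually_mono) (rule conjunct2)
  qed
  have "\<forall>i\<in>{1..N}. \<exists>v. admissible M F T v \<and> VH.weak v (f_of w i)"
    using VH.weak_solution_exists[OF fw] by metis
  then obtain v where "\<forall>i\<in>{1..N}. admissible M F T (v i) \<and> VH.weak (v i) (f_of w i)"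
    unfolding bchoice_iff by (elim exE)
  then have v: "\<forall>i\<in>{1..N}. admissible M F T (v i)" and vw: "\<forall>i\<in>{1..N}. VH.weak (v i) (f_of w i)"
    by simp_all
  have vq: "\<forall>i\<in>{1..N}. psq (v i)" using v admissible_psq by blast
  have hw: "psq (\<lambda>s \<omega>. fbar N b s \<omega> - Hproc w s \<omega>)"
    by (rule psq_diff[OF admissible_psq[OF fbar_adm] psq_kop[OF rowbd_Hs wq]])
  have hp: "proc (\<lambda>s \<omega>. fbar N b s \<omega> - Hproc w s \<omega>)"
  proof -
    have "(\<lambda>p. case_prod (fbar N b) p - (case p of (s, \<omega>) \<Rightarrow> Hproc w s \<omega>)) \<in> borel_measurable (J \<Otimes>\<^sub>M M)"
      by (intro borel_measurable_diff progressive_proc[OF admissible_progressive[OF fbar_adm]]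
          measurable_kop_process[OF measurable_sym_kernel[OF borel_kernels(1)] sq_int_measurable[OF wq]])
    then show ?thesis by (simp add: case_prod_beta')
  qed
  have weak_transfer: "VH.weak x (f_of y i)" if "i \<in> {1..N}" "psq x" "psq x'" "eqv x' x" "psq y" "psq y'" "eqv y' y" "VH.weak x' (f_of y' i)" for x x' y y' i
    by (rule VH.weak_cong[OF that(3,2,4) f_of_psq[OF that(1,6)] f_of_psq[OF that(1,5)] f_of_eqv[OF that(6,5,7)] that(8)])
  \<comment> \<open>The loop closes: the average of the responses and \<open>w\<close> itself solve
    the same equation, with \<open>w\<close> in the source.\<close>
  have avg: "eqv (ubar v) w"
    by (rule VH.weak_unique[OF ubar_admissible[OF v] w(1) VH_weak_solutions_average[OF v w(1) vw] VB_weak_iff[OF wq, THEN iffD1, OF w(2)] hp hw])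
  have vN: "is_Nash M F T N lam A1 A2h A3 b c v"
    unfolding Nash_iff_weak[OF v]
  proof
    fix i assume i: "i \<in> {1..N}"
    show "VH.weak (v i) (f_of (ubar v) i)"
      by (rule weak_transfer[OF i bspec[OF vq i] bspec[OF vq i] eqv_refl ubar_psq[OF vq] wq eqv_sym[OF avg] bspec[OF vw i]])
  qed
  have char: "is_Nash M F T N lam A1 A2h A3 b c u \<longleftrightarrow> (\<forall>i\<in>{1..N}. eqv (u i) (a i))"
    if u: "\<forall>i\<in>{1..N}. admissible M F T (u i)" for u
  proof
    have uq: "\<forall>i\<in>{1..N}. psq (u i)" using u admissible_psq by blast
    assume "is_Nash M F T N lam A1 A2h A3 b c u"
    then have wk: "\<forall>i\<in>{1..N}. VH.weak (u i) (f_of (ubar u) i)" using Nash_iff_weak[OF u] by blast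
    note ua = ubar_admissible[OF u]
    have "VH.weak (ubar u) (\<lambda>s \<omega>. fbar N b s \<omega> - Hproc (ubar u) s \<omega>)"
      by (rule VH_weak_solutions_average[OF u ua wk])
    then have "VB.weak (ubar u) (fbar N b)" using VB_weak_iff[OF admissible_psq[OF ua]] by simp
    \<comment> \<open>Any equilibrium has an average solving the averaged equation, hence equal to
      \<open>w\<close>; its strategies are then the unique responses to \<open>w\<close>.\<close>
    then have uw: "eqv (ubar u) w"
      by (rule VB.weak_unique[OF ua w(1) _ w(2) progressive_proc[OF admissible_progressive[OF fbar_adm]] admissible_psq[OF fbar_adm]])
    show "\<forall>i\<in>{1..N}. eqv (u i) (a i)"
    proof
      fix i assume i: "i \<in> {1..N}"
      show "eqv (u i) (a i)"
        by (rule rep[OF i bspec[OF u i] weak_transfer[OF i bspec[OF uq i] bspec[OF uq i] eqv_refl wq admissible_psq[OF ua] uw bspec[OF wk i]]])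
    qed
  next
    have uq: "\<forall>i\<in>{1..N}. psq (u i)" using u admissible_psq by blast
    assume ea: "\<forall>i\<in>{1..N}. eqv (u i) (a i)"
    \<comment> \<open>Conversely, strategies given by the formula agree with the responses
      \<open>v\<close>, and the weak equations are insensitive to null sets.\<close>
    have uv: "\<forall>i\<in>{1..N}. eqv (v i) (u i)"
    proof
      fix i assume i: "i \<in> {1..N}"
      show "eqv (v i) (u i)"
        by (rule eqv_trans[OF rep[OF i bspec[OF v i] bspec[OF vw i]] eqv_sym[OF bspec[OF ea i]]])
    qed
    have ub: "eqv (ubar v) (ubar u)" by (rule ubar_eqv[OF uv])
    show "is_Nash M F T N lam A1 A2h A3 b c u"
      unfolding Nash_iff_weak[OF u]
    proof
      fix i assume i: "i \<in> {1..N}"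
      have "VH.weak (v i) (f_of (ubar v) i)" using vN Nash_iff_weak[OF v] i by blast
      then show "VH.weak (u i) (f_of (ubar u) i)"
        by (rule weak_transfer[OF i bspec[OF uq i] bspec[OF vq i] bspec[OF uv i] ubar_psq[OF uq] ubar_psq[OF vq] ub])
    qed
  qed
  show "(\<exists>u. is_Nash M F T N lam A1 A2h A3 b c u)
      \<and> (\<forall>u. (\<forall>i\<in>{1..N}. admissible M F T (u i)) \<longrightarrow>
           (is_Nash M F T N lam A1 A2h A3 b c u \<longleftrightarrow>
            (\<forall>i\<in>{1..N}. eqv (u i) (\<lambda>t \<omega>. op_inv T (IminusB T (Bker T lam (Dtil T N lam A1 A2h A3) Kh))
                (\<lambda>s. ai_proc T N lam A1 A2h A3 (Y i) s \<omega>) t))))"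
    using vN char unfolding a_def by (intro conjI exI[of _ v] allI impI) (assumption, blast)
qed

end

text \<open>The formula involves versions of conditional expectations, so the claim is made for
  every choice of them; the accompanying existence statements keep it from being vacuous. Uniqueness
  is meant up to null sets of time and scenario and is expressed by characterising all equilibria
  among admissible strategies.\<close>

theorem mainTheorem2:
  fixes M :: "'a measure" and F :: "real \<Rightarrow> 'a measure"
    and T lam :: real and N :: nat
    and A1 A2h A3 :: "real \<Rightarrow> real \<Rightarrow> real"
    and b :: "nat \<Rightarrow> real \<Rightarrow> 'a \<Rightarrow> real" and c :: "nat \<Rightarrow> 'a \<Rightarrow> real"
  assumes "prob_space M"
    and "usual_filtration M F T"
    and "T > 0" and "N \<ge> 2"
    and "\<forall>i\<in>{0..N}. admissible M F T (b i)"
    and "\<forall>i\<in>{1..N}. integrable M (c i)"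
    and "lam > 0"
    and "kernel_class T A1" and "kernel_class T A2h" and "kernel_class T A3"
  shows "(\<forall>t\<in>{0..T}. invertible_op T (Dtil T N lam A1 A2h A3 t))
       \<and> (\<forall>t\<in>{0..T}. invertible_op T (Dbar T N lam A1 A2h A3 t))
       \<and> invertible_op T (IminusB T (Bker T lam (Dtil T N lam A1 A2h A3) (Khat N A1 A2h A3)))
       \<and> invertible_op T (IminusB T (Bker T lam (Dbar T N lam A1 A2h A3) (Kbar N A1 A2h A3)))
       \<and> (\<exists>Ybar. cond_version M F T (fbar N b) Ybar)
       \<and> (\<forall>Ybar. cond_version M F T (fbar N b) Ybar \<longrightarrow>
            (\<exists>Y. \<forall>i\<in>{1..N}. cond_version M F T
                   (fi T N A1 A3 b (ubar_proc T N lam A1 A2h A3 b Ybar) i) (Y i))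
          \<and> (\<forall>Y. (\<forall>i\<in>{1..N}. cond_version M F T
                   (fi T N A1 A3 b (ubar_proc T N lam A1 A2h A3 b Ybar) i) (Y i)) \<longrightarrow>
               (\<exists>u. is_Nash M F T N lam A1 A2h A3 b c u)
             \<and> (\<forall>u. (\<forall>i\<in>{1..N}. admissible M F T (u i)) \<longrightarrow>
                   (is_Nash M F T N lam A1 A2h A3 b c u \<longleftrightarrow>
                    (\<forall>i\<in>{1..N}. AE \<omega> in M. AE t in lebesgue_on {0..T}.
                       u i t \<omega> = op_inv T (IminusB T (Bker T lam (Dtil T N lam A1 A2h A3) (Khat N A1 A2h A3)))
                                   (\<lambda>s. ai_proc T N lam A1 A2h A3 (Y i) s \<omega>) t)))))"
proof -
  interpret prob_space M by fact
  interpret game T M F lam N A1 A2h A3 b c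
    using assms by unfold_locales auto
  have "\<exists>Ybar. cond_version M F T (fbar N b) Ybar"
    using cond_version_exists[OF progressive_proc[OF admissible_progressive[OF fbar_adm]]] by metis
  then show ?thesis
    using equilibrium[unfolded eqv_def aeq_def]
    by (intro conjI ballI allI impI)
       (simp_all only: invertible_Dtil invertible_Dbar Bker_Dtil Bker_Dbar VH.IminusB_invertible VB.IminusB_invertible)
qed

end
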